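(* Let $X$ be a multilinearly stable sequence class and $Y$ be a linearly stable sequence class such that $X(\mathbb{K})^n\hookrightarrow Y(\mathbb{K})$ for every $n\in\mathbb{N}$. Then $(\mathcal{P}_{X;Y},\|\cdot\|_{X;Y;1})$ and $(\mathcal{P}_{X;Y},\|\cdot\|_{X;Y;2})$ are $\left(\frac{n^n}{n!}\right)_{n=1}^\infty$-polynomial Banach hyper-ideals.
   Context: All Banach spaces are over $\mathbb{K} = \mathbb{R}$ or $\mathbb{C}$. $\mathcal{L}(E_1,\ldots,E_n;F)$ (written $\mathcal{L}(^nE;F)$ if all $E_i=E$) is the Banach space of continuous $n$-linear operators and $\mathcal{P}(^nE;F)$ the Banach space of continuous $n$-homogeneous polynomials, with their usual sup norms. $\check P$ denotes the unique symmetric $n$-linear operator with $\check P(x,\ldots,x)=P(x)$. **Sequence class.** $E \hookrightarrow F$ means that the Banach space $E$ is a linear subspace of the Banach space $F$ and $\|x\|_F \le \|x\|_E$ for all $x\in E$. $c_{00}(E)$ is the space of eventually null $E$-valued sequences, $\ell_\infty(E)$ the Banach space of bounded $E$-valued sequences with the sup norm, and $e_j$ the $j$-th canonical scalar sequence. A sequence class is a rule $E\mapsto X(E)$ assigning to each Banach space $E$ a Banach space $X(E)$ of $E$-valued sequences (coordinatewise operations) such that $c_{00}(E)\subseteq X(E)$, $X(E)\hookrightarrow \ell_\infty(E)$ and $\|e_j\|_{X(\mathbb{K})}=1$ for every $j\in\mathbb{N}$. **Linearly stable.** $Y$ is linearly stable if for all Banach spaces $E,F$ and every $u\in\mathcal{L}(E;F)$,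 $(u(x_j))_{j=1}^\infty\in Y(F)$ whenever $(x_j)_{j=1}^\infty\in Y(E)$, and the induced linear operator $\widetilde u\colon Y(E)\to Y(F)$, $\widetilde u((x_j)_j)=(u(x_j))_j$, is continuous with $\|\widetilde u\|=\|u\|$. **Multilinearly stable.** $X$ is multilinearly stable if for all $n\in\mathbb{N}$, Banach spaces $E_1,\ldots,E_n,F$ and $A\in\mathcal{L}(E_1,\ldots,E_n;F)$, $(A(x_j^1,\ldots,x_j^n))_{j=1}^\infty\in X(F)$ whenever $(x_j^m)_{j=1}^\infty\in X(E_m)$, $m=1,\ldots,n$, and the induced $n$-linear operator $\widetilde A\colon X(E_1)\times\cdots\times X(E_n)\to X(F)$, $\widetilde A((x^1_j)_j,\ldots,(x^n_j)_j)=(A(x_j^1,\ldots,x_j^n))_j$, is continuous with $\|\widetilde A\|=\|A\|$. **Compatibility.** $X(\mathbb{K})^n\hookrightarrow Y(\mathbb{K})$ means: whenever $(\lambda_j^m)_{j=1}^\infty\in X(\mathbb{K})$, $m=1,\ldots,n$, one has $(\lambda_j^1\cdots\lambda_j^n)_{j=1}^\infty\in Y(\mathbb{K})$ and $\|(\lambda_j^1\cdots\lambda_j^n)_j\|_{Y(\mathbb{K})}\le\prod_{m=1}^n\|(\lambda_j^m)_j\|_{X(\mathbb{K})}$. **$(X;Y)$-summing operators and polynomials.** $A\in\mathcal{L}(^nE;F)$ belongs to $\mathcal{L}_{X;Y}(^nE;F)$ if $(A(x_j^1,\ldots,x_j^n))_j\in Y(F)$ whenever $(x_j^m)_j\in X(E)$,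 $m=1,\ldots,n$; then the induced $n$-linear operator $\widetilde A\colon X(E)^n\to Y(F)$, defined coordinatewise, is continuous and $\|A\|_{X;Y}:=\|\widetilde A\|$. A polynomial $P\in\mathcal{P}(^nE;F)$ belongs to $\mathcal{P}_{X;Y}(^nE;F)$ if $(P(x_j))_j\in Y(F)$ whenever $(x_j)_j\in X(E)$; equivalently, $\check P\in\mathcal{L}_{X;Y}(^nE;F)$; equivalently, $\widetilde P\colon X(E)\to Y(F)$, $\widetilde P((x_j)_j)=(P(x_j))_j$, is a well defined continuous $n$-homogeneous polynomial. In this case $\|P\|_{X;Y;1}:=\|\widetilde P\|$ and $\|P\|_{X;Y;2}:=\|\check P\|_{X;Y}$. **$(C_n)_{n=1}^\infty$-polynomial Banach hyper-ideal.** Let $C_n\ge1$ for every $n$ and $C_1=1$. Let $\mathcal{Q}$ be a subclass of the class of continuous homogeneous polynomials between Banach spaces and $\|\cdot\|_{\mathcal{Q}}\colon\mathcal{Q}\to\mathbb{R}$ such that, for all $n$ and Banach spaces $E,F$, the component $\mathcal{Q}(^nE;F):=\mathcal{P}(^nE;F)\cap\mathcal{Q}$ is a linear subspace of $\mathcal{P}(^nE;F)$ containing the polynomials of finite type (linear combinations of $x\mapsto\varphi(x)^nb$, $\varphi\in E^*$, $b\in F$), on which $\|\cdot\|_{\mathcal{Q}}$ is a complete norm, and $\widehat I_n\colon\mathbb{K}\to\mathbb{K}$, $\widehat I_n(\lambda)=\lambda^n$, satisfies $\|\widehat I_n\|_{\mathcal{Q}}=1$. The pair $(\mathcal{Q},\|\cdot\|_{\mathcal{Q}})$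 is a $(C_n)_{n=1}^\infty$-polynomial Banach hyper-ideal if for all $n,m\in\mathbb{N}$, Banach spaces $E,F,G,H$, $P\in\mathcal{Q}(^nE;F)$, $Q\in\mathcal{P}(^mG;E)$ and $t\in\mathcal{L}(F;H)$, one has $t\circ P\circ Q\in\mathcal{Q}(^{mn}G;H)$ and $\|t\circ P\circ Q\|_{\mathcal{Q}}\le C_m^{\,n}\cdot\|t\|\cdot\|P\|_{\mathcal{Q}}\cdot\|Q\|^n$. *)

theory Defs
  imports "HOL-Analysis.Analysis"
begin

text \<open>
  A sequence class is a function on all Banach spaces, and \<open>X(E)\<close> is again a Banach space,
  whose points are sequences. Spaces are therefore represented by records with an explicit
  carrier, vector operations and norm. The operations matter only on the carrier.

  The scalar field is a type \<open>'k :: {real_normed_field, banach}\<close>. The instances are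
  \<open>real\<close> and \<open>complex\<close> and, by the Gelfand--Mazur theorem, nothing else up to isometric
  isomorphism.
\<close>

section \<open>Banach spaces with explicit carrier\<close>

record ('k, 'a) nspace =
  pts :: "'a set"
  vzero :: 'a
  vadd :: "'a \<Rightarrow> 'a \<Rightarrow> 'a"
  vscale :: "'k \<Rightarrow> 'a \<Rightarrow> 'a"
  vnorm :: "'a \<Rightarrow> real"

text \<open>The library's \<^locale>\<open>Metric_space\<close> requires nonnegativity and symmetry of the distance
  on the whole type, hence the value \<open>0\<close> off the carrier.\<close>

definition vdist :: "('k::real_normed_field, 'a) nspace \<Rightarrow> 'a \<Rightarrow> 'a \<Rightarrow> real" where
  "vdist E x y =
     (if x \<in> pts E \<and> y \<in> pts E then vnorm E (vadd E x (vscale E (- 1) y)) else 0)"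

definition vtop :: "('k::real_normed_field, 'a) nspace \<Rightarrow> 'a topology" where
  "vtop E = Metric_space.mtopology (pts E) (vdist E)"

locale normed_nspace =
  fixes E :: "('k::real_normed_field, 'a) nspace"
  assumes zero_closed: "vzero E \<in> pts E"
    and add_closed: "\<lbrakk>x \<in> pts E; y \<in> pts E\<rbrakk> \<Longrightarrow> vadd E x y \<in> pts E"
    and scale_closed: "x \<in> pts E \<Longrightarrow> vscale E c x \<in> pts E"
    and add_assoc:
      "\<lbrakk>x \<in> pts E; y \<in> pts E; z \<in> pts E\<rbrakk> \<Longrightarrow> vadd E (vadd E x y) z = vadd E x (vadd E y z)"
    and add_commute: "\<lbrakk>x \<in> pts E; y \<in> pts E\<rbrakk> \<Longrightarrow> vadd E x y = vadd E y x"
    and add_zero: "x \<in> pts E \<Longrightarrow> vadd E x (vzero E) = x"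
    and add_inverse: "x \<in> pts E \<Longrightarrow> \<exists>y\<in>pts E. vadd E x y = vzero E"
    and scale_add_right:
      "\<lbrakk>x \<in> pts E; y \<in> pts E\<rbrakk> \<Longrightarrow> vscale E c (vadd E x y) = vadd E (vscale E c x) (vscale E c y)"
    and scale_add_left:
      "x \<in> pts E \<Longrightarrow> vscale E (c + d) x = vadd E (vscale E c x) (vscale E d x)"
    and scale_scale: "x \<in> pts E \<Longrightarrow> vscale E c (vscale E d x) = vscale E (c * d) x"
    and scale_one: "x \<in> pts E \<Longrightarrow> vscale E 1 x = x"
    and norm_nonneg: "x \<in> pts E \<Longrightarrow> 0 \<le> vnorm E x"
    and norm_eq_0_iff: "x \<in> pts E \<Longrightarrow> vnorm E x = 0 \<longleftrightarrow> x = vzero E"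
    and norm_scale: "x \<in> pts E \<Longrightarrow> vnorm E (vscale E c x) = norm c * vnorm E x"
    and norm_triangle:
      "\<lbrakk>x \<in> pts E; y \<in> pts E\<rbrakk> \<Longrightarrow> vnorm E (vadd E x y) \<le> vnorm E x + vnorm E y"

locale banach_nspace = normed_nspace +
  assumes complete: "Metric_space.mcomplete (pts E) (vdist E)"

text \<open>\<open>E \<hookrightarrow> F\<close>\<close>

definition embeds :: "('k, 'a) nspace \<Rightarrow> ('k, 'a) nspace \<Rightarrow> bool" where
  "embeds E F \<longleftrightarrow>
     pts E \<subseteq> pts F \<and> vzero E = vzero F \<and>
     (\<forall>x\<in>pts E. \<forall>y\<in>pts E. vadd E x y = vadd F x y) \<and>
     (\<forall>c. \<forall>x\<in>pts E. vscale E c x = vscale F c x) \<and>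
     (\<forall>x\<in>pts E. vnorm F x \<le> vnorm E x)"

text \<open>Linear hull of a subset \<open>S\<close> of \<open>E\<close>.\<close>

inductive_set lin_hull :: "('k, 'a) nspace \<Rightarrow> 'a set \<Rightarrow> 'a set"
  for E :: "('k, 'a) nspace" and S :: "'a set" where
  zero: "vzero E \<in> lin_hull E S"
| step: "\<lbrakk>x \<in> lin_hull E S; s \<in> S\<rbrakk> \<Longrightarrow> vadd E x (vscale E c s) \<in> lin_hull E S"

text \<open>
  ``All Banach spaces'' are all Banach spaces whose carrier is a subset of the type
  \<open>'k + 'u\<close>, with \<open>'u\<close> an arbitrary type. The left summand only serves to make the scalar field
  itself one of these spaces; the carrier, operations and norm of the other spaces are
  unrelated to it.
\<close>

definition scalars :: "('k::real_normed_field, 'k + 'u) nspace" where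
  "scalars =
     \<lparr>pts = range Inl,
      vzero = Inl 0,
      vadd = (\<lambda>x y. Inl (projl x + projl y)),
      vscale = (\<lambda>c x. Inl (c * projl x)),
      vnorm = (\<lambda>x. norm (projl x))\<rparr>"

section \<open>Operators and polynomials\<close>

text \<open>All operators and polynomials are extensional functions on their domain, so that
  operators which agree on their domain are equal. An \<open>n\<close>-tuple is an extensional function on
  \<open>{..<n}\<close>.\<close>

text \<open>Norm of linear operators and of homogeneous polynomials.\<close>

definition ball_norm :: "('k, 'a) nspace \<Rightarrow> ('k, 'b) nspace \<Rightarrow> ('a \<Rightarrow> 'b) \<Rightarrow> real" where
  "ball_norm E F f = Sup ((\<lambda>x. vnorm F (f x)) ` {x \<in> pts E. vnorm E x \<le> 1})"

definition linops ::
  "('k::real_normed_field, 'a) nspace \<Rightarrow> ('k, 'b) nspace \<Rightarrow> ('a \<Rightarrow> 'b) set" where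
  "linops E F =
     {u \<in> pts E \<rightarrow>\<^sub>E pts F.
        (\<forall>x\<in>pts E. \<forall>y\<in>pts E. u (vadd E x y) = vadd F (u x) (u y)) \<and>
        (\<forall>c. \<forall>x\<in>pts E. u (vscale E c x) = vscale F c (u x)) \<and>
        continuous_map (vtop E) (vtop F) u}"

text \<open>\<open>n\<close>-linear maps \<open>E 0 \<times> \<dots> \<times> E (n - 1) \<rightarrow> F\<close>, not necessarily continuous.\<close>

definition multilinear ::
  "nat \<Rightarrow> (nat \<Rightarrow> ('k, 'a) nspace) \<Rightarrow> ('k, 'b) nspace \<Rightarrow> ((nat \<Rightarrow> 'a) \<Rightarrow> 'b) \<Rightarrow> bool" where
  "multilinear n E F A \<longleftrightarrow>
     A \<in> (\<Pi>\<^sub>E i\<in>{..<n}. pts (E i)) \<rightarrow>\<^sub>E pts F \<and>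
     (\<forall>i<n. \<forall>x\<in>(\<Pi>\<^sub>E i\<in>{..<n}. pts (E i)).
        (\<forall>y\<in>pts (E i). \<forall>z\<in>pts (E i).
           A (x(i := vadd (E i) y z)) = vadd F (A (x(i := y))) (A (x(i := z)))) \<and>
        (\<forall>c. \<forall>y\<in>pts (E i). A (x(i := vscale (E i) c y)) = vscale F c (A (x(i := y)))))"

definition multicontinuous ::
  "nat \<Rightarrow> (nat \<Rightarrow> ('k::real_normed_field, 'a) nspace) \<Rightarrow> ('k, 'b) nspace
     \<Rightarrow> ((nat \<Rightarrow> 'a) \<Rightarrow> 'b) \<Rightarrow> bool" where
  "multicontinuous n E F A \<longleftrightarrow>
     continuous_map (product_topology (\<lambda>i. vtop (E i)) {..<n}) (vtop F) A"

definition multiops ::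
  "nat \<Rightarrow> (nat \<Rightarrow> ('k::real_normed_field, 'a) nspace) \<Rightarrow> ('k, 'b) nspace
     \<Rightarrow> ((nat \<Rightarrow> 'a) \<Rightarrow> 'b) set" where
  "multiops n E F = {A. multilinear n E F A \<and> multicontinuous n E F A}"

definition multinorm ::
  "nat \<Rightarrow> (nat \<Rightarrow> ('k, 'a) nspace) \<Rightarrow> ('k, 'b) nspace \<Rightarrow> ((nat \<Rightarrow> 'a) \<Rightarrow> 'b) \<Rightarrow> real" where
  "multinorm n E F A =
     Sup ((\<lambda>x. vnorm F (A x)) `
       {x \<in> (\<Pi>\<^sub>E i\<in>{..<n}. pts (E i)). \<forall>i<n. vnorm (E i) (x i) \<le> 1})"

definition symmetric_map :: "nat \<Rightarrow> ('k, 'a) nspace \<Rightarrow> ((nat \<Rightarrow> 'a) \<Rightarrow> 'b) \<Rightarrow> bool" where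
  "symmetric_map n E A \<longleftrightarrow>
     (\<forall>\<sigma>. \<sigma> permutes {..<n} \<longrightarrow> (\<forall>x\<in>{..<n} \<rightarrow>\<^sub>E pts E. A (x \<circ> \<sigma>) = A x))"

definition polys ::
  "nat \<Rightarrow> ('k::real_normed_field, 'a) nspace \<Rightarrow> ('k, 'b) nspace \<Rightarrow> ('a \<Rightarrow> 'b) set" where
  "polys n E F =
     {P \<in> pts E \<rightarrow>\<^sub>E pts F.
        (\<exists>A. multilinear n (\<lambda>_. E) F A \<and> (\<forall>x\<in>pts E. P x = A (\<lambda>i\<in>{..<n}. x))) \<and>
        continuous_map (vtop E) (vtop F) P}"

text \<open>The symmetric \<open>n\<close>-linear operator associated with \<open>P\<close>.\<close>

definition polar ::
  "nat \<Rightarrow> ('k, 'a) nspace \<Rightarrow> ('k, 'b) nspace \<Rightarrow> ('a \<Rightarrow> 'b) \<Rightarrow> ((nat \<Rightarrow> 'a) \<Rightarrow> 'b)" where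
  "polar n E F P =
     (THE A. multilinear n (\<lambda>_. E) F A \<and> symmetric_map n E A \<and>
        (\<forall>x\<in>pts E. A (\<lambda>i\<in>{..<n}. x) = P x))"

text \<open>A set \<open>S\<close> of extensional maps from \<open>E\<close> to \<open>F\<close>, with the pointwise operations and the
  norm \<open>N\<close>.\<close>

definition map_space ::
  "('k, 'a) nspace \<Rightarrow> ('k, 'b) nspace \<Rightarrow> ('a \<Rightarrow> 'b) set \<Rightarrow> (('a \<Rightarrow> 'b) \<Rightarrow> real)
     \<Rightarrow> ('k, 'a \<Rightarrow> 'b) nspace" where
  "map_space E F S N =
     \<lparr>pts = S,
      vzero = (\<lambda>x\<in>pts E. vzero F),
      vadd = (\<lambda>f g. \<lambda>x\<in>pts E. vadd F (f x) (g x)),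
      vscale = (\<lambda>c f. \<lambda>x\<in>pts E. vscale F c (f x)),
      vnorm = N\<rparr>"

definition finite_type_polys ::
  "nat \<Rightarrow> ('k::real_normed_field, 'k + 'u) nspace \<Rightarrow> ('k, 'k + 'u) nspace
     \<Rightarrow> ('k + 'u \<Rightarrow> 'k + 'u) set" where
  "finite_type_polys n E F =
     lin_hull (map_space E F (polys n E F) (ball_norm E F))
       {(\<lambda>x\<in>pts E. vscale F (projl (\<phi> x) ^ n) b) | \<phi> b.
          \<phi> \<in> linops E (scalars :: ('k, 'k + 'u) nspace) \<and> b \<in> pts F}"

section \<open>Sequence classes\<close>

definition c00 :: "('k, 'a) nspace \<Rightarrow> (nat \<Rightarrow> 'a) set" where
  "c00 E = {x. (\<forall>j. x j \<in> pts E) \<and> (\<exists>N. \<forall>j\<ge>N. x j = vzero E)}"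

definition linf :: "('k, 'a) nspace \<Rightarrow> ('k, nat \<Rightarrow> 'a) nspace" where
  "linf E =
     \<lparr>pts = {x. (\<forall>j. x j \<in> pts E) \<and> bdd_above (range (\<lambda>j. vnorm E (x j)))},
      vzero = (\<lambda>j. vzero E),
      vadd = (\<lambda>x y j. vadd E (x j) (y j)),
      vscale = (\<lambda>c x j. vscale E c (x j)),
      vnorm = (\<lambda>x. SUP j. vnorm E (x j))\<rparr>"

text \<open>A rule \<open>E \<mapsto> X(E)\<close>. Its values on records that are not Banach spaces are irrelevant.\<close>

type_synonym ('k, 'u) seq_rule = "('k, 'k + 'u) nspace \<Rightarrow> ('k, nat \<Rightarrow> 'k + 'u) nspace"

definition unit_seq :: "nat \<Rightarrow> nat \<Rightarrow> 'k::real_normed_field + 'u" where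
  "unit_seq j = (\<lambda>i. Inl (if i = j then 1 else 0))"

definition sequence_class :: "('k::{real_normed_field,banach}, 'u) seq_rule \<Rightarrow> bool" where
  "sequence_class X \<longleftrightarrow>
     (\<forall>E. banach_nspace E \<longrightarrow>
        banach_nspace (X E) \<and> c00 E \<subseteq> pts (X E) \<and> embeds (X E) (linf E)) \<and>
     (\<forall>j. vnorm (X scalars) (unit_seq j) = 1)"

definition linearly_stable :: "('k::{real_normed_field,banach}, 'u) seq_rule \<Rightarrow> bool" where
  "linearly_stable Y \<longleftrightarrow>
     (\<forall>E F u. banach_nspace E \<and> banach_nspace F \<and> u \<in> linops E F \<longrightarrow>
        (\<forall>x\<in>pts (Y E). (\<lambda>j. u (x j)) \<in> pts (Y F)) \<and>
        continuous_map (vtop (Y E)) (vtop (Y F)) (\<lambda>x j. u (x j)) \<and>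
        ball_norm (Y E) (Y F) (\<lambda>x j. u (x j)) = ball_norm E F u)"

text \<open>The operator induced by \<open>A\<close>; \<open>x m\<close> is the \<open>m\<close>-th of the \<open>n\<close> sequences.\<close>

definition induced :: "nat \<Rightarrow> ((nat \<Rightarrow> 'a) \<Rightarrow> 'b) \<Rightarrow> (nat \<Rightarrow> nat \<Rightarrow> 'a) \<Rightarrow> nat \<Rightarrow> 'b" where
  "induced n A x = (\<lambda>j. A (\<lambda>m\<in>{..<n}. x m j))"

definition multilinearly_stable :: "('k::{real_normed_field,banach}, 'u) seq_rule \<Rightarrow> bool" where
  "multilinearly_stable X \<longleftrightarrow>
     (\<forall>n E F A. 1 \<le> n \<and> (\<forall>m<n. banach_nspace (E m)) \<and> banach_nspace F \<and> A \<in> multiops n E F \<longrightarrow>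
        (\<forall>x\<in>(\<Pi>\<^sub>E m\<in>{..<n}. pts (X (E m))). induced n A x \<in> pts (X F)) \<and>
        multicontinuous n (\<lambda>m. X (E m)) (X F) (induced n A) \<and>
        multinorm n (\<lambda>m. X (E m)) (X F) (induced n A) = multinorm n E F A)"

text \<open>\<open>X(K)\<^sup>n \<hookrightarrow> Y(K)\<close>\<close>

definition power_embeds ::
  "nat \<Rightarrow> ('k::{real_normed_field,banach}, 'u) seq_rule \<Rightarrow> ('k, 'u) seq_rule \<Rightarrow> bool" where
  "power_embeds n X Y \<longleftrightarrow>
     (\<forall>l :: nat \<Rightarrow> nat \<Rightarrow> 'k.
        (\<forall>m<n. (\<lambda>j. Inl (l m j)) \<in> pts (X scalars)) \<longrightarrow>
        (\<lambda>j. Inl (\<Prod>m<n. l m j)) \<in> pts (Y scalars) \<and>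
        vnorm (Y scalars) (\<lambda>j. Inl (\<Prod>m<n. l m j))
          \<le> (\<Prod>m<n. vnorm (X scalars) (\<lambda>j. Inl (l m j))))"

section \<open>\<open>(X;Y)\<close>-summing polynomials\<close>

text \<open>The norm \<open>\<parallel>A\<parallel>\<^sub>X\<^sub>;\<^sub>Y\<close> of an \<open>n\<close>-linear operator.\<close>

definition summing_multinorm ::
  "('k, 'u) seq_rule \<Rightarrow> ('k, 'u) seq_rule \<Rightarrow> nat \<Rightarrow> ('k, 'k + 'u) nspace \<Rightarrow> ('k, 'k + 'u) nspace
     \<Rightarrow> ((nat \<Rightarrow> 'k + 'u) \<Rightarrow> 'k + 'u) \<Rightarrow> real" where
  "summing_multinorm X Y n E F A = multinorm n (\<lambda>_. X E) (Y F) (induced n A)"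

definition summing_polys ::
  "('k::{real_normed_field,banach}, 'u) seq_rule \<Rightarrow> ('k, 'u) seq_rule
     \<Rightarrow> nat \<Rightarrow> ('k, 'k + 'u) nspace \<Rightarrow> ('k, 'k + 'u) nspace \<Rightarrow> ('k + 'u \<Rightarrow> 'k + 'u) set" where
  "summing_polys X Y n E F = {P \<in> polys n E F. \<forall>x\<in>pts (X E). (\<lambda>j. P (x j)) \<in> pts (Y F)}"

definition summing_norm1 ::
  "('k::{real_normed_field,banach}, 'u) seq_rule \<Rightarrow> ('k, 'u) seq_rule
     \<Rightarrow> nat \<Rightarrow> ('k, 'k + 'u) nspace \<Rightarrow> ('k, 'k + 'u) nspace \<Rightarrow> ('k + 'u \<Rightarrow> 'k + 'u) \<Rightarrow> real" where
  "summing_norm1 X Y n E F P = ball_norm (X E) (Y F) (\<lambda>x j. P (x j))"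

definition summing_norm2 ::
  "('k::{real_normed_field,banach}, 'u) seq_rule \<Rightarrow> ('k, 'u) seq_rule
     \<Rightarrow> nat \<Rightarrow> ('k, 'k + 'u) nspace \<Rightarrow> ('k, 'k + 'u) nspace \<Rightarrow> ('k + 'u \<Rightarrow> 'k + 'u) \<Rightarrow> real" where
  "summing_norm2 X Y n E F P = summing_multinorm X Y n E F (polar n E F P)"

section \<open>Polynomial Banach hyper-ideals\<close>

text \<open>A class of polynomials is given by its components \<open>Q n E F\<close>, its norm by the norms
  \<open>N n E F\<close> on the components.\<close>

definition polynomial_banach_hyper_ideal ::
  "(nat \<Rightarrow> real)
     \<Rightarrow> (nat \<Rightarrow> ('k::{real_normed_field,banach}, 'k + 'u) nspace \<Rightarrow> ('k, 'k + 'u) nspace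
           \<Rightarrow> ('k + 'u \<Rightarrow> 'k + 'u) set)
     \<Rightarrow> (nat \<Rightarrow> ('k, 'k + 'u) nspace \<Rightarrow> ('k, 'k + 'u) nspace \<Rightarrow> ('k + 'u \<Rightarrow> 'k + 'u) \<Rightarrow> real)
     \<Rightarrow> bool" where
  "polynomial_banach_hyper_ideal C Q N \<longleftrightarrow>
     (\<forall>n\<ge>1. 1 \<le> C n) \<and> C 1 = 1 \<and>
     (\<forall>n E F. 1 \<le> n \<and> banach_nspace E \<and> banach_nspace F \<longrightarrow>
        Q n E F \<subseteq> polys n E F \<and>
        finite_type_polys n E F \<subseteq> Q n E F \<and>
        banach_nspace (map_space E F (Q n E F) (N n E F))) \<and>
     (\<forall>n\<ge>1. N n scalars scalars (\<lambda>x\<in>pts scalars. Inl (projl x ^ n)) = 1) \<and>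
     (\<forall>n m E F G H P R t.
        1 \<le> n \<and> 1 \<le> m \<and>
        banach_nspace E \<and> banach_nspace F \<and> banach_nspace G \<and> banach_nspace H \<and>
        P \<in> Q n E F \<and> R \<in> polys m G E \<and> t \<in> linops F H \<longrightarrow>
        restrict (t \<circ> P \<circ> R) (pts G) \<in> Q (m * n) G H \<and>
        N (m * n) G H (restrict (t \<circ> P \<circ> R) (pts G))
          \<le> C m ^ n * ball_norm F H t * N n E F P * ball_norm G E R ^ n)"

end

theory Submission
  imports Defs "HOL-Algebra.FiniteProduct"
begin

text \<open>
  The points that need an argument are the finiteness and the completeness of the two norms and the
  constant in the hyper-ideal inequality. Polarization writes the polar \<open>A\<close> of \<open>P\<close> as a finite linear
  combination of values of \<open>P\<close>, so the coordinatewise extension of \<open>A\<close> maps \<open>X(E)\<^sup>n\<close> into \<open>Y(F)\<close>; a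
  closed graph theorem for multilinear maps makes it bounded, and the two norms are equivalent with
  constant \<open>n\<^sup>n / n!\<close>. Both dominate the sup norm, because \<open>x \<mapsto> (x, 0, 0, \<dots>)\<close> is a contraction from
  \<open>E\<close> to \<open>X(E)\<close>; so a Cauchy sequence converges pointwise, and completeness of \<open>Y(F)\<close> shows that the
  limit is summing. For the hyper-ideal inequality, multilinear stability of \<open>X\<close> is applied to the
  polar of the inner polynomial, whose norm is at most \<open>m\<^sup>m / m!\<close> times that of the polynomial.
\<close>

section \<open>Normed spaces with explicit carrier\<close>

text \<open>Belonging to the class of summing polynomials only means that certain sequences lie in
  \<open>Y(F)\<close>; no estimate is part of it. Since \<open>Sup\<close> of an unbounded set of
  reals carries no information, each use of either norm needs a finite bound first, and the closed
  graph theorem supplies it. It applies because \<open>X(E)\<close> and \<open>Y(F)\<close> embed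
  into the bounded sequences: convergence there forces convergence in each coordinate, where the
  original operator is known to be bounded.

  The constant in the hyper-ideal inequality comes from the fact that multilinear stability controls
  multilinear operators, not polynomials. The inner polynomial of degree \<open>m\<close> therefore
  acts through its polar, once in each of the \<open>n\<close> slots of the outer one, and this
  produces the \<open>n\<close>-th power of \<open>m^m / m!\<close>.

  The compatibility of \<open>X\<close> and \<open>Y\<close> puts the polynomials of finite type
  into the class and bounds the norms of the scalar power maps by \<open>1\<close>. The contraction
  from \<open>E\<close> to \<open>X(E)\<close> comes from stability, applied to multiplication of
  scalars by a vector, and from the norm of the first unit sequence.\<close>

abbreviation tuples :: "nat \<Rightarrow> (nat \<Rightarrow> ('k, 'a) nspace) \<Rightarrow> (nat \<Rightarrow> 'a) set" where
  "tuples n E \<equiv> \<Pi>\<^sub>E i\<in>{..<n}. pts (E i)"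

abbreviation tuples_in :: "nat \<Rightarrow> ('k, 'a) nspace \<Rightarrow> (nat \<Rightarrow> 'a) set" where
  "tuples_in n E \<equiv> tuples n (\<lambda>_. E)"

definition vsub :: "('k::real_normed_field, 'a) nspace \<Rightarrow> 'a \<Rightarrow> 'a \<Rightarrow> 'a" where
  "vsub E x y = vadd E x (vscale E (- 1) y)"

text \<open>Convergence is expressed by real null sequences instead of
  \<open>limitin (vtop E)\<close>, so that the arithmetic of real limits applies directly.\<close>

definition vlim :: "('k::real_normed_field, 'a) nspace \<Rightarrow> (nat \<Rightarrow> 'a) \<Rightarrow> 'a \<Rightarrow> bool" where
  "vlim E s l \<longleftrightarrow> (\<lambda>k. vnorm E (vsub E (s k) l)) \<longlonglongrightarrow> 0"

text \<open>The additive structure is presented to \<open>finprod\<close> as a commutative monoid in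
  multiplicative notation. As with \<open>finprod\<close>, an infinite index set yields
  \<open>vzero E\<close>.\<close>

definition vsum :: "('k, 'a) nspace \<Rightarrow> ('b \<Rightarrow> 'a) \<Rightarrow> 'b set \<Rightarrow> 'a" where
  "vsum E f A = finprod \<lparr>carrier = pts E, monoid.mult = vadd E, one = vzero E\<rparr> f A"

lemma null_seq_le:
  fixes f g :: "nat \<Rightarrow> real"
  assumes "g \<longlonglongrightarrow> 0" "\<And>k. \<bar>f k\<bar> \<le> g k"
  shows "f \<longlonglongrightarrow> 0"
  by (rule Lim_null_comparison[OF _ assms(1)]) (simp add: assms(2))

context normed_nspace
begin

lemmas closed = zero_closed add_closed scale_closed

lemma norm_zero: "vnorm E (vzero E) = 0"
  using norm_eq_0_iff zero_closed by blast

lemma add_zero_left: "x \<in> pts E \<Longrightarrow> vadd E (vzero E) x = x"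
  using add_commute add_zero zero_closed by metis

lemma add_left_commute:
  "\<lbrakk>x \<in> pts E; y \<in> pts E; z \<in> pts E\<rbrakk> \<Longrightarrow> vadd E x (vadd E y z) = vadd E y (vadd E x z)"
  by (metis add_assoc add_commute)

lemmas add_ac = add_assoc add_commute add_left_commute

text \<open>The norm is definite, so it suffices that \<open>vscale E 0 x\<close> has norm
  \<open>0\<close>.\<close>

lemma scale_zero_left: "x \<in> pts E \<Longrightarrow> vscale E 0 x = vzero E"
  using norm_eq_0_iff[of "vscale E 0 x"] norm_scale[of x 0] scale_closed by simp

lemma scale_zero_right: "vscale E c (vzero E) = vzero E"
  using norm_eq_0_iff[of "vscale E c (vzero E)"] norm_scale[of "vzero E" c] closed norm_zero
  by simp

lemma add_minus: "x \<in> pts E \<Longrightarrow> vadd E x (vscale E (- 1) x) = vzero E"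
  using scale_add_left[of x 1 "- 1"] by (simp add: scale_one scale_zero_left)

lemma vsub_closed: "\<lbrakk>x \<in> pts E; y \<in> pts E\<rbrakk> \<Longrightarrow> vsub E x y \<in> pts E"
  by (simp add: vsub_def closed)

lemma vsub_self: "x \<in> pts E \<Longrightarrow> vsub E x x = vzero E"
  by (simp add: vsub_def add_minus)

lemma vsub_zero: "x \<in> pts E \<Longrightarrow> vsub E x (vzero E) = x"
  by (simp add: vsub_def scale_zero_right add_zero)

lemma vsub_add_cancel: "\<lbrakk>x \<in> pts E; y \<in> pts E\<rbrakk> \<Longrightarrow> vadd E (vsub E x y) y = x"
  by (simp add: vsub_def add_assoc add_minus closed add_zero add_commute[of "vscale E (- 1) y" y])

lemma vsub_vsub: "\<lbrakk>x \<in> pts E; y \<in> pts E; z \<in> pts E\<rbrakk> \<Longrightarrow>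
    vadd E (vsub E x y) (vsub E y z) = vsub E x z"
  by (metis (no_types, lifting) add_assoc scale_closed vsub_add_cancel vsub_closed vsub_def)

lemma scale_vsub: "\<lbrakk>x \<in> pts E; y \<in> pts E\<rbrakk> \<Longrightarrow>
    vscale E c (vsub E x y) = vsub E (vscale E c x) (vscale E c y)"
  by (simp add: vsub_def scale_add_right closed scale_scale mult.commute)

lemma vsub_commute: "\<lbrakk>x \<in> pts E; y \<in> pts E\<rbrakk> \<Longrightarrow> vsub E y x = vscale E (- 1) (vsub E x y)"
  by (simp add: vsub_def scale_add_right closed scale_scale scale_one add_commute)

lemma vsub_add_vadd:
  "\<lbrakk>x \<in> pts E; y \<in> pts E; z \<in> pts E; w \<in> pts E\<rbrakk> \<Longrightarrow>
    vsub E (vadd E x y) (vadd E z w) = vadd E (vsub E x z) (vsub E y w)"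
  by (simp add: vsub_def scale_add_right closed add_ac)

lemma norm_vsub_commute:
  "\<lbrakk>x \<in> pts E; y \<in> pts E\<rbrakk> \<Longrightarrow> vnorm E (vsub E x y) = vnorm E (vsub E y x)"
  by (simp add: vsub_commute[of x y] norm_scale vsub_closed)

lemma norm_vsub_triangle: "\<lbrakk>x \<in> pts E; y \<in> pts E; z \<in> pts E\<rbrakk> \<Longrightarrow>
    vnorm E (vsub E x z) \<le> vnorm E (vsub E x y) + vnorm E (vsub E y z)"
  using norm_triangle[of "vsub E x y" "vsub E y z"] by (simp add: vsub_vsub vsub_closed)

lemma norm_vsub_le: "\<lbrakk>x \<in> pts E; y \<in> pts E\<rbrakk> \<Longrightarrow> vnorm E (vsub E x y) \<le> vnorm E x + vnorm E y"
  using norm_triangle[of x "vscale E (- 1) y"] by (simp add: vsub_def closed norm_scale)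

lemma norm_le_vsub: "\<lbrakk>x \<in> pts E; y \<in> pts E\<rbrakk> \<Longrightarrow> vnorm E x \<le> vnorm E (vsub E x y) + vnorm E y"
  using norm_triangle[of "vsub E x y" y] by (simp add: vsub_add_cancel vsub_closed)

lemma norm_vsub_eq_0_iff: "\<lbrakk>x \<in> pts E; y \<in> pts E\<rbrakk> \<Longrightarrow> vnorm E (vsub E x y) = 0 \<longleftrightarrow> x = y"
  by (metis add_zero_left norm_eq_0_iff vsub_add_cancel vsub_closed vsub_self)

lemma vdist_eq: "\<lbrakk>x \<in> pts E; y \<in> pts E\<rbrakk> \<Longrightarrow> vdist E x y = vnorm E (vsub E x y)"
  by (simp add: vdist_def vsub_def)

lemma Metric_space_vdist: "Metric_space (pts E) (vdist E)"
proof
  fix x y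
  show "0 \<le> vdist E x y"
    by (auto simp: vdist_def closed norm_nonneg)
  show "vdist E x y = vdist E y x"
    by (metis norm_vsub_commute vdist_def vsub_def)
next
  fix x y assume "x \<in> pts E" "y \<in> pts E"
  then show "(vdist E x y = 0) = (x = y)"
    by (simp add: vdist_eq norm_vsub_eq_0_iff)
next
  fix x y z assume "x \<in> pts E" "y \<in> pts E" "z \<in> pts E"
  then show "vdist E x z \<le> vdist E x y + vdist E y z"
    by (simp add: vdist_eq norm_vsub_triangle)
qed

lemma topspace_vtop: "topspace (vtop E) = pts E"
  by (simp add: vtop_def Metric_space.topspace_mtopology[OF Metric_space_vdist])

lemma in_mball_vdist: "y \<in> Metric_space.mball (pts E) (vdist E) x r \<longleftrightarrow>
    x \<in> pts E \<and> y \<in> pts E \<and> vnorm E (vsub E y x) < r"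
  by (auto simp: Metric_space.in_mball[OF Metric_space_vdist] vdist_eq norm_vsub_commute)

section \<open>Limits in the norm\<close>

lemma vlim_unique:
  assumes "vlim E s l" "vlim E s m" "\<And>k. s k \<in> pts E" "l \<in> pts E" "m \<in> pts E"
  shows "l = m"
proof -
  have "(\<lambda>k. vnorm E (vsub E (s k) l) + vnorm E (vsub E (s k) m)) \<longlonglongrightarrow> 0 + 0"
    using assms by (intro tendsto_add) (auto simp: vlim_def)
  moreover have "vnorm E (vsub E l m) \<le> vnorm E (vsub E (s k) l) + vnorm E (vsub E (s k) m)" for k
    using norm_vsub_triangle[of l "s k" m] norm_vsub_commute[of l "s k"] assms by simp
  ultimately have "vnorm E (vsub E l m) \<le> 0"
    using LIMSEQ_le_const by fastforce
  then show ?thesis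
    using assms norm_nonneg norm_vsub_eq_0_iff vsub_closed by (metis antisym)
qed

lemma vlim_const: "x \<in> pts E \<Longrightarrow> vlim E (\<lambda>_. x) x"
  by (simp add: vlim_def vsub_self norm_zero)

lemma vlim_add:
  assumes "vlim E s l" "vlim E t m" "\<And>k. s k \<in> pts E" "\<And>k. t k \<in> pts E" "l \<in> pts E" "m \<in> pts E"
  shows "vlim E (\<lambda>k. vadd E (s k) (t k)) (vadd E l m)"
proof -
  have "(\<lambda>k. vnorm E (vsub E (s k) l) + vnorm E (vsub E (t k) m)) \<longlonglongrightarrow> 0"
    using tendsto_add[of _ 0 _ _ 0] assms by (fastforce simp: vlim_def)
  then show ?thesis
    unfolding vlim_def
    by (rule null_seq_le[where g = "\<lambda>k. vnorm E (vsub E (s k) l) + vnorm E (vsub E (t k) m)"])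
      (simp_all add: assms vsub_add_vadd norm_triangle vsub_closed norm_nonneg closed)
qed

lemma vlim_scale:
  assumes "vlim E s l" "\<And>k. s k \<in> pts E" "l \<in> pts E"
  shows "vlim E (\<lambda>k. vscale E c (s k)) (vscale E c l)"
proof -
  have "(\<lambda>k. norm c * vnorm E (vsub E (s k) l)) \<longlonglongrightarrow> norm c * 0"
    using assms by (intro tendsto_mult) (auto simp: vlim_def)
  then show ?thesis
    by (simp add: vlim_def assms norm_scale vsub_closed flip: scale_vsub)
qed

lemma norm_vlim:
  assumes "vlim E s l" "\<And>k. s k \<in> pts E" "l \<in> pts E"
  shows "(\<lambda>k. vnorm E (s k)) \<longlonglongrightarrow> vnorm E l"
proof (rule Lim_transform)
  show "(\<lambda>k. vnorm E l) \<longlonglongrightarrow> vnorm E l"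
    by simp
  have *: "\<bar>vnorm E (s k) - vnorm E l\<bar> \<le> vnorm E (vsub E (s k) l)" for k
    using norm_le_vsub[of l "s k"] norm_le_vsub[of "s k" l] norm_vsub_commute[of l "s k"] assms
    by (simp add: abs_le_iff)
  show "(\<lambda>k. vnorm E (s k) - vnorm E l) \<longlonglongrightarrow> 0"
    by (rule null_seq_le[OF assms(1)[unfolded vlim_def] *])
qed

section \<open>Finite sums over the carrier\<close>

lemma comm_monoid_vadd: "comm_monoid \<lparr>carrier = pts E, monoid.mult = vadd E, one = vzero E\<rparr>"
  by (rule comm_monoidI) (simp_all add: closed add_assoc add_zero_left add_zero, simp add: add_commute)

lemmas vsum_infinite = comm_monoid.finprod_infinite[OF comm_monoid_vadd, folded vsum_def, simplified]

lemma vsum_empty: "vsum E f {} = vzero E"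
  by (simp add: vsum_def comm_monoid.finprod_empty[OF comm_monoid_vadd])

lemma vsum_insert:
  "\<lbrakk>finite A; a \<notin> A; f ` insert a A \<subseteq> pts E\<rbrakk> \<Longrightarrow> vsum E f (insert a A) = vadd E (f a) (vsum E f A)"
  using comm_monoid.finprod_insert[OF comm_monoid_vadd, of A a f] by (auto simp: vsum_def)

lemma vsum_singleton: "f a \<in> pts E \<Longrightarrow> vsum E f {a} = f a"
  using vsum_insert[of "{}" a f] by (simp add: vsum_empty add_zero)

lemma vsum_closed: "f ` A \<subseteq> pts E \<Longrightarrow> vsum E f A \<in> pts E"
  using comm_monoid.finprod_closed[OF comm_monoid_vadd, of f A] by (auto simp: vsum_def)

lemma vsum_cong:
  "\<lbrakk>A = B; \<And>i. i \<in> B \<Longrightarrow> f i = g i; g ` B \<subseteq> pts E\<rbrakk> \<Longrightarrow> vsum E f A = vsum E g B"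
  using comm_monoid.finprod_cong'[OF comm_monoid_vadd, of A B g f] by (auto simp: vsum_def)

lemma vsum_reindex:
  "\<lbrakk>f ` h ` A \<subseteq> pts E; inj_on h A\<rbrakk> \<Longrightarrow> vsum E f (h ` A) = vsum E (\<lambda>a. f (h a)) A"
  using comm_monoid.finprod_reindex[OF comm_monoid_vadd, of f h A] by (auto simp: vsum_def)

lemma vsum_mono_neutral:
  "\<lbrakk>finite B; A \<subseteq> B; \<And>i. i \<in> B - A \<Longrightarrow> f i = vzero E; f ` B \<subseteq> pts E\<rbrakk> \<Longrightarrow> vsum E f A = vsum E f B"
  using comm_monoid.finprod_mono_neutral_cong_left[OF comm_monoid_vadd, of B A f f]
  by (auto simp: vsum_def)

lemma vsum_add:
  "\<lbrakk>f ` A \<subseteq> pts E; g ` A \<subseteq> pts E\<rbrakk> \<Longrightarrow>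
    vsum E (\<lambda>a. vadd E (f a) (g a)) A = vadd E (vsum E f A) (vsum E g A)"
  using comm_monoid.finprod_multf[OF comm_monoid_vadd, of f A g] by (auto simp: vsum_def)

lemma vsum_zero: "vsum E (\<lambda>_. vzero E) A = vzero E"
  using comm_monoid.finprod_one_eqI[OF comm_monoid_vadd, of A "\<lambda>_. vzero E"] by (auto simp: vsum_def)

lemma vsum_scale:
  assumes "f ` A \<subseteq> pts E"
  shows "vsum E (\<lambda>a. vscale E c (f a)) A = vscale E c (vsum E f A)"
proof (cases "finite A")
  case True
  then show ?thesis using assms
    by (induction A) (auto simp: vsum_empty scale_zero_right vsum_insert vsum_closed closed
      scale_add_right image_subset_iff)
qed (simp add: vsum_infinite scale_zero_right)

lemma vsum_scale_const:
  assumes "finite A" "x \<in> pts E"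
  shows "vsum E (\<lambda>a. vscale E (c a) x) A = vscale E (sum c A) x"
  using assms(1)
  by (induction A) (auto simp: vsum_empty scale_zero_left vsum_insert vsum_closed closed
      scale_add_left image_subset_iff assms(2))

lemma norm_vsum: "f ` A \<subseteq> pts E \<Longrightarrow> vnorm E (vsum E f A) \<le> (\<Sum>a\<in>A. vnorm E (f a))"
proof (induction A rule: infinite_finite_induct)
  case (insert a A)
  then show ?case
    using norm_triangle[of "f a" "vsum E f A"] by (simp add: vsum_insert vsum_closed)
qed (simp_all add: vsum_infinite vsum_empty norm_zero)

lemma vsum_swap:
  assumes "finite A" "finite B" "\<And>a b. \<lbrakk>a \<in> A; b \<in> B\<rbrakk> \<Longrightarrow> f a b \<in> pts E"
  shows "vsum E (\<lambda>a. vsum E (f a) B) A = vsum E (\<lambda>b. vsum E (\<lambda>a. f a b) A) B"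
  using assms(1,3)
proof (induction A)
  case empty
  then show ?case by (simp add: vsum_empty vsum_zero)
next
  case (insert a A)
  have "vsum E (\<lambda>b. vsum E (\<lambda>a. f a b) (insert a A)) B
      = vsum E (\<lambda>b. vadd E (f a b) (vsum E (\<lambda>a. f a b) A)) B"
    using insert.hyps insert.prems
    by (intro vsum_cong) (auto intro!: vsum_insert add_closed vsum_closed)
  also have "\<dots> = vadd E (vsum E (f a) B) (vsum E (\<lambda>b. vsum E (\<lambda>a. f a b) A) B)"
    using insert.prems by (intro vsum_add) (auto intro!: vsum_closed)
  also have "\<dots> = vsum E (\<lambda>a. vsum E (f a) B) (insert a A)"
    using insert.prems insert.hyps insert.IH
    by (subst vsum_insert) (auto intro!: vsum_closed)
  finally show ?case ..
qed

lemma vsum_Sigma: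
  assumes "finite A" "finite B" "\<And>a b. \<lbrakk>a \<in> A; b \<in> B\<rbrakk> \<Longrightarrow> f a b \<in> pts E"
  shows "vsum E (\<lambda>a. vsum E (f a) B) A = vsum E (\<lambda>(a, b). f a b) (A \<times> B)"
  using assms(1,3)
proof (induction A)
  case empty
  then show ?case by (simp add: vsum_empty)
next
  case (insert a A)
  have "vsum E (\<lambda>(a, b). f a b) (insert a A \<times> B)
      = vsum E (\<lambda>(a, b). f a b) (Pair a ` B \<union> A \<times> B)"
    by (rule arg_cong[where f = "vsum E _"]) auto
  also have "\<dots> = vadd E (vsum E (\<lambda>(a, b). f a b) (Pair a ` B)) (vsum E (\<lambda>(a, b). f a b) (A \<times> B))"
    using comm_monoid.finprod_Un_disjoint[OF comm_monoid_vadd, of "Pair a ` B" "A \<times> B" "\<lambda>(a, b). f a b"]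
      insert.hyps insert.prems assms(2) by (fastforce simp: vsum_def)
  also have "vsum E (\<lambda>(a, b). f a b) (Pair a ` B) = vsum E (f a) B"
    using insert.prems by (subst vsum_reindex) (auto simp: inj_on_def)
  finally show ?case
    using insert.prems insert.hyps insert.IH
    by (subst vsum_insert) (auto intro!: vsum_closed)
qed

lemma vsum_vlim:
  assumes "finite A" "\<And>a. a \<in> A \<Longrightarrow> vlim E (s a) (l a)" "\<And>a k. a \<in> A \<Longrightarrow> s a k \<in> pts E"
    "\<And>a. a \<in> A \<Longrightarrow> l a \<in> pts E"
  shows "vlim E (\<lambda>k. vsum E (\<lambda>a. s a k) A) (vsum E l A)"
  using assms
proof (induction A)
  case empty
  then show ?case by (simp add: vsum_empty vlim_const zero_closed)
next
  case (insert a A)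
  have "vlim E (\<lambda>k. vadd E (s a k) (vsum E (\<lambda>a. s a k) A)) (vadd E (l a) (vsum E l A))"
    using insert.prems insert.IH by (intro vlim_add) (auto intro!: vsum_closed)
  then show ?case
    using insert.prems insert.hyps by (subst (1 2) vsum_insert) auto
qed

end

section \<open>Completeness and continuity in terms of the norm\<close>

lemma (in banach_nspace) Cauchy_vlim:
  assumes "\<And>k. s k \<in> pts E"
    and "\<And>e. 0 < e \<Longrightarrow> \<exists>N. \<forall>k\<ge>N. \<forall>l\<ge>N. vnorm E (vsub E (s k) (s l)) < e"
  obtains l where "l \<in> pts E" "vlim E s l"
proof -
  interpret M: Metric_space "pts E" "vdist E" by (rule Metric_space_vdist)
  have "M.MCauchy s"
    unfolding M.MCauchy_def using assms by (fastforce simp: vdist_eq)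
  then obtain l where "limitin M.mtopology s l sequentially"
    using complete M.mcomplete_def by blast
  then have l: "l \<in> pts E" "\<forall>e>0. \<exists>N. \<forall>n\<ge>N. s n \<in> pts E \<and> vdist E (s n) l < e"
    by (auto simp: M.limit_metric_sequentially)
  moreover have "vlim E s l"
    unfolding vlim_def using l assms(1)
    by (intro LIMSEQ_I) (simp add: vdist_eq norm_nonneg vsub_closed)
  ultimately show ?thesis
    using that by blast
qed

lemma (in normed_nspace) banach_nspaceI:
  assumes "\<And>s. \<lbrakk>\<And>k. s k \<in> pts E;
      \<And>e. 0 < e \<Longrightarrow> \<exists>N. \<forall>k\<ge>N. \<forall>l\<ge>N. vnorm E (vsub E (s k) (s l)) < e\<rbrakk>
      \<Longrightarrow> \<exists>l\<in>pts E. vlim E s l"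
  shows "banach_nspace E"
proof
  interpret M: Metric_space "pts E" "vdist E" by (rule Metric_space_vdist)
  show "M.mcomplete"
    unfolding M.mcomplete_def
  proof (intro allI impI)
    fix s assume "M.MCauchy s"
    then have s: "s k \<in> pts E" "0 < e \<Longrightarrow> \<exists>N. \<forall>k\<ge>N. \<forall>l\<ge>N. vdist E (s k) (s l) < e" for k e
      by (auto simp: M.MCauchy_def)
    then obtain l where l: "l \<in> pts E" "vlim E s l"
      using assms[of s] by (auto simp: vdist_eq)
    then have "\<forall>e>0. \<exists>N. \<forall>n\<ge>N. vdist E (s n) l < e"
      using LIMSEQ_D[of "\<lambda>k. vnorm E (vsub E (s k) l)" 0] unfolding vlim_def
      by (simp add: s vdist_eq norm_nonneg vsub_closed)
    with l s show "\<exists>x. limitin M.mtopology s x sequentially"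
      by (auto simp: M.limit_metric_sequentially)
  qed
qed

lemma continuous_map_vtop:
  assumes "normed_nspace E" "normed_nspace F"
  shows "continuous_map (vtop E) (vtop F) f \<longleftrightarrow> f ` pts E \<subseteq> pts F \<and>
    (\<forall>a\<in>pts E. \<forall>e>0. \<exists>d>0. \<forall>x\<in>pts E.
      vnorm E (vsub E x a) < d \<longrightarrow> vnorm F (vsub F (f x) (f a)) < e)"
proof -
  interpret E: normed_nspace E by fact
  interpret F: normed_nspace F by fact
  show ?thesis
    unfolding vtop_def
    by (simp add: Metric_space.metric_continuous_map[OF E.Metric_space_vdist F.Metric_space_vdist]
        image_subset_iff E.vdist_eq F.vdist_eq E.norm_vsub_commute F.norm_vsub_commute
        imp_conjL Ball_def cong: conj_cong)
qed

section \<open>Multilinear maps\<close>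

lemma upd_tuple: "\<lbrakk>x \<in> tuples n E; y \<in> pts (E i); i < n\<rbrakk> \<Longrightarrow> x(i := y) \<in> tuples n E"
  by (auto simp: PiE_iff extensional_def)

text \<open>Separate homogeneity is all that is needed to pass between continuity and boundedness, and
  unlike multilinearity it does not ask for extensionality, which fails for \<^const>\<open>induced\<close> maps.\<close>

lemma tuple_mem: "\<lbrakk>x \<in> tuples n E; i < n\<rbrakk> \<Longrightarrow> x i \<in> pts (E i)"
  by auto

locale homog_map =
  fixes n :: nat and E :: "nat \<Rightarrow> ('k::real_normed_field, 'a) nspace"
    and F :: "('k, 'b) nspace" and T :: "(nat \<Rightarrow> 'a) \<Rightarrow> 'b"
  assumes normed_E: "i < n \<Longrightarrow> normed_nspace (E i)"
    and normed_F: "normed_nspace F"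
    and into: "x \<in> tuples n E \<Longrightarrow> T x \<in> pts F"
    and scale_coord: "\<lbrakk>i < n; x \<in> tuples n E; y \<in> pts (E i)\<rbrakk> \<Longrightarrow>
      T (x(i := vscale (E i) c y)) = vscale F c (T (x(i := y)))"
begin

sublocale F: normed_nspace F by (rule normed_F)

lemma scale_all:
  assumes "x \<in> tuples n E"
  shows "T (\<lambda>i\<in>{..<n}. vscale (E i) (c i) (x i)) = vscale F (\<Prod>i<n. c i) (T x)"
proof -
  \<comment> \<open>The first \<open>k\<close> coordinates are already scaled; \<open>k = n\<close>
    is the claim.\<close>
  have "k \<le> n \<Longrightarrow> T (\<lambda>i\<in>{..<n}. if i < k then vscale (E i) (c i) (x i) else x i)
      = vscale F (\<Prod>i<k. c i) (T x)" for k
  proof (induction k)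
    case 0
    have "(\<lambda>i\<in>{..<n}. if i < 0 then vscale (E i) (c i) (x i) else x i) = x"
      using assms by (auto simp: fun_eq_iff PiE_iff extensional_def)
    then show ?case
      using assms by (simp add: F.scale_one into)
  next
    case (Suc k)
    define z where "z = (\<lambda>i\<in>{..<n}. if i < k then vscale (E i) (c i) (x i) else x i)"
    have z: "z \<in> tuples n E"
      using assms normed_E by (auto simp: z_def PiE_iff normed_nspace.scale_closed)
    have "(\<lambda>i\<in>{..<n}. if i < Suc k then vscale (E i) (c i) (x i) else x i)
        = z(k := vscale (E k) (c k) (x k))"
      using Suc.prems by (auto simp: z_def fun_eq_iff less_Suc_eq)
    then have "T (\<lambda>i\<in>{..<n}. if i < Suc k then vscale (E i) (c i) (x i) else x i)
        = T (z(k := vscale (E k) (c k) (x k)))"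
      by simp
    also have "\<dots> = vscale F (c k) (T (z(k := x k)))"
      using Suc.prems z tuple_mem[OF assms] by (intro scale_coord) simp_all
    also have "z(k := x k) = z"
      using Suc.prems by (auto simp: z_def fun_eq_iff)
    finally show ?case
      using Suc assms by (simp add: z_def F.scale_scale into mult.commute)
  qed
  from this[of n] show ?thesis
    by (simp cong: restrict_cong)
qed

text \<open>Scaling a zero coordinate by \<open>0\<close> leaves the tuple alone and turns the value
  into \<open>vzero F\<close>.\<close>

lemma zero_coord:
  assumes "x \<in> tuples n E" "i < n" "x i = vzero (E i)"
  shows "T x = vzero F"
proof -
  interpret Ei: normed_nspace "E i" using assms normed_E by simp
  have "T (x(i := vscale (E i) 0 (x i))) = vscale F 0 (T (x(i := x i)))"
    using assms by (intro scale_coord) (auto simp: Ei.closed)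
  then show ?thesis
    using assms by (simp add: Ei.scale_zero_right F.scale_zero_left into fun_upd_idem)
qed

text \<open>If some coordinate is zero, both sides vanish; otherwise the coordinates are normalised
  and the factors are pulled out by \<open>scale_all\<close>.\<close>

lemma unit_ball_bound:
  assumes "\<And>x. \<lbrakk>x \<in> tuples n E; \<And>i. i < n \<Longrightarrow> vnorm (E i) (x i) \<le> 1\<rbrakk> \<Longrightarrow> vnorm F (T x) \<le> C"
    and x: "x \<in> tuples n E"
  shows "vnorm F (T x) \<le> C * (\<Prod>i<n. vnorm (E i) (x i))"
proof (cases "\<exists>i<n. x i = vzero (E i)")
  case True
  then obtain i where i: "i < n" "x i = vzero (E i)" by blast
  then have "vnorm (E i) (x i) = 0"
    using normed_E normed_nspace.norm_zero by metis
  then have "(\<Prod>i<n. vnorm (E i) (x i)) = 0"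
    using i by (intro prod_zero) (auto intro!: bexI[of _ i])
  then show ?thesis
    using zero_coord[OF x i] by (simp only: F.norm_zero mult_zero_right)
next
  case False
  have pos: "0 < vnorm (E i) (x i)" if "i < n" for i
  proof -
    interpret Ei: normed_nspace "E i" using that normed_E by simp
    show ?thesis
      using False that x Ei.norm_nonneg[of "x i"] Ei.norm_eq_0_iff[of "x i"]
      by (fastforce simp: PiE_iff less_le)
  qed
  define c :: "nat \<Rightarrow> 'k" where "c i = of_real (1 / vnorm (E i) (x i))" for i
  have "vnorm F (T (\<lambda>i\<in>{..<n}. vscale (E i) (c i) (x i))) \<le> C"
  proof (rule assms(1))
    show "(\<lambda>i\<in>{..<n}. vscale (E i) (c i) (x i)) \<in> tuples n E"
      using x normed_E by (auto simp: PiE_iff normed_nspace.scale_closed)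
    show "vnorm (E i) ((\<lambda>i\<in>{..<n}. vscale (E i) (c i) (x i)) i) \<le> 1" if "i < n" for i
      using that x pos[OF that] normed_nspace.norm_scale[OF normed_E[OF that], of "x i" "c i"]
      by (auto simp: c_def PiE_iff norm_divide)
  qed
  moreover have "(\<Prod>i<n. norm (c i)) = (\<Prod>i<n. 1 / vnorm (E i) (x i))"
    using pos by (intro prod.cong) (simp_all add: c_def norm_divide abs_of_pos)
  ultimately have "(\<Prod>i<n. 1 / vnorm (E i) (x i)) * vnorm F (T x) \<le> C"
    using x by (simp add: scale_all F.norm_scale into flip: prod_norm)
  moreover have "(\<Prod>i<n. vnorm (E i) (x i)) > 0"
    using pos by (intro prod_pos) auto
  ultimately show ?thesis
    by (simp add: prod_dividef field_simps)
qed

lemma prod_norm_nonneg: "x \<in> tuples n E \<Longrightarrow> 0 \<le> (\<Prod>i<n. vnorm (E i) (x i))"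
  using normed_E by (auto intro!: prod_nonneg simp: PiE_iff normed_nspace.norm_nonneg)

lemma multinorm_le:
  assumes "\<And>x. \<lbrakk>x \<in> tuples n E; \<And>i. i < n \<Longrightarrow> vnorm (E i) (x i) \<le> 1\<rbrakk> \<Longrightarrow> vnorm F (T x) \<le> C"
  shows "multinorm n E F T \<le> C"
  unfolding multinorm_def
proof (rule cSup_least)
  have "(\<lambda>i\<in>{..<n}. vzero (E i)) \<in> {x \<in> tuples n E. \<forall>i<n. vnorm (E i) (x i) \<le> 1}"
    using normed_E by (auto simp: normed_nspace.norm_zero normed_nspace.zero_closed)
  then show "(\<lambda>x. vnorm F (T x)) ` {x \<in> tuples n E. \<forall>i<n. vnorm (E i) (x i) \<le> 1} \<noteq> {}"
    by blast
qed (use assms in auto)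

text \<open>A supremum of reals bounds its set only if the set is bounded above; any
  \<open>C\<close> will do for that.\<close>

lemma multinorm_ball:
  assumes "\<And>x. \<lbrakk>x \<in> tuples n E; \<And>i. i < n \<Longrightarrow> vnorm (E i) (x i) \<le> 1\<rbrakk> \<Longrightarrow> vnorm F (T x) \<le> C"
    and "x \<in> tuples n E" "\<And>i. i < n \<Longrightarrow> vnorm (E i) (x i) \<le> 1"
  shows "vnorm F (T x) \<le> multinorm n E F T"
  unfolding multinorm_def using assms by (intro cSup_upper) (auto intro!: bdd_aboveI[of _ C])

lemma norm_le_multinorm:
  assumes "\<And>x. \<lbrakk>x \<in> tuples n E; \<And>i. i < n \<Longrightarrow> vnorm (E i) (x i) \<le> 1\<rbrakk> \<Longrightarrow> vnorm F (T x) \<le> C"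
    and "x \<in> tuples n E"
  shows "vnorm F (T x) \<le> multinorm n E F T * (\<Prod>i<n. vnorm (E i) (x i))"
  by (rule unit_ball_bound[OF multinorm_ball[OF assms(1)] assms(2)])

text \<open>Continuity at the zero tuple, where \<open>T\<close> vanishes because
  \<open>1 \<le> n\<close>, gives a box on which the values have norm below \<open>1\<close>.
  Shrinking a tuple from the unit balls by \<open>d\<close> moves it into the box and multiplies the
  value by \<open>d ^ n\<close>.\<close>

lemma multicontinuous_bound:
  assumes cont: "multicontinuous n E F T" and n: "1 \<le> n"
  obtains C where "\<And>x. \<lbrakk>x \<in> tuples n E; \<And>i. i < n \<Longrightarrow> vnorm (E i) (x i) \<le> 1\<rbrakk> \<Longrightarrow> vnorm F (T x) \<le> C"
proof -
  interpret MF: Metric_space "pts F" "vdist F" by (rule F.Metric_space_vdist)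
  define z where "z = (\<lambda>i\<in>{..<n}. vzero (E i))"
  have z: "z \<in> tuples n E"
    using normed_E by (auto simp: z_def normed_nspace.zero_closed)
  have Tz: "T z = vzero F"
    using n z by (intro zero_coord[of _ 0]) (auto simp: z_def)
  have top: "topspace (product_topology (\<lambda>i. vtop (E i)) {..<n}) = tuples n E"
    using normed_E by (auto simp: normed_nspace.topspace_vtop PiE_iff)
  obtain U where U: "openin (product_topology (\<lambda>i. vtop (E i)) {..<n}) U" "z \<in> U"
      "\<And>y. y \<in> U \<Longrightarrow> T y \<in> MF.mball (T z) 1"
    using cont z unfolding multicontinuous_def vtop_def[of F] MF.continuous_map_to_metric top
    by (meson zero_less_one)
  then obtain V where V: "\<And>i. i < n \<Longrightarrow> openin (vtop (E i)) (V i)" "z \<in> PiE {..<n} V" "PiE {..<n} V \<subseteq> U"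
    unfolding openin_product_topology_alt by (metis lessThan_iff)
  have "\<exists>r>0. \<forall>y\<in>pts (E i). vnorm (E i) y < r \<longrightarrow> y \<in> V i" if "i < n" for i
  proof -
    interpret Ei: normed_nspace "E i" using that normed_E by simp
    have "vzero (E i) \<in> V i"
      using V(2) that by (auto simp: z_def PiE_iff)
    moreover have "openin (vtop (E i)) (V i)"
      by (rule V(1)[OF that])
    ultimately obtain r where "r > 0" "Metric_space.mball (pts (E i)) (vdist (E i)) (vzero (E i)) r \<subseteq> V i"
      unfolding vtop_def Metric_space.openin_mtopology[OF Ei.Metric_space_vdist]
      by metis
    then show ?thesis
      by (auto simp: subset_iff Ei.in_mball_vdist Ei.vsub_zero Ei.closed)
  qed
  then obtain r where r: "\<And>i. i < n \<Longrightarrow> r i > 0"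
      "\<And>i y. \<lbrakk>i < n; y \<in> pts (E i); vnorm (E i) y < r i\<rbrakk> \<Longrightarrow> y \<in> V i"
    by metis
  \<comment> \<open>The half makes \<open>d < r i\<close> strict, since the shrunk coordinates are
    only known to have norm at most \<open>d\<close>.\<close>
  define d where "d = Min (r ` {..<n}) / 2"
  have d: "d > 0" "\<And>i. i < n \<Longrightarrow> d < r i"
  proof -
    have "Min (r ` {..<n}) > 0"
      using n r(1) by (subst Min_gr_iff) (auto simp: lessThan_empty_iff)
    then show "d > 0"
      by (simp add: d_def)
    show "d < r i" if "i < n" for i
    proof -
      have "Min (r ` {..<n}) \<le> r i"
        using that by simp
      then show ?thesis
        using \<open>Min (r ` {..<n}) > 0\<close> by (simp add: d_def)
    qed
  qed
  show ?thesis
  proof (rule that[of "1 / d ^ n"])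
    fix x assume x: "x \<in> tuples n E" and x1: "\<And>i. i < n \<Longrightarrow> vnorm (E i) (x i) \<le> 1"
    define y where "y = (\<lambda>i\<in>{..<n}. vscale (E i) (of_real d :: 'k) (x i))"
    have "y i \<in> V i" if "i < n" for i
    proof -
      interpret Ei: normed_nspace "E i" using that normed_E by simp
      have "vnorm (E i) (y i) \<le> d"
        using d x x1[OF that] that by (auto simp: y_def Ei.norm_scale PiE_iff intro: mult_left_le)
      then show ?thesis
        using x that d(2)[OF that] by (intro r(2)) (auto simp: y_def Ei.closed PiE_iff)
    qed
    then have "y \<in> PiE {..<n} V"
      by (auto simp: y_def PiE_iff)
    then have "y \<in> U"
      using V(3) by blast
    then have "T y \<in> pts F" "vnorm F (vsub F (T y) (T z)) < 1"
      using U(3) unfolding F.in_mball_vdist by blast+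
    then have "vnorm F (T y) < 1"
      by (simp add: Tz F.vsub_zero)
    moreover have "T y = vscale F (of_real d ^ n) (T x)"
      using scale_all[OF x, of "\<lambda>_. of_real d"] by (simp add: y_def)
    ultimately have "d ^ n * vnorm F (T x) < 1"
      using d x by (simp add: F.norm_scale into norm_power)
    then show "vnorm F (T x) \<le> 1 / d ^ n"
      using d by (simp add: field_simps)
  qed
qed

end

section \<open>Expansion over sums, and continuity of bounded multilinear maps\<close>

locale multilinear_map =
  fixes n :: nat and E :: "nat \<Rightarrow> ('k::real_normed_field, 'a) nspace"
    and F :: "('k, 'b) nspace" and A :: "(nat \<Rightarrow> 'a) \<Rightarrow> 'b"
  assumes normed_dom: "i < n \<Longrightarrow> normed_nspace (E i)"
    and normed_cod: "normed_nspace F"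
    and multilinear: "multilinear n E F A"
begin

sublocale homog_map n E F A
  using normed_dom normed_cod multilinear by (intro homog_map.intro) (auto simp: multilinear_def)

lemma add_coord:
  "\<lbrakk>i < n; x \<in> tuples n E; y \<in> pts (E i); z \<in> pts (E i)\<rbrakk> \<Longrightarrow>
    A (x(i := vadd (E i) y z)) = vadd F (A (x(i := y))) (A (x(i := z)))"
  using multilinear by (simp add: multilinear_def)

lemma vsub_coord:
  "\<lbrakk>i < n; x \<in> tuples n E; y \<in> pts (E i); z \<in> pts (E i)\<rbrakk> \<Longrightarrow>
    A (x(i := vsub (E i) y z)) = vsub F (A (x(i := y))) (A (x(i := z)))"
  by (simp add: vsub_def add_coord scale_coord normed_nspace.scale_closed normed_E)

lemma vsum_coord:
  assumes "i < n" "x \<in> tuples n E" "finite J" "y ` J \<subseteq> pts (E i)"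
  shows "A (x(i := vsum (E i) y J)) = vsum F (\<lambda>j. A (x(i := y j))) J"
proof -
  interpret Ei: normed_nspace "E i" using assms normed_E by simp
  show ?thesis using assms(3,4)
  proof (induction J)
    case empty
    show ?case
      unfolding Ei.vsum_empty F.vsum_empty
      by (rule zero_coord[OF upd_tuple, where i = i]) (use assms in \<open>simp_all add: Ei.closed\<close>)
  next
    case (insert j J)
    have "A (x(i := y l)) \<in> pts F" if "l \<in> insert j J" for l
      using that insert assms by (intro into upd_tuple) auto
    then have "vsum F (\<lambda>j. A (x(i := y j))) (insert j J)
        = vadd F (A (x(i := y j))) (vsum F (\<lambda>j. A (x(i := y j))) J)"
      using insert.hyps by (intro F.vsum_insert) auto
    moreover have "vsum (E i) y (insert j J) = vadd (E i) (y j) (vsum (E i) y J)"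
      using insert by (intro Ei.vsum_insert) auto
    moreover have "A (x(i := vadd (E i) (y j) (vsum (E i) y J)))
        = vadd F (A (x(i := y j))) (A (x(i := vsum (E i) y J)))"
      using insert.prems assms by (intro add_coord Ei.vsum_closed) auto
    moreover have "A (x(i := vsum (E i) y J)) = vsum F (\<lambda>j. A (x(i := y j))) J"
      using insert.prems by (intro insert.IH) simp
    ultimately show ?case
      by (simp only:)
  qed
qed

text \<open>Multiplying out \<open>n\<close> sums over \<open>J\<close> means choosing one summand
  per coordinate. The choices are extensional functions, so that each of them is counted
  once.\<close>

lemma vsum_expand:
  assumes J: "finite J" and y: "\<And>i j. \<lbrakk>i < n; j \<in> J\<rbrakk> \<Longrightarrow> y i j \<in> pts (E i)"
  shows "A (\<lambda>i\<in>{..<n}. vsum (E i) (y i) J) = vsum F (\<lambda>f. A (\<lambda>i\<in>{..<n}. y i (f i))) ({..<n} \<rightarrow>\<^sub>E J)"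
proof -
  have ys: "vsum (E i) (y i) J \<in> pts (E i)" if "i < n" for i
    using that y normed_E by (intro normed_nspace.vsum_closed) auto
  \<comment> \<open>\<open>k\<close> is the number of coordinates expanded so far. The tuple
    \<open>x\<close> is general because the induction step stores the sum in coordinate
    \<open>k\<close>, still unexpanded, in it.\<close>
  have "\<lbrakk>x \<in> tuples n E; k \<le> n\<rbrakk> \<Longrightarrow> A (\<lambda>i\<in>{..<n}. if i < k then vsum (E i) (y i) J else x i)
     = vsum F (\<lambda>f. A (\<lambda>i\<in>{..<n}. if i < k then y i (f i) else x i)) ({..<k} \<rightarrow>\<^sub>E J)" for x k
  proof (induction k arbitrary: x)
    case 0
    have "(\<lambda>i\<in>{..<n}. if i < 0 then a i else x i) = x" for a
      using 0 by (auto simp: fun_eq_iff PiE_iff extensional_def)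
    then show ?case
      using 0 by (simp add: F.vsum_singleton into)
  next
    case (Suc k)
    define w where "w f = (\<lambda>i\<in>{..<n}. if i < k then y i (f i) else x i)" for f
    have w: "w f \<in> tuples n E" if "f \<in> {..<k} \<rightarrow>\<^sub>E J" for f
      using that Suc.prems y by (auto simp: w_def PiE_iff)
    have wj: "A ((w f)(k := y k j)) \<in> pts F" if "f \<in> {..<k} \<rightarrow>\<^sub>E J" "j \<in> J" for f j
      using that w y Suc.prems by (intro into upd_tuple) auto
    define x' where "x' = x(k := vsum (E k) (y k) J)"
    have x': "x' \<in> tuples n E"
      using Suc.prems ys by (auto simp: x'_def intro!: upd_tuple)
    have "(\<lambda>i\<in>{..<n}. if i < Suc k then vsum (E i) (y i) J else x i)
        = (\<lambda>i\<in>{..<n}. if i < k then vsum (E i) (y i) J else x' i)"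
      using Suc.prems by (auto simp: x'_def fun_eq_iff less_Suc_eq)
    then have "A (\<lambda>i\<in>{..<n}. if i < Suc k then vsum (E i) (y i) J else x i)
        = A (\<lambda>i\<in>{..<n}. if i < k then vsum (E i) (y i) J else x' i)"
      by simp
    also have "\<dots> = vsum F (\<lambda>f. A (\<lambda>i\<in>{..<n}. if i < k then y i (f i) else x' i)) ({..<k} \<rightarrow>\<^sub>E J)"
      by (rule Suc.IH[OF x']) (use Suc.prems in simp)
    also have "\<dots> = vsum F (\<lambda>f. vsum F (\<lambda>j. A ((w f)(k := y k j))) J) ({..<k} \<rightarrow>\<^sub>E J)"
    proof (rule F.vsum_cong[OF refl])
      fix f assume f: "f \<in> {..<k} \<rightarrow>\<^sub>E J"
      have "(\<lambda>i\<in>{..<n}. if i < k then y i (f i) else x' i) = (w f)(k := vsum (E k) (y k) J)"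
        using Suc.prems by (auto simp: x'_def w_def fun_eq_iff)
      then show "A (\<lambda>i\<in>{..<n}. if i < k then y i (f i) else x' i)
          = vsum F (\<lambda>j. A ((w f)(k := y k j))) J"
        using vsum_coord[OF _ w[OF f] J, of k "y k"] Suc.prems y by (auto simp: image_subset_iff)
    qed (auto intro!: F.vsum_closed wj)
    \<comment> \<open>The sums are swapped to obtain pairs \<open>(j, f)\<close> in the order of
      \<open>inj_combinator\<close> and \<open>PiE_insert_eq\<close>.\<close>
    also have "\<dots> = vsum F (\<lambda>j. vsum F (\<lambda>f. A ((w f)(k := y k j))) ({..<k} \<rightarrow>\<^sub>E J)) J"
      using J by (intro F.vsum_swap) (auto intro!: finite_PiE wj)
    also have "\<dots> = vsum F (\<lambda>(j, f). A ((w f)(k := y k j))) (J \<times> ({..<k} \<rightarrow>\<^sub>E J))"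
      using J by (intro F.vsum_Sigma) (auto intro!: finite_PiE wj)
    also have "\<dots> = vsum F (\<lambda>p. A (\<lambda>i\<in>{..<n}. if i < Suc k
        then y i ((case p of (j, f) \<Rightarrow> f(k := j)) i) else x i)) (J \<times> ({..<k} \<rightarrow>\<^sub>E J))"
    proof (rule F.vsum_cong[OF refl], safe)
      fix j f assume "j \<in> J" "f \<in> {..<k} \<rightarrow>\<^sub>E J"
      moreover have "(w f)(k := y k j) = (\<lambda>i\<in>{..<n}. if i < Suc k then y i ((f(k := j)) i) else x i)"
        using Suc.prems by (auto simp: w_def fun_eq_iff less_Suc_eq)
      ultimately show "A ((w f)(k := y k j))
            = A (\<lambda>i\<in>{..<n}. if i < Suc k then y i ((f(k := j)) i) else x i)"
        "A (\<lambda>i\<in>{..<n}. if i < Suc k then y i ((f(k := j)) i) else x i) \<in> pts F"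
        using wj[of f j] by simp_all
    qed
    also have "\<dots> = vsum F (\<lambda>f. A (\<lambda>i\<in>{..<n}. if i < Suc k then y i (f i) else x i))
        ((\<lambda>(j, f). f(k := j)) ` (J \<times> ({..<k} \<rightarrow>\<^sub>E J)))"
    proof (rule F.vsum_reindex[symmetric])
      show "inj_on (\<lambda>(j, f). f(k := j)) (J \<times> ({..<k} \<rightarrow>\<^sub>E J))"
        using inj_combinator[of k "{..<k}" "\<lambda>_. J"] by simp
      show "(\<lambda>f. A (\<lambda>i\<in>{..<n}. if i < Suc k then y i (f i) else x i)) `
          (\<lambda>(j, f). f(k := j)) ` (J \<times> ({..<k} \<rightarrow>\<^sub>E J)) \<subseteq> pts F"
        unfolding image_subset_iff
      proof (safe, rule into)
        fix j f assume "j \<in> J" "f \<in> {..<k} \<rightarrow>\<^sub>E J"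
        then show "(\<lambda>i\<in>{..<n}. if i < Suc k then y i ((f(k := j)) i) else x i) \<in> tuples n E"
          using Suc.prems y by (auto simp: PiE_iff less_Suc_eq)
      qed
    qed
    also have "(\<lambda>(j, f). f(k := j)) ` (J \<times> ({..<k} \<rightarrow>\<^sub>E J)) = ({..<Suc k} \<rightarrow>\<^sub>E J)"
      using PiE_insert_eq[of k "{..<k}" "\<lambda>_. J"] by (simp add: lessThan_Suc)
    finally show ?case .
  qed
  note * = this[of "\<lambda>i\<in>{..<n}. vsum (E i) (y i) J" n]
  show ?thesis
    using * ys by (simp cong: restrict_cong)
qed

text \<open>Replacing the coordinates one at a time, each step changes the value by a multiple of the
  change of one coordinate.\<close>

lemma bounded_multicontinuous:
  assumes bound: "\<And>x. x \<in> tuples n E \<Longrightarrow> vnorm F (A x) \<le> C * (\<Prod>i<n. vnorm (E i) (x i))"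
  shows "multicontinuous n E F A"
proof -
  interpret MF: Metric_space "pts F" "vdist F" by (rule F.Metric_space_vdist)
  \<comment> \<open>\<open>C\<close> may be negative, and the estimates below multiply inequalities
    by the constant.\<close>
  define C' where "C' = max C 0"
  have C': "C' \<ge> 0" "vnorm F (A x) \<le> C' * (\<Prod>i<n. vnorm (E i) (x i))" if "x \<in> tuples n E" for x
    using bound[OF that] mult_right_mono[OF _ prod_norm_nonneg[OF that], of C C'] by (auto simp: C'_def)
  have top: "topspace (product_topology (\<lambda>i. vtop (E i)) {..<n}) = tuples n E"
    using normed_E by (auto simp: normed_nspace.topspace_vtop PiE_iff)
  have "\<exists>U. openin (product_topology (\<lambda>i. vtop (E i)) {..<n}) U \<and> x \<in> U \<and>
      (\<forall>y\<in>U. A y \<in> MF.mball (A x) e)" if x: "x \<in> tuples n E" and e: "e > 0" for x e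
  proof -
    \<comment> \<open>A common bound for the coordinates of \<open>x\<close> and of all points
      within distance \<open>1\<close> of it. The summand \<open>1\<close> also gives
      \<open>1 \<le> M\<close>, needed to pass from \<open>M ^ (n - 1)\<close> to
      \<open>M ^ n\<close>.\<close>
    define M where "M = 1 + (\<Sum>i<n. vnorm (E i) (x i))"
    have xi: "x i \<in> pts (E i)" "0 \<le> vnorm (E i) (x i)" if "i < n" for i
      using x that normed_E by (auto simp: PiE_iff normed_nspace.norm_nonneg)
    have M: "1 \<le> M" "\<And>i. i < n \<Longrightarrow> vnorm (E i) (x i) + 1 \<le> M"
      using xi by (auto simp: M_def intro!: sum_nonneg member_le_sum)
    define K where "K = C' * M ^ n"
    have "C' \<ge> 0" by (simp add: C'_def)
    then have K: "K \<ge> 0" using M by (simp add: K_def)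
    \<comment> \<open>Each of the \<open>n\<close> replacements changes the value by at most
      \<open>K * d\<close>, and this choice keeps the total below \<open>e\<close>. The
      \<open>1\<close> in the denominator covers \<open>K = 0\<close>.\<close>
    define d where "d = min 1 (e / (real n * K + 1))"
    have d: "0 < d" "d \<le> 1" "real n * (K * d) < e"
    proof -
      have *: "real n * K + 1 > 0" using K by (simp add: add_nonneg_pos)
      then show "0 < d" "d \<le> 1" using e by (auto simp: d_def)
      have "real n * (K * d) \<le> (real n * K) * (e / (real n * K + 1))"
        unfolding mult.assoc[symmetric] using K by (intro mult_left_mono) (auto simp: d_def)
      also have "\<dots> < e" using * e by (simp add: field_simps)
      finally show "real n * (K * d) < e" .
    qed
    define U where "U = (\<Pi>\<^sub>E i\<in>{..<n}. Metric_space.mball (pts (E i)) (vdist (E i)) (x i) d)"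
    have U: "y i \<in> pts (E i)" "vnorm (E i) (vsub (E i) (y i) (x i)) < d" if "y \<in> U" "i < n" for y i
      using that normed_nspace.in_mball_vdist[OF normed_E[OF that(2)]] by (auto simp: U_def PiE_iff)
    have "openin (product_topology (\<lambda>i. vtop (E i)) {..<n}) U"
      unfolding U_def vtop_def using normed_E
      by (subst openin_PiE) (auto simp: Metric_space.openin_mball normed_nspace.Metric_space_vdist)
    moreover have "x \<in> U"
      using x d normed_E by (auto simp: U_def PiE_iff normed_nspace.in_mball_vdist normed_nspace.vsub_self
        normed_nspace.norm_zero)
    moreover have "A y \<in> MF.mball (A x) e" if y: "y \<in> U" for y
    proof -
      have yt: "y \<in> tuples n E"
        using y U by (auto simp: U_def PiE_iff)
      have yM: "vnorm (E i) (y i) \<le> M" if "i < n" for i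
        using normed_nspace.norm_le_vsub[OF normed_E[OF that], of "y i" "x i"] U[OF y that] xi[OF that]
          M(2)[OF that] d by simp
      define z where "z k = (\<lambda>i\<in>{..<n}. if i < k then y i else x i)" for k
      have z: "z k \<in> tuples n E" for k
        using x yt by (auto simp: z_def PiE_iff)
      have zM: "vnorm (E i) (z k i) \<le> M" if "i < n" for i k
        using that yM M(2)[OF that] by (simp add: z_def)
      have "k \<le> n \<Longrightarrow> vnorm F (vsub F (A (z k)) (A x)) \<le> real k * (K * d)" for k
      proof (induction k)
        case 0
        have "z 0 = x"
          using x by (auto simp: z_def fun_eq_iff PiE_iff extensional_def)
        then show ?case
          by (simp add: F.vsub_self F.norm_zero into x)
      next
        case (Suc k)
        interpret Ek: normed_nspace "E k" using Suc.prems normed_E by simp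
        define v where "v = vsub (E k) (y k) (x k)"
        have v: "v \<in> pts (E k)" "vnorm (E k) v \<le> d"
          using Suc.prems U[OF y] xi by (auto simp: v_def Ek.vsub_closed less_imp_le)
        have zv: "(z k)(k := v) \<in> tuples n E"
          using z v Suc.prems by (intro upd_tuple) auto
        have "z (Suc k) = (z k)(k := y k)" "(z k)(k := x k) = z k"
          using Suc.prems by (auto simp: z_def fun_eq_iff less_Suc_eq)
        then have "vsub F (A (z (Suc k))) (A (z k)) = A ((z k)(k := v))"
          unfolding v_def using vsub_coord[of k "z k" "y k" "x k"] Suc.prems z xi U[OF y] by simp
        then have "vnorm F (vsub F (A (z (Suc k))) (A (z k)))
            \<le> C' * (\<Prod>i<n. vnorm (E i) (((z k)(k := v)) i))"
          using C'(2)[OF zv] by simp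
        also have "(\<Prod>i<n. vnorm (E i) (((z k)(k := v)) i)) \<le> (\<Prod>i<n. if i = k then d else M)"
          using zM v zv normed_E
          by (intro prod_mono) (auto simp: PiE_iff normed_nspace.norm_nonneg)
        also have "\<dots> = d * M ^ (n - 1)"
          using Suc.prems by (subst prod.remove[of _ k]) auto
        also have "\<dots> \<le> d * M ^ n"
          using d M by (intro mult_left_mono power_increasing) auto
        finally have "vnorm F (vsub F (A (z (Suc k))) (A (z k))) \<le> C' * (d * M ^ n)"
          using \<open>C' \<ge> 0\<close> by (simp add: mult_left_mono)
        also have "\<dots> = K * d"
          by (simp add: K_def)
        finally have "vnorm F (vsub F (A (z (Suc k))) (A (z k))) \<le> K * d" .
        moreover have "vnorm F (vsub F (A (z (Suc k))) (A x))
            \<le> vnorm F (vsub F (A (z (Suc k))) (A (z k))) + vnorm F (vsub F (A (z k)) (A x))"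
          using z x by (intro F.norm_vsub_triangle into)
        ultimately show ?case
          using Suc by (simp add: algebra_simps)
      qed
      moreover have "z n = y"
        using yt by (auto simp: z_def fun_eq_iff PiE_iff extensional_def)
      ultimately have "vnorm F (vsub F (A y) (A x)) < e"
        using d(3) by fastforce
      then show ?thesis
        unfolding F.in_mball_vdist using into[OF x] into[OF yt] by blast
    qed
    ultimately show ?thesis by blast
  qed
  then show ?thesis
    unfolding multicontinuous_def vtop_def[of F] MF.continuous_map_to_metric top by blast
qed

end

section \<open>Homogeneous maps and polynomials\<close>

text \<open>Homogeneity of degree \<open>n\<close> is enough to derive a bound from continuity and
  to compare values with norms. The locale serves linear operators, polynomials and the maps that
  these induce on sequence spaces.\<close>

locale homogeneous_map =
  fixes n :: nat and E :: "('k::real_normed_field, 'a) nspace"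
    and F :: "('k, 'b) nspace" and P :: "'a \<Rightarrow> 'b"
  assumes normed_dom: "normed_nspace E"
    and normed_cod: "normed_nspace F"
    and into: "x \<in> pts E \<Longrightarrow> P x \<in> pts F"
    and scale: "x \<in> pts E \<Longrightarrow> P (vscale E c x) = vscale F (c ^ n) (P x)"
    and degree_pos: "1 \<le> n"
begin

sublocale E: normed_nspace E by (rule normed_dom)
sublocale F: normed_nspace F by (rule normed_cod)

lemma zero: "P (vzero E) = vzero F"
proof -
  have "P (vscale E 0 (vzero E)) = vscale F (0 ^ n) (P (vzero E))"
    by (intro scale E.zero_closed)
  then show ?thesis
    using degree_pos by (simp add: E.scale_zero_right E.zero_closed F.scale_zero_left into zero_power)
qed

lemma unit_ball_bound:
  assumes bound: "\<And>x. \<lbrakk>x \<in> pts E; vnorm E x \<le> 1\<rbrakk> \<Longrightarrow> vnorm F (P x) \<le> C"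
    and x: "x \<in> pts E"
  shows "vnorm F (P x) \<le> C * vnorm E x ^ n"
proof (cases "x = vzero E")
  case True
  then show ?thesis
    using degree_pos by (simp add: zero F.norm_zero E.norm_zero zero_power)
next
  case False
  then have pos: "0 < vnorm E x"
    using E.norm_nonneg[OF x] E.norm_eq_0_iff[OF x] by linarith
  define c :: 'k where "c = of_real (1 / vnorm E x)"
  have nc: "norm c = 1 / vnorm E x"
    using pos by (simp add: c_def norm_divide)
  have "vnorm F (P (vscale E c x)) \<le> C"
    using x pos by (intro bound) (simp_all add: E.closed E.norm_scale nc)
  then have "(1 / vnorm E x) ^ n * vnorm F (P x) \<le> C"
    using x by (simp add: scale F.norm_scale into norm_power nc)
  then show ?thesis
    using pos by (simp add: power_one_over field_simps)
qed

lemma continuous_bound: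
  assumes "continuous_map (vtop E) (vtop F) P"
  obtains C where "\<And>x. \<lbrakk>x \<in> pts E; vnorm E x \<le> 1\<rbrakk> \<Longrightarrow> vnorm F (P x) \<le> C"
proof -
  obtain d where d: "d > 0"
      "\<And>x. \<lbrakk>x \<in> pts E; vnorm E (vsub E x (vzero E)) < d\<rbrakk> \<Longrightarrow> vnorm F (vsub F (P x) (P (vzero E))) < 1"
    using assms E.zero_closed unfolding continuous_map_vtop[OF normed_dom normed_cod]
    by (meson zero_less_one)
  show ?thesis
  proof (rule that[of "1 / (d / 2) ^ n"])
    \<comment> \<open>Shrinking by \<open>d / 2\<close> puts the unit ball strictly inside the ball
      of radius \<open>d\<close>; by homogeneity the value shrinks by
      \<open>(d / 2) ^ n\<close>.\<close>
    fix x assume x: "x \<in> pts E" "vnorm E x \<le> 1"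
    have "vnorm E (vscale E (of_real (d / 2)) x) < d"
    proof -
      have "d / 2 * vnorm E x \<le> d / 2"
        using d x by (intro mult_left_le) auto
      then show ?thesis
        using d x by (simp add: E.norm_scale del: of_real_divide)
    qed
    then have "vnorm F (P (vscale E (of_real (d / 2)) x)) < 1"
      using d(2)[of "vscale E (of_real (d / 2)) x"] x
      by (simp add: E.closed E.vsub_zero zero F.vsub_zero into)
    then have "(d / 2) ^ n * vnorm F (P x) < 1"
      using x d by (simp add: scale into F.norm_scale norm_power del: of_real_divide)
    then show "vnorm F (P x) \<le> 1 / (d / 2) ^ n"
      using d by (simp add: field_simps)
  qed
qed

lemma ball_norm_le:
  assumes "\<And>x. \<lbrakk>x \<in> pts E; vnorm E x \<le> 1\<rbrakk> \<Longrightarrow> vnorm F (P x) \<le> C"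
  shows "ball_norm E F P \<le> C"
  unfolding ball_norm_def
proof (rule cSup_least)
  have "vzero E \<in> {x \<in> pts E. vnorm E x \<le> 1}"
    by (simp add: E.zero_closed E.norm_zero)
  then show "(\<lambda>x. vnorm F (P x)) ` {x \<in> pts E. vnorm E x \<le> 1} \<noteq> {}"
    by blast
qed (use assms in auto)

lemma ball_norm_ball:
  assumes "\<And>x. \<lbrakk>x \<in> pts E; vnorm E x \<le> 1\<rbrakk> \<Longrightarrow> vnorm F (P x) \<le> C"
    and "x \<in> pts E" "vnorm E x \<le> 1"
  shows "vnorm F (P x) \<le> ball_norm E F P"
  unfolding ball_norm_def using assms by (intro cSup_upper) (auto intro!: bdd_aboveI[of _ C])

lemma ball_norm_nonneg:
  assumes "\<And>x. \<lbrakk>x \<in> pts E; vnorm E x \<le> 1\<rbrakk> \<Longrightarrow> vnorm F (P x) \<le> C"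
  shows "0 \<le> ball_norm E F P"
  using F.norm_nonneg[OF into[OF E.zero_closed]] ball_norm_ball[OF assms, of "vzero E"]
  by (simp add: E.zero_closed E.norm_zero)

lemma norm_le_ball_norm:
  assumes "\<And>x. \<lbrakk>x \<in> pts E; vnorm E x \<le> 1\<rbrakk> \<Longrightarrow> vnorm F (P x) \<le> C" and "x \<in> pts E"
  shows "vnorm F (P x) \<le> ball_norm E F P * vnorm E x ^ n"
  by (rule unit_ball_bound[OF ball_norm_ball[OF assms(1)] assms(2)])

end

section \<open>Symmetrization and polarization\<close>

abbreviation perms :: "nat \<Rightarrow> (nat \<Rightarrow> nat) set" where
  "perms n \<equiv> {\<sigma>. \<sigma> permutes {..<n}}"

definition symmetrize ::
  "nat \<Rightarrow> ('k::real_normed_field, 'a) nspace \<Rightarrow> ('k, 'b) nspace \<Rightarrow> ((nat \<Rightarrow> 'a) \<Rightarrow> 'b) \<Rightarrow> (nat \<Rightarrow> 'a) \<Rightarrow> 'b" where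
  "symmetrize n E F B =
     (\<lambda>x\<in>tuples_in n E. vscale F (1 / fact n) (vsum F (\<lambda>\<sigma>. B (x \<circ> \<sigma>)) (perms n)))"

abbreviation signs :: "nat \<Rightarrow> (nat \<Rightarrow> 'k::real_normed_field) set" where
  "signs n \<equiv> {..<n} \<rightarrow>\<^sub>E {1, - 1}"

text \<open>The right side of the polarization formula, with the signs taken in the field. It makes
  sense for every map \<open>P\<close>, so it can be formed for a pointwise limit before that limit
  is known to be a polynomial.\<close>

definition polarize ::
  "nat \<Rightarrow> ('k::real_normed_field, 'a) nspace \<Rightarrow> ('k, 'b) nspace \<Rightarrow> ('a \<Rightarrow> 'b) \<Rightarrow> (nat \<Rightarrow> 'a) \<Rightarrow> 'b" where
  "polarize n E F P =
     (\<lambda>x\<in>tuples_in n E. vscale F (1 / (2 ^ n * fact n))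
        (vsum F (\<lambda>e. vscale F (\<Prod>i<n. e i) (P (vsum E (\<lambda>i. vscale E (e i) (x i)) {..<n}))) (signs n)))"

lemma finite_signs: "finite (signs n)"
  by (intro finite_PiE) auto

lemma card_signs: "card (signs n :: (nat \<Rightarrow> 'k::real_normed_field) set) = 2 ^ n"
  by (simp add: card_PiE numeral_2_eq_2)

lemma norm_sign: "e \<in> signs n \<Longrightarrow> i < n \<Longrightarrow> norm (e i) = 1"
  by (drule PiE_mem[of _ _ _ i]) auto

lemma norm_prod_signs: "e \<in> signs n \<Longrightarrow> norm (\<Prod>i<n. e i) = 1"
  by (simp add: norm_sign flip: prod_norm)

text \<open>Grouping the factors by the value of \<open>f\<close>, the sum becomes the product over \<open>j\<close> of
  \<open>1 + (- 1) ^ (card (f -` {j}) + 1)\<close>, and for a non-injective \<open>f\<close> some fibre is empty.\<close>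

lemma sum_signs:
  assumes f: "f \<in> {..<n} \<rightarrow>\<^sub>E {..<n}"
  shows "(\<Sum>e\<in>signs n. (\<Prod>i<n. e i) * (\<Prod>i<n. e (f i)))
    = (if inj_on f {..<n} then 2 ^ n else 0 :: 'k::real_normed_field)"
proof -
  define m where "m j = card {i \<in> {..<n}. f i = j}" for j
  have fib: "(\<Prod>i<n. e (f i)) = (\<Prod>j<n. e j ^ m j)" for e :: "nat \<Rightarrow> 'k"
  proof -
    have "(\<Prod>i<n. e (f i)) = (\<Prod>j<n. \<Prod>i\<in>{i \<in> {..<n}. f i = j}. e (f i))"
      using f by (subst prod.group) auto
    also have "\<dots> = (\<Prod>j<n. e j ^ m j)"
      by (intro prod.cong) (auto simp: m_def)
    finally show ?thesis .
  qed
  have "(\<Sum>e\<in>signs n. (\<Prod>i<n. e i) * (\<Prod>i<n. e (f i))) = (\<Sum>e\<in>signs n. \<Prod>j<n. (e j :: 'k) ^ Suc (m j))"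
    by (simp add: fib prod.distrib)
  also have "\<dots> = (\<Prod>j<n. \<Sum>s\<in>{1, - 1}. (s :: 'k) ^ Suc (m j))"
    by (subst prod_sum_PiE) auto
  also have "\<dots> = (\<Prod>j<n. 1 + (- 1) ^ Suc (m j))"
    by simp
  also have "\<dots> = (if inj_on f {..<n} then 2 ^ n else 0)"
  proof (cases "inj_on f {..<n}")
    case True
    then have surj: "f ` {..<n} = {..<n}"
      using f by (intro endo_inj_surj) auto
    have "m j = 1" if "j < n" for j
    proof -
      have "j \<in> f ` {..<n}"
        using that surj by simp
      then obtain i where "i < n" "f i = j"
        by blast
      then have "{i \<in> {..<n}. f i = j} = {i}"
        using True by (auto simp: inj_on_def)
      then show ?thesis
        by (simp add: m_def)
    qed
    then show ?thesis
      using True by simp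
  next
    case False
    then have "f ` {..<n} \<noteq> {..<n}"
      using eq_card_imp_inj_on[of "{..<n}" f] by auto
    then obtain j where j: "j < n" "j \<notin> f ` {..<n}"
      using f by (auto simp: PiE_iff)
    then have "m j = 0"
      by (auto simp: m_def)
    then show ?thesis
      using j False by (auto intro!: prod_zero bexI[of _ j])
  qed
  finally show ?thesis .
qed

lemma perm_tuple:
  assumes "\<sigma> permutes {..<n}" "x \<in> tuples_in n E"
  shows "x \<circ> \<sigma> \<in> tuples_in n E"
  using assms permutes_in_image[OF assms(1)] by (auto simp: PiE_iff extensional_def)

text \<open>The changed coordinate moves to the preimage of \<open>i\<close>. Linearity of a
  symmetrization in coordinate \<open>i\<close> thus reduces to linearity of each summand in that
  preimage.\<close>

lemma upd_perm: "\<sigma> permutes A \<Longrightarrow> x(i := y) \<circ> \<sigma> = (x \<circ> \<sigma>)(inv_into UNIV \<sigma> i := y)"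
  by (auto simp: fun_eq_iff permutes_inverses permutes_inv_eq)

lemma const_tuple: "x \<in> pts E \<Longrightarrow> (\<lambda>i\<in>{..<n}. x) \<in> tuples_in n E"
  by auto

lemma const_perm: "\<sigma> permutes {..<n} \<Longrightarrow> (\<lambda>i\<in>{..<n}. x) \<circ> \<sigma> = (\<lambda>i\<in>{..<n}. x)"
  using permutes_in_image[of \<sigma> "{..<n}"] by (auto simp: fun_eq_iff)

lemma finite_perms: "finite (perms n)"
  by (simp add: finite_permutations)

lemma card_perms: "card (perms n) = fact n"
  by (simp add: card_permutations)

locale multilinear_power =
  fixes n :: nat and E :: "('k::real_normed_field, 'a) nspace"
    and F :: "('k, 'b) nspace" and B :: "(nat \<Rightarrow> 'a) \<Rightarrow> 'b"
  assumes normed_base: "normed_nspace E"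
    and normed_target: "normed_nspace F"
    and multilinear_B: "multilinear n (\<lambda>_. E) F B"
begin

sublocale E: normed_nspace E by (rule normed_base)
sublocale multilinear_map n "\<lambda>_. E" F B
  using normed_base normed_target multilinear_B by (intro multilinear_map.intro) auto

lemma symmetrize_eq:
  "x \<in> tuples_in n E \<Longrightarrow>
    symmetrize n E F B x = vscale F (1 / fact n) (vsum F (\<lambda>\<sigma>. B (x \<circ> \<sigma>)) (perms n))"
  by (simp add: symmetrize_def)

lemma into_perm: "x \<in> tuples_in n E \<Longrightarrow> (\<lambda>\<sigma>. B (x \<circ> \<sigma>)) ` perms n \<subseteq> pts F"
  by (auto intro!: into perm_tuple)

lemma symmetrize_into: "x \<in> tuples_in n E \<Longrightarrow> symmetrize n E F B x \<in> pts F"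
  unfolding symmetrize_eq by (intro F.scale_closed F.vsum_closed into_perm)

lemma multilinear_symmetrize: "multilinear n (\<lambda>_. E) F (symmetrize n E F B)"
  unfolding multilinear_def
proof (intro conjI ballI allI impI)
  show "symmetrize n E F B \<in> tuples_in n E \<rightarrow>\<^sub>E pts F"
    using symmetrize_into by (intro PiE_I) (simp_all add: symmetrize_def)
next
  fix i x y z assume i: "i < n" and x: "x \<in> tuples_in n E" and y: "y \<in> pts E" and z: "z \<in> pts E"
  have u: "x(i := v) \<in> tuples_in n E" if "v \<in> pts E" for v
    using x i that by (intro upd_tuple)
  have "vsum F (\<lambda>\<sigma>. B (x(i := vadd E y z) \<circ> \<sigma>)) (perms n)
      = vsum F (\<lambda>\<sigma>. vadd F (B (x(i := y) \<circ> \<sigma>)) (B (x(i := z) \<circ> \<sigma>))) (perms n)"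
  proof (rule F.vsum_cong[OF refl])
    fix \<sigma> assume "\<sigma> \<in> perms n"
    then have s: "\<sigma> permutes {..<n}" by simp
    show "B (x(i := vadd E y z) \<circ> \<sigma>) = vadd F (B (x(i := y) \<circ> \<sigma>)) (B (x(i := z) \<circ> \<sigma>))"
      unfolding upd_perm[OF s]
      using permutes_in_image[OF permutes_inv[OF s], of i] i y z by (intro add_coord perm_tuple s x) auto
  qed (auto intro!: F.closed into perm_tuple u y z)
  also have "\<dots> = vadd F (vsum F (\<lambda>\<sigma>. B (x(i := y) \<circ> \<sigma>)) (perms n)) (vsum F (\<lambda>\<sigma>. B (x(i := z) \<circ> \<sigma>)) (perms n))"
    by (intro F.vsum_add into_perm u y z)
  finally show "symmetrize n E F B (x(i := vadd E y z))
      = vadd F (symmetrize n E F B (x(i := y))) (symmetrize n E F B (x(i := z)))"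
    using u y z by (simp only: symmetrize_eq E.closed F.scale_add_right F.vsum_closed into_perm)
next
  fix i x c y assume i: "i < n" and x: "x \<in> tuples_in n E" and y: "y \<in> pts E"
  have u: "x(i := v) \<in> tuples_in n E" if "v \<in> pts E" for v
    using x i that by (intro upd_tuple)
  have "vsum F (\<lambda>\<sigma>. B (x(i := vscale E c y) \<circ> \<sigma>)) (perms n)
      = vsum F (\<lambda>\<sigma>. vscale F c (B (x(i := y) \<circ> \<sigma>))) (perms n)"
  proof (rule F.vsum_cong[OF refl])
    fix \<sigma> assume "\<sigma> \<in> perms n"
    then have s: "\<sigma> permutes {..<n}" by simp
    show "B (x(i := vscale E c y) \<circ> \<sigma>) = vscale F c (B (x(i := y) \<circ> \<sigma>))"
      unfolding upd_perm[OF s]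
      using permutes_in_image[OF permutes_inv[OF s], of i] i y by (intro scale_coord perm_tuple s x) auto
  qed (auto intro!: F.closed into perm_tuple u y)
  also have "\<dots> = vscale F c (vsum F (\<lambda>\<sigma>. B (x(i := y) \<circ> \<sigma>)) (perms n))"
    by (intro F.vsum_scale into_perm u y)
  finally show "symmetrize n E F B (x(i := vscale E c y)) = vscale F c (symmetrize n E F B (x(i := y)))"
    using u y
    by (simp only: symmetrize_eq E.closed F.scale_scale F.vsum_closed into_perm mult.commute)
qed

text \<open>Left composition with a permutation maps \<open>perms n\<close> bijectively onto itself,
  so permuting the tuple only reorders the sum.\<close>

lemma symmetric_symmetrize: "symmetric_map n E (symmetrize n E F B)"
  unfolding symmetric_map_def
proof (intro allI impI ballI)
  fix \<tau> x assume t: "\<tau> permutes {..<n}" and x: "x \<in> tuples_in n E"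
  have img: "(\<lambda>\<sigma>. \<tau> \<circ> \<sigma>) ` perms n = perms n"
    using image_compose_permutations_left[OF t] by auto
  have "vsum F (\<lambda>\<sigma>. B (x \<circ> \<sigma>)) (perms n) = vsum F (\<lambda>\<sigma>. B (x \<circ> \<sigma>)) ((\<lambda>\<sigma>. \<tau> \<circ> \<sigma>) ` perms n)"
    by (simp only: img)
  also have "\<dots> = vsum F (\<lambda>\<sigma>. B (x \<circ> (\<tau> \<circ> \<sigma>))) (perms n)"
  proof (rule F.vsum_reindex)
    show "inj_on ((\<circ>) \<tau>) (perms n)"
      by (rule inj_on_subset[OF fun.inj_map[OF permutes_inj[OF t]]]) simp
    show "(\<lambda>\<sigma>. B (x \<circ> \<sigma>)) ` (\<circ>) \<tau> ` perms n \<subseteq> pts F"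
      unfolding img by (rule into_perm[OF x])
  qed
  finally show "symmetrize n E F B (x \<circ> \<tau>) = symmetrize n E F B x"
    by (simp only: symmetrize_eq x perm_tuple[OF t x] o_assoc)
qed

text \<open>All \<open>fact n\<close> summands coincide. Outside the tuples both maps are
  \<open>undefined\<close>, so they agree as functions.\<close>

lemma symmetrize_id:
  assumes "symmetric_map n E B"
  shows "symmetrize n E F B = B"
proof
  fix x show "symmetrize n E F B x = B x"
  proof (cases "x \<in> tuples_in n E")
    case True
    have "vsum F (\<lambda>\<sigma>. B (x \<circ> \<sigma>)) (perms n) = vsum F (\<lambda>\<sigma>. vscale F 1 (B x)) (perms n)"
      using assms True into[OF True]
      by (intro F.vsum_cong) (auto simp: symmetric_map_def F.scale_one)
    also have "\<dots> = vscale F (fact n) (B x)"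
      using into[OF True] by (simp add: F.vsum_scale_const finite_perms card_perms)
    finally show ?thesis
      using True into[OF True] by (simp add: symmetrize_eq F.scale_scale F.scale_one)
  next
    case False
    have "B \<in> extensional (tuples_in n E)"
      using multilinear_B by (auto simp: multilinear_def PiE_iff)
    then show ?thesis
      using False by (simp add: symmetrize_def extensional_def)
  qed
qed

lemma symmetrize_diagonal:
  assumes v: "v \<in> pts E"
  shows "symmetrize n E F B (\<lambda>i\<in>{..<n}. v) = B (\<lambda>i\<in>{..<n}. v)"
proof -
  have b: "B (\<lambda>i\<in>{..<n}. v) \<in> pts F"
    by (intro into const_tuple v)
  have "vsum F (\<lambda>\<sigma>. B ((\<lambda>i\<in>{..<n}. v) \<circ> \<sigma>)) (perms n)
      = vsum F (\<lambda>\<sigma>. vscale F 1 (B (\<lambda>i\<in>{..<n}. v))) (perms n)"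
    using b by (intro F.vsum_cong) (auto simp: const_perm F.scale_one)
  also have "\<dots> = vscale F (fact n) (B (\<lambda>i\<in>{..<n}. v))"
    using b by (simp add: F.vsum_scale_const finite_perms card_perms)
  finally show ?thesis
    using b by (simp only: symmetrize_eq const_tuple v) (simp add: F.scale_scale F.scale_one)
qed

text \<open>Expanding \<open>P\<close> at a signed sum gives a sum over all index maps
  \<open>f\<close>. Once the two sums are interchanged, \<open>sum_signs\<close> removes the
  non-injective \<open>f\<close> and gives weight \<open>2 ^ n\<close> to the others, which are the
  permutations.\<close>

theorem polarization:
  assumes P: "\<And>v. v \<in> pts E \<Longrightarrow> P v = B (\<lambda>i\<in>{..<n}. v)"
  shows "polarize n E F P = symmetrize n E F B"
proof -
  have "vscale F (1 / (2 ^ n * fact n))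
        (vsum F (\<lambda>e. vscale F (\<Prod>i<n. e i) (P (vsum E (\<lambda>i. vscale E (e i) (x i)) {..<n}))) (signs n))
      = vscale F (1 / fact n) (vsum F (\<lambda>\<sigma>. B (x \<circ> \<sigma>)) (perms n))"
    if x: "x \<in> tuples_in n E" for x
  proof -
    let ?Fs = "{..<n} \<rightarrow>\<^sub>E {..<n}"
    define b where "b f = B (\<lambda>i\<in>{..<n}. x (f i))" for f
    have xf: "(\<lambda>i\<in>{..<n}. x (f i)) \<in> tuples_in n E" if "f \<in> ?Fs" for f
      using x that by (auto simp: PiE_iff)
    have b: "b f \<in> pts F" if "f \<in> ?Fs" for f
      using that by (auto simp: b_def intro!: into xf)
    have finFs: "finite ?Fs"
      by (intro finite_PiE) auto
    have term_eq: "vscale F (\<Prod>i<n. e i) (P (vsum E (\<lambda>i. vscale E (e i) (x i)) {..<n}))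
        = vsum F (\<lambda>f. vscale F ((\<Prod>i<n. e i) * (\<Prod>i<n. e (f i))) (b f)) ?Fs" for e
    proof -
      have ex: "vscale E (e j) (x j) \<in> pts E" if "j \<in> {..<n}" for j
        using x that by (auto intro: E.scale_closed)
      have "P (vsum E (\<lambda>i. vscale E (e i) (x i)) {..<n})
          = B (\<lambda>i\<in>{..<n}. vsum E (\<lambda>j. vscale E (e j) (x j)) {..<n})"
        using ex by (intro P E.vsum_closed) auto
      also have "\<dots> = vsum F (\<lambda>f. B (\<lambda>i\<in>{..<n}. vscale E (e (f i)) (x (f i)))) ?Fs"
        using ex by (intro vsum_expand) auto
      also have "\<dots> = vsum F (\<lambda>f. vscale F (\<Prod>i<n. e (f i)) (b f)) ?Fs"
      proof (rule F.vsum_cong[OF refl])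
        fix f assume f: "f \<in> ?Fs"
        have "(\<lambda>i\<in>{..<n}. vscale E (e (f i)) (x (f i)))
            = (\<lambda>i\<in>{..<n}. vscale E (e (f i)) ((\<lambda>i\<in>{..<n}. x (f i)) i))"
          by auto
        then show "B (\<lambda>i\<in>{..<n}. vscale E (e (f i)) (x (f i))) = vscale F (\<Prod>i<n. e (f i)) (b f)"
          using scale_all[OF xf[OF f], of "\<lambda>i. e (f i)"] by (simp only: b_def)
      qed (auto intro!: F.closed b)
      finally have "vscale F (\<Prod>i<n. e i) (P (vsum E (\<lambda>i. vscale E (e i) (x i)) {..<n}))
          = vsum F (\<lambda>f. vscale F (\<Prod>i<n. e i) (vscale F (\<Prod>i<n. e (f i)) (b f))) ?Fs"
        by (subst F.vsum_scale) (auto intro!: F.closed b)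
      also have "\<dots> = vsum F (\<lambda>f. vscale F ((\<Prod>i<n. e i) * (\<Prod>i<n. e (f i))) (b f)) ?Fs"
        by (intro F.vsum_cong) (auto intro!: F.closed b simp: F.scale_scale b)
      finally show ?thesis .
    qed
    have "vsum F (\<lambda>e. vscale F (\<Prod>i<n. e i) (P (vsum E (\<lambda>i. vscale E (e i) (x i)) {..<n}))) (signs n)
        = vsum F (\<lambda>e. vsum F (\<lambda>f. vscale F ((\<Prod>i<n. e i) * (\<Prod>i<n. e (f i))) (b f)) ?Fs) (signs n)"
      by (simp only: term_eq)
    also have "\<dots> = vsum F (\<lambda>f. vsum F (\<lambda>e. vscale F ((\<Prod>i<n. e i) * (\<Prod>i<n. e (f i))) (b f)) (signs n)) ?Fs"
      by (intro F.vsum_swap finite_signs finFs F.closed b)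
    also have "\<dots> = vsum F (\<lambda>f. vscale F (if inj_on f {..<n} then 2 ^ n else 0) (b f)) ?Fs"
      by (intro F.vsum_cong) (auto simp: F.vsum_scale_const finite_signs b sum_signs intro!: F.closed b)
    also have "\<dots> = vsum F (\<lambda>f. vscale F (if inj_on f {..<n} then 2 ^ n else 0) (b f)) {f \<in> ?Fs. inj_on f {..<n}}"
      by (rule F.vsum_mono_neutral[symmetric]) (auto simp: finFs F.scale_zero_left b intro!: F.closed b)
    also have "\<dots> = vsum F (\<lambda>f. vscale F (2 ^ n) (b f)) {f \<in> ?Fs. inj_on f {..<n}}"
      by (intro F.vsum_cong) (auto intro!: F.closed b)
    also have "\<dots> = vscale F (2 ^ n) (vsum F b {f \<in> ?Fs. inj_on f {..<n}})"
      by (intro F.vsum_scale) (auto intro!: b)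
    \<comment> \<open>An injective self-map of a finite set is onto. A permutation is the identity
      off \<open>{..<n}\<close>, whereas \<open>f\<close> is \<open>undefined\<close> there, hence
      the restriction.\<close>
    also have "{f \<in> ?Fs. inj_on f {..<n}} = (\<lambda>\<sigma>. restrict \<sigma> {..<n}) ` perms n"
    proof (intro equalityI subsetI)
      fix f assume f: "f \<in> {f \<in> ?Fs. inj_on f {..<n}}"
      define \<sigma> where "\<sigma> = (\<lambda>i. if i < n then f i else i)"
      have "f ` {..<n} = {..<n}"
        using f by (intro endo_inj_surj) auto
      then have "bij_betw \<sigma> {..<n} {..<n}"
        using f by (auto simp: bij_betw_def \<sigma>_def inj_on_def)
      then have "\<sigma> permutes {..<n}"
        by (rule bij_imp_permutes) (simp add: \<sigma>_def)
      moreover have "f = restrict \<sigma> {..<n}"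
        using f by (auto simp: \<sigma>_def fun_eq_iff PiE_iff extensional_def)
      ultimately show "f \<in> (\<lambda>\<sigma>. restrict \<sigma> {..<n}) ` perms n"
        by blast
    next
      fix f assume "f \<in> (\<lambda>\<sigma>. restrict \<sigma> {..<n}) ` perms n"
      then obtain \<sigma> where "\<sigma> permutes {..<n}" "f = restrict \<sigma> {..<n}"
        by blast
      then show "f \<in> {f \<in> ?Fs. inj_on f {..<n}}"
        using permutes_in_image[of \<sigma> "{..<n}"] permutes_inj_on[of \<sigma> "{..<n}" "{..<n}"]
        by (auto simp: inj_on_def)
    qed
    also have "vsum F b ((\<lambda>\<sigma>. restrict \<sigma> {..<n}) ` perms n) = vsum F (\<lambda>\<sigma>. b (restrict \<sigma> {..<n})) (perms n)"
    proof (rule F.vsum_reindex)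
      show "b ` (\<lambda>\<sigma>. restrict \<sigma> {..<n}) ` perms n \<subseteq> pts F"
        using permutes_in_image by (fastforce intro!: b)
      show "inj_on (\<lambda>\<sigma>. restrict \<sigma> {..<n}) (perms n)"
      proof (intro inj_onI ext)
        fix \<sigma> \<tau> i assume *: "\<sigma> \<in> perms n" "\<tau> \<in> perms n" "restrict \<sigma> {..<n} = restrict \<tau> {..<n}"
        show "\<sigma> i = \<tau> i"
          using fun_cong[OF *(3), of i] *(1,2) by (cases "i < n") (auto simp: permutes_def)
      qed
    qed
    also have "\<dots> = vsum F (\<lambda>\<sigma>. B (x \<circ> \<sigma>)) (perms n)"
    proof (rule F.vsum_cong[OF refl])
      fix \<sigma> assume "\<sigma> \<in> perms n"
      then have "x \<circ> \<sigma> = (\<lambda>i\<in>{..<n}. x (restrict \<sigma> {..<n} i))"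
        using perm_tuple[of \<sigma> n x E] x by (auto simp: fun_eq_iff PiE_iff extensional_def)
      then show "b (restrict \<sigma> {..<n}) = B (x \<circ> \<sigma>)"
        by (simp only: b_def)
    qed (rule into_perm[OF x])
    finally show ?thesis
      by (simp add: F.scale_scale F.vsum_closed into_perm[OF x])
  qed
  then show ?thesis
    by (simp add: polarize_def symmetrize_def cong: restrict_cong)
qed

text \<open>A symmetric multilinear map equals its own symmetrization, which
  \<open>polarization\<close> computes from the diagonal \<open>P\<close> alone. This gives the
  uniqueness that \<open>THE\<close> requires.\<close>

lemma polar_eq_symmetrize:
  assumes "\<And>v. v \<in> pts E \<Longrightarrow> P v = B (\<lambda>i\<in>{..<n}. v)"
  shows "polar n E F P = symmetrize n E F B"
  unfolding polar_def
proof (rule the_equality)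
  show "multilinear n (\<lambda>_. E) F (symmetrize n E F B) \<and> symmetric_map n E (symmetrize n E F B) \<and>
      (\<forall>x\<in>pts E. symmetrize n E F B (\<lambda>i\<in>{..<n}. x) = P x)"
    by (simp add: multilinear_symmetrize symmetric_symmetrize symmetrize_diagonal assms del: restrict_apply)
  fix A assume A: "multilinear n (\<lambda>_. E) F A \<and> symmetric_map n E A \<and> (\<forall>x\<in>pts E. A (\<lambda>i\<in>{..<n}. x) = P x)"
  then interpret A: multilinear_power n E F A
    using normed_base normed_target by unfold_locales auto
  have "A = symmetrize n E F A"
    using A by (simp add: A.symmetrize_id)
  also have "\<dots> = polarize n E F P"
    using A by (intro A.polarization[symmetric]) simp
  also have "\<dots> = symmetrize n E F B"
    by (rule polarization[OF assms])
  finally show "A = symmetrize n E F B" .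
qed

end

section \<open>The polarization inequality and its consequences for continuity\<close>

context multilinear_power
begin

lemma homogeneous_diagonal:
  assumes "\<And>v. v \<in> pts E \<Longrightarrow> P v = B (\<lambda>i\<in>{..<n}. v)" and "1 \<le> n"
  shows "homogeneous_map n E F P"
proof
  fix v c assume v: "v \<in> pts E"
  show "P v \<in> pts F"
    using v by (simp add: assms into const_tuple del: restrict_apply)
  have "(\<lambda>i\<in>{..<n}. vscale E c v) = (\<lambda>i\<in>{..<n}. vscale E c ((\<lambda>i\<in>{..<n}. v) i))"
    by auto
  then show "P (vscale E c v) = vscale F (c ^ n) (P v)"
    using scale_all[OF const_tuple[OF v], of "\<lambda>_. c"] v
    by (simp only: assms(1) E.scale_closed) simp
qed (fact normed_base normed_target assms)+

text \<open>A signed sum of \<open>n\<close> vectors from the unit ball has norm at most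
  \<open>n\<close>, so the values of \<open>P\<close> there have norm at most
  \<open>n ^ n * C\<close>. Averaging over the \<open>2 ^ n\<close> sign vectors leaves the factor
  \<open>1 / fact n\<close>.\<close>

lemma norm_symmetrize_le:
  assumes P: "\<And>v. v \<in> pts E \<Longrightarrow> P v = B (\<lambda>i\<in>{..<n}. v)" and n: "1 \<le> n"
    and bound: "\<And>v. \<lbrakk>v \<in> pts E; vnorm E v \<le> 1\<rbrakk> \<Longrightarrow> vnorm F (P v) \<le> C" and C: "0 \<le> C"
    and x: "x \<in> tuples_in n E" "\<And>i. i < n \<Longrightarrow> vnorm E (x i) \<le> 1"
  shows "vnorm F (symmetrize n E F B x) \<le> real n ^ n / fact n * C"
proof -
  interpret P: homogeneous_map n E F P
    by (rule homogeneous_diagonal[OF P n])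
  let ?t = "\<lambda>e. vscale F (\<Prod>i<n. e i) (P (vsum E (\<lambda>i. vscale E (e i) (x i)) {..<n}))"
  have ex: "vsum E (\<lambda>i. vscale E (e i) (x i)) {..<n} \<in> pts E" for e
    using x by (intro E.vsum_closed) (auto intro: E.scale_closed)
  have t: "?t ` signs n \<subseteq> pts F"
    using ex by (auto intro!: F.closed P.into)
  have "vnorm F (?t e) \<le> C * real n ^ n" if e: "e \<in> signs n" for e
  proof -
    have "vnorm E (vsum E (\<lambda>i. vscale E (e i) (x i)) {..<n}) \<le> (\<Sum>i<n. vnorm E (vscale E (e i) (x i)))"
      using x by (intro E.norm_vsum) (auto intro: E.scale_closed)
    also have "\<dots> \<le> (\<Sum>i<n. 1)"
      using x norm_sign[OF e] by (intro sum_mono) (simp add: E.norm_scale tuple_mem[OF x(1)])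
    finally have "vnorm E (vsum E (\<lambda>i. vscale E (e i) (x i)) {..<n}) \<le> real n"
      by simp
    then have "C * vnorm E (vsum E (\<lambda>i. vscale E (e i) (x i)) {..<n}) ^ n \<le> C * real n ^ n"
      using C ex by (intro mult_left_mono power_mono) (auto intro: E.norm_nonneg)
    moreover have "vnorm F (?t e) = vnorm F (P (vsum E (\<lambda>i. vscale E (e i) (x i)) {..<n}))"
      by (simp add: F.norm_scale P.into ex norm_prod_signs[OF e])
    ultimately show ?thesis
      using P.unit_ball_bound[OF bound ex, of e] by simp
  qed
  then have "(\<Sum>e\<in>signs n. vnorm F (?t e)) \<le> (\<Sum>e\<in>(signs n :: (nat \<Rightarrow> 'k) set). C * real n ^ n)"
    by (intro sum_mono)
  then have "vnorm F (vsum F ?t (signs n)) \<le> 2 ^ n * (C * real n ^ n)"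
    using F.norm_vsum[OF t] by (simp add: card_signs)
  then have "1 / (2 ^ n * fact n) * vnorm F (vsum F ?t (signs n))
      \<le> 1 / (2 ^ n * fact n) * (2 ^ n * (C * real n ^ n))"
    by (intro mult_left_mono) auto
  also have "\<dots> = real n ^ n / fact n * C"
    by simp
  finally show ?thesis
    using x F.vsum_closed[OF t]
    by (simp add: polarization[OF P, symmetric] polarize_def F.norm_scale norm_divide norm_mult norm_power)
qed

text \<open>Only the diagonal of \<open>B\<close> is controlled, so \<open>B\<close> itself need not
  be bounded. Its symmetrization is bounded by polarization, hence continuous, and \<open>P\<close>
  is that map composed with the diagonal embedding.\<close>

lemma diagonal_in_polys:
  assumes P: "\<And>v. v \<in> pts E \<Longrightarrow> P v = B (\<lambda>i\<in>{..<n}. v)" and n: "1 \<le> n"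
    and ext: "P \<in> extensional (pts E)"
    and bound: "\<And>v. \<lbrakk>v \<in> pts E; vnorm E v \<le> 1\<rbrakk> \<Longrightarrow> vnorm F (P v) \<le> C"
  shows "P \<in> polys n E F"
proof -
  interpret P: homogeneous_map n E F P
    by (rule homogeneous_diagonal[OF P n])
  interpret S: multilinear_power n E F "symmetrize n E F B"
    using normed_base normed_target multilinear_symmetrize by unfold_locales
  have C: "0 \<le> C"
    using bound[of "vzero E"] by (simp add: E.zero_closed E.norm_zero P.zero F.norm_zero)
  have cont: "continuous_map (product_topology (\<lambda>i. vtop E) {..<n}) (vtop F) (symmetrize n E F B)"
    unfolding multicontinuous_def[of n "\<lambda>_. E" F, symmetric]
    by (rule S.bounded_multicontinuous, rule S.unit_ball_bound, rule norm_symmetrize_le[OF P n bound C])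
  have "continuous_map (vtop E) (product_topology (\<lambda>i. vtop E) {..<n}) (\<lambda>v. \<lambda>i\<in>{..<n}. v)"
    by (auto simp: continuous_map_componentwise)
  then have "continuous_map (vtop E) (vtop F) (symmetrize n E F B \<circ> (\<lambda>v. \<lambda>i\<in>{..<n}. v))"
    by (rule continuous_map_compose[OF _ cont])
  then have "continuous_map (vtop E) (vtop F) P"
    by (rule continuous_map_eq) (simp add: E.topspace_vtop symmetrize_diagonal P del: restrict_apply)
  then show ?thesis
    unfolding polys_def mem_Collect_eq PiE_iff using multilinear_B P P.into ext by blast
qed

end

text \<open>\<open>B\<close> is an arbitrary witness and need be neither symmetric nor continuous;
  \<open>C\<close> comes from the continuity of \<open>P\<close>.\<close>

lemma polysE:
  assumes "P \<in> polys n E F" "normed_nspace E" "normed_nspace F" "1 \<le> n"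
  obtains B C where "multilinear_power n E F B" "\<And>v. v \<in> pts E \<Longrightarrow> P v = B (\<lambda>i\<in>{..<n}. v)"
    "homogeneous_map n E F P" "\<And>v. \<lbrakk>v \<in> pts E; vnorm E v \<le> 1\<rbrakk> \<Longrightarrow> vnorm F (P v) \<le> C"
    "P \<in> extensional (pts E)"
proof -
  obtain B where B: "multilinear n (\<lambda>_. E) F B" "\<And>v. v \<in> pts E \<Longrightarrow> P v = B (\<lambda>i\<in>{..<n}. v)"
    and P: "P \<in> pts E \<rightarrow>\<^sub>E pts F" "continuous_map (vtop E) (vtop F) P"
    using assms(1) unfolding polys_def by blast
  interpret B: multilinear_power n E F B
    using assms(2,3) B(1) by (rule multilinear_power.intro)
  interpret P: homogeneous_map n E F P
    using B(2) assms(4) by (rule B.homogeneous_diagonal)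
  obtain C where C: "\<And>v. \<lbrakk>v \<in> pts E; vnorm E v \<le> 1\<rbrakk> \<Longrightarrow> vnorm F (P v) \<le> C"
    using P.continuous_bound[OF P(2)] by blast
  show ?thesis
    by (rule that[OF B.multilinear_power_axioms B(2) P.homogeneous_map_axioms C])
      (use P in \<open>auto simp: PiE_iff\<close>)
qed

section \<open>The closed graph theorem for multilinear maps\<close>

lemma (in normed_nspace) vsub_vsub_vsub:
  "\<lbrakk>x \<in> pts E; y \<in> pts E; z \<in> pts E; w \<in> pts E\<rbrakk> \<Longrightarrow>
    vsub E (vsub E x y) (vsub E z w) = vsub E (vsub E x z) (vsub E y w)"
  by (simp add: vsub_def scale_add_right scale_scale closed add_ac)

lemma (in normed_nspace) vsub_vsub_self:
  "\<lbrakk>x \<in> pts E; y \<in> pts E\<rbrakk> \<Longrightarrow> vsub E x (vsub E x y) = y"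
  using vsub_vsub_vsub[of x "vzero E" x y]
  by (simp add: vsub_zero vsub_self closed vsub_closed) (simp add: vsub_def closed scale_scale scale_one add_zero_left)

lemma (in normed_nspace) norm_vsub_geometric:
  assumes T: "\<And>s. T s \<in> pts E" and "\<And>s. vnorm E (vsub E (T s) (T (Suc s))) \<le> M / 2 ^ s"
  shows "vnorm E (vsub E (T s) (T (s + j))) \<le> 2 * M / 2 ^ s"
proof -
  have "0 \<le> M"
    using assms(2)[of 0] norm_nonneg[OF vsub_closed[OF T T], of 0 1] by simp
  \<comment> \<open>Subtracting the tail of the geometric series makes the induction close.\<close>
  have "vnorm E (vsub E (T s) (T (s + j))) \<le> 2 * M / 2 ^ s - 2 * M / 2 ^ (s + j)"
  proof (induction j)
    case 0
    then show ?case by (simp add: vsub_self T norm_zero)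
  next
    case (Suc j)
    have "vnorm E (vsub E (T s) (T (s + Suc j)))
        \<le> vnorm E (vsub E (T s) (T (s + j))) + vnorm E (vsub E (T (s + j)) (T (Suc (s + j))))"
      using norm_vsub_triangle[OF T T T] by simp
    also have "\<dots> \<le> (2 * M / 2 ^ s - 2 * M / 2 ^ (s + j)) + M / 2 ^ (s + j)"
      using Suc assms(2) by (intro add_mono)
    also have "\<dots> = 2 * M / 2 ^ s - 2 * M / 2 ^ (s + Suc j)"
      by (simp add: field_simps)
    finally show ?case .
  qed
  also have "\<dots> \<le> 2 * M / 2 ^ s"
    using \<open>0 \<le> M\<close> by simp
  finally show ?thesis .
qed

text \<open>The convergent series of Zabreiko's lemma is given by its remainders \<open>y\<close>, so that no partial
  sums occur.\<close>

lemma (in banach_nspace) zabreiko: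
  fixes p :: "'b \<Rightarrow> real"
  assumes add: "\<And>x y. \<lbrakk>x \<in> pts E; y \<in> pts E\<rbrakk> \<Longrightarrow> p (vadd E x y) \<le> p x + p y"
    and scale: "\<And>c x. x \<in> pts E \<Longrightarrow> p (vscale E c x) \<le> norm c * p x"
    and series: "\<And>y M. \<lbrakk>\<And>s. y s \<in> pts E; (\<lambda>s. vnorm E (y s)) \<longlonglongrightarrow> 0;
        \<And>s. p (vsub E (y s) (y (Suc s))) \<le> M / 2 ^ s\<rbrakk> \<Longrightarrow> p (y 0) \<le> 2 * M"
  obtains C where "0 \<le> C" "\<And>x. x \<in> pts E \<Longrightarrow> p x \<le> C * vnorm E x"
proof -
  interpret M: Metric_space "pts E" "vdist E" by (rule Metric_space_vdist)
  \<comment> \<open>Sublevel sets of \<open>p\<close>. No semicontinuity is available to make them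
    closed, so the Baire category theorem is applied to their closures.\<close>
  define A where "A m = {x \<in> pts E. p x \<le> real m}" for m
  have union: "(\<Union>m. M.mtopology closure_of (A m)) = pts E"
  proof (intro equalityI subsetI)
    fix x assume x: "x \<in> pts E"
    obtain m where "p x \<le> real m"
      using real_arch_simple by blast
    then have "x \<in> A m" using x by (simp add: A_def)
    moreover have "A m \<subseteq> M.mtopology closure_of (A m)"
      by (intro closure_of_subset) (auto simp: A_def)
    ultimately show "x \<in> (\<Union>m. M.mtopology closure_of (A m))"
      by blast
  qed (use closure_of_subset_topspace[of M.mtopology] in \<open>auto simp del: closure_of_subset_topspace\<close>)
  have "\<exists>m. M.mtopology interior_of (M.mtopology closure_of (A m)) \<noteq> {}"
  proof (rule ccontr)
    assume *: "\<not> (\<exists>m. M.mtopology interior_of (M.mtopology closure_of (A m)) \<noteq> {})"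
    have "M.mtopology interior_of (\<Union>(range (\<lambda>m. M.mtopology closure_of (A m)))) = {}"
      using * by (intro M.metric_Baire_category_alt[OF complete]) auto
    then show False
      using zero_closed interior_of_topspace[of M.mtopology] unfolding union by simp
  qed
  then obtain m where "M.mtopology interior_of (M.mtopology closure_of (A m)) \<noteq> {}"
    by blast
  then obtain x0 where "x0 \<in> M.mtopology interior_of (M.mtopology closure_of (A m))"
    by blast
  then obtain U where "openin M.mtopology U" "x0 \<in> U" "U \<subseteq> M.mtopology closure_of (A m)"
    by (auto simp: interior_of_def)
  then obtain r where r: "r > 0" "M.mball x0 r \<subseteq> M.mtopology closure_of (A m)" and x0: "x0 \<in> pts E"
    unfolding M.openin_mtopology by blast
  have near: "\<exists>a\<in>pts E. p a \<le> real m \<and> vnorm E (vsub E x a) < e"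
    if x: "x \<in> pts E" "vnorm E (vsub E x x0) < r" and e: "e > 0" for x e
  proof -
    have "x \<in> M.mball x0 r"
      unfolding in_mball_vdist using x x0 by blast
    then have "x \<in> M.mtopology closure_of (A m)"
      using r by blast
    then obtain a where "a \<in> A m" "a \<in> M.mball x e"
      using e unfolding M.metric_closure_of by blast
    then show ?thesis
      unfolding in_mball_vdist A_def using norm_vsub_commute by auto
  qed
  \<comment> \<open>The ball around \<open>x0\<close> is moved to the origin by writing
    \<open>y\<close> as the difference of \<open>x0 + y\<close> and \<open>x0\<close>. Both are
    approximated, so the bound on \<open>p\<close> doubles.\<close>
  have approx: "\<exists>a\<in>pts E. p a \<le> 2 * real m \<and> vnorm E (vsub E y a) < e"
    if y: "y \<in> pts E" "vnorm E y < r" and e: "e > 0" for y e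
  proof -
    have xy: "vadd E x0 y \<in> pts E" "vsub E (vadd E x0 y) x0 = y"
      using x0 y vsub_add_vadd[of x0 y x0 "vzero E"]
      by (simp_all add: closed add_zero vsub_self vsub_zero add_zero_left)
    obtain a where a: "a \<in> pts E" "p a \<le> real m" "vnorm E (vsub E (vadd E x0 y) a) < e / 2"
      using near[of "vadd E x0 y" "e / 2"] xy y e by auto
    obtain b where b: "b \<in> pts E" "p b \<le> real m" "vnorm E (vsub E x0 b) < e / 2"
      using near[of x0 "e / 2"] x0 e r by (auto simp: vsub_self norm_zero)
    have "p (vsub E a b) \<le> 2 * real m"
      using add[of a "vscale E (- 1) b"] scale[of b "- 1"] a b by (simp add: vsub_def closed)
    moreover have "vsub E y (vsub E a b) = vsub E (vsub E (vadd E x0 y) a) (vsub E x0 b)"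
      using vsub_vsub_vsub[of "vadd E x0 y" x0 a b] xy a b x0 by simp
    then have "vnorm E (vsub E y (vsub E a b)) < e"
      using norm_vsub_le[of "vsub E (vadd E x0 y) a" "vsub E x0 b"] a b x0 xy by (simp add: vsub_closed)
    ultimately show ?thesis
      using a b vsub_closed by blast
  qed
  \<comment> \<open>This is \<open>approx\<close> rescaled by \<open>2 ^ s\<close>: the bound on the
    remainder is halved, at a cost in \<open>p\<close> that decays geometrically.\<close>
  have step: "\<exists>a\<in>pts E. p a \<le> 2 * real m / 2 ^ s \<and> vnorm E (vsub E y a) < r / 2 ^ Suc s"
    if y: "y \<in> pts E" "vnorm E y < r / 2 ^ s" for y s
  proof -
    obtain a where a: "a \<in> pts E" "p a \<le> 2 * real m" "vnorm E (vsub E (vscale E (2 ^ s) y) a) < r / 2"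
      using approx[of "vscale E (2 ^ s) y" "r / 2"] y r
      by (auto simp: closed norm_scale norm_power field_simps)
    have "p (vscale E (1 / 2 ^ s) a) \<le> 1 / 2 ^ s * p a"
      using scale[of a "1 / 2 ^ s"] a by (simp add: norm_divide norm_power)
    also have "\<dots> \<le> 2 * real m / 2 ^ s"
      using a by (simp add: divide_right_mono)
    finally have "p (vscale E (1 / 2 ^ s) a) \<le> 2 * real m / 2 ^ s" .
    moreover have "vsub E y (vscale E (1 / 2 ^ s) a) = vscale E (1 / 2 ^ s) (vsub E (vscale E (2 ^ s) y) a)"
      using y a by (simp add: scale_vsub closed scale_scale scale_one)
    then have "vnorm E (vsub E y (vscale E (1 / 2 ^ s) a)) < r / 2 ^ Suc s"
      using a y by (simp add: norm_scale vsub_closed closed norm_divide norm_power divide_simps mult.commute)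
    ultimately show ?thesis
      using a scale_closed by blast
  qed
  have small: "p y \<le> 2 * (2 * real m)" if y: "y \<in> pts E" "vnorm E y < r" for y
  proof -
    \<comment> \<open>The clause for \<open>s = 0\<close> forces the chosen sequence of remainders
      to start at \<open>y\<close>.\<close>
    let ?P = "\<lambda>s x. x \<in> pts E \<and> vnorm E x < r / 2 ^ s \<and> (s = 0 \<longrightarrow> x = y)"
    let ?Q = "\<lambda>s x z. p (vsub E x z) \<le> 2 * real m / 2 ^ s"
    have "\<exists>f. \<forall>s. ?P s (f s) \<and> ?Q s (f s) (f (Suc s))"
    proof (rule dependent_nat_choice)
      show "\<exists>x. ?P 0 x" using y by auto
      fix x s assume "?P s x"
      then obtain a where "a \<in> pts E" "p a \<le> 2 * real m / 2 ^ s" "vnorm E (vsub E x a) < r / 2 ^ Suc s"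
        using step[of x s] by blast
      with \<open>?P s x\<close> show "\<exists>z. ?P (Suc s) z \<and> ?Q s x z"
        by (intro exI[of _ "vsub E x a"]) (simp add: vsub_closed vsub_vsub_self)
    qed
    then obtain f where f: "\<And>s. ?P s (f s)" "\<And>s. ?Q s (f s) (f (Suc s))"
      by blast
    have "(\<lambda>s. vnorm E (f s)) \<longlonglongrightarrow> 0"
    proof (rule null_seq_le)
      show "(\<lambda>s. r * (1 / 2) ^ s) \<longlonglongrightarrow> 0"
        by (intro tendsto_mult_right_zero LIMSEQ_power_zero) auto
      show "\<bar>vnorm E (f s)\<bar> \<le> r * (1 / 2) ^ s" for s
      proof -
        have "0 \<le> vnorm E (f s)" "vnorm E (f s) < r / 2 ^ s"
          using f(1)[of s] norm_nonneg by auto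
        then show ?thesis
          by (simp add: power_one_over)
      qed
    qed
    then have "p (f 0) \<le> 2 * (2 * real m)"
      using f by (intro series) auto
    then show ?thesis
      using f(1)[of 0] by simp
  qed
  show ?thesis
  proof (rule that[of "8 * real m / r"])
    show "0 \<le> 8 * real m / r" using r by simp
    fix x assume x: "x \<in> pts E"
    show "p x \<le> 8 * real m / r * vnorm E x"
    proof (cases "x = vzero E")
      case True
      then show ?thesis
        using scale[OF zero_closed, of 0] by (simp add: scale_zero_right norm_zero)
    next
      case False
      then have pos: "0 < vnorm E x"
        using norm_nonneg[OF x] norm_eq_0_iff[OF x] by linarith
      \<comment> \<open>Scaling by \<open>c\<close> gives norm \<open>r / 2\<close>, where
        \<open>small\<close> bounds \<open>p\<close> by \<open>4 * real m\<close>. Dividing by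
        \<open>c\<close> produces the constant \<open>8 * real m / r\<close>.\<close>
      define c where "c = r / (2 * vnorm E x)"
      have c: "c > 0" using r pos by (simp add: c_def)
      have "p (vscale E (of_real c) x) \<le> 2 * (2 * real m)"
      proof (rule small)
        have "c * vnorm E x < r"
          using r pos by (simp add: c_def)
        then show "vnorm E (vscale E (of_real c) x) < r"
          using x c by (simp add: norm_scale)
      qed (simp add: closed x)
      moreover have "p x \<le> 1 / c * p (vscale E (of_real c) x)"
        using scale[of "vscale E (of_real c) x" "of_real (1 / c)"] x c
        by (simp add: closed scale_scale scale_one norm_divide flip: of_real_mult)
      ultimately have "p x \<le> 1 / c * (2 * (2 * real m))"
        using c by (meson divide_nonneg_pos dual_order.trans mult_left_mono zero_le_one)
      then show ?thesis
        using r pos by (simp add: c_def field_simps)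
    qed
  qed
qed

text \<open>Zabreiko's lemma is applied to one coordinate at a time, with \<open>p v\<close> the supremum over the
  unit ball in the coordinates already dealt with; this replaces the closed graph theorem in each
  coordinate and the uniform boundedness principle.\<close>

lemma (in multilinear_map) closed_graph:
  assumes banach_dom: "\<And>i. i < n \<Longrightarrow> banach_nspace (E i)" and banach_cod: "banach_nspace F"
    and closed_graph: "\<And>i x y w. \<lbrakk>i < n; x \<in> tuples n E; \<And>s. y s \<in> pts (E i);
        (\<lambda>s. vnorm (E i) (y s)) \<longlonglongrightarrow> 0; w \<in> pts F; vlim F (\<lambda>s. A (x(i := y s))) w\<rbrakk> \<Longrightarrow> w = vzero F"
  obtains C where "\<And>x. \<lbrakk>x \<in> tuples n E; \<And>i. i < n \<Longrightarrow> vnorm (E i) (x i) \<le> 1\<rbrakk> \<Longrightarrow> vnorm F (A x) \<le> C"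
proof -
  \<comment> \<open>The first \<open>k\<close> coordinates range over unit balls, the others are
    frozen at those of \<open>x\<close>. The constant may depend on \<open>x\<close>; at
    \<open>k = n\<close> nothing is frozen any more.\<close>
  have "k \<le> n \<Longrightarrow> x \<in> tuples n E \<Longrightarrow> \<exists>C. \<forall>z\<in>tuples n E. (\<forall>i<n. k \<le> i \<longrightarrow> z i = x i) \<longrightarrow>
      (\<forall>i<k. vnorm (E i) (z i) \<le> 1) \<longrightarrow> vnorm F (A z) \<le> C" for k x
  proof (induction k arbitrary: x)
    case 0
    have "z = x" if "z \<in> tuples n E" "\<forall>i<n. z i = x i" for z
      using that 0 by (intro PiE_ext) auto
    then show ?case
      by (intro exI[of _ "vnorm F (A x)"]) auto
  next
    case (Suc k)
    then have k: "k < n" by simp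
    interpret Ek: banach_nspace "E k" using banach_dom[OF k] .
    interpret FB: banach_nspace F by (rule banach_cod)
    define Z where "Z = {z \<in> tuples n E. (\<forall>i<n. k < i \<longrightarrow> z i = x i) \<and> (\<forall>i<k. vnorm (E i) (z i) \<le> 1)}"
    define p where "p v = Sup ((\<lambda>z. vnorm F (A (z(k := v)))) ` Z)" for v
    have Zk: "z(k := v) \<in> tuples n E" if "z \<in> Z" "v \<in> pts (E k)" for z v
      using that k by (intro upd_tuple) (auto simp: Z_def)
    have Az: "A (z(k := v)) \<in> pts F" if "z \<in> Z" "v \<in> pts (E k)" for z v
      by (intro into Zk that)
    have "(\<lambda>i\<in>{..<n}. if i \<le> k then vzero (E i) else x i) \<in> Z"
      using Suc.prems normed_E
      by (auto simp: Z_def PiE_iff normed_nspace.zero_closed normed_nspace.norm_zero)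
    then have Z: "Z \<noteq> {}" by blast
    \<comment> \<open>The induction hypothesis makes \<open>p v\<close> a finite supremum for each
      single \<open>v\<close>; the uniformity in \<open>v\<close> is what Zabreiko's lemma
      adds.\<close>
    have bdd: "bdd_above ((\<lambda>z. vnorm F (A (z(k := v)))) ` Z)" if v: "v \<in> pts (E k)" for v
    proof -
      have xv: "x(k := v) \<in> tuples n E"
        using Suc.prems v k by (intro upd_tuple) auto
      have "\<exists>C. \<forall>z\<in>tuples n E. (\<forall>i<n. k \<le> i \<longrightarrow> z i = (x(k := v)) i) \<longrightarrow>
          (\<forall>i<k. vnorm (E i) (z i) \<le> 1) \<longrightarrow> vnorm F (A z) \<le> C"
        by (rule Suc.IH[OF _ xv]) (use k in simp)
      then obtain C where C: "\<forall>z\<in>tuples n E. (\<forall>i<n. k \<le> i \<longrightarrow> z i = (x(k := v)) i) \<longrightarrow>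
          (\<forall>i<k. vnorm (E i) (z i) \<le> 1) \<longrightarrow> vnorm F (A z) \<le> C" ..
      show ?thesis
      proof (rule bdd_aboveI2)
        fix z assume z: "z \<in> Z"
        have "\<forall>i<n. k \<le> i \<longrightarrow> (z(k := v)) i = (x(k := v)) i" "\<forall>i<k. vnorm (E i) ((z(k := v)) i) \<le> 1"
          using z by (auto simp: Z_def)
        with C Zk[OF z v] show "vnorm F (A (z(k := v))) \<le> C"
          by blast
      qed
    qed
    have p_ge: "vnorm F (A (z(k := v))) \<le> p v" if "z \<in> Z" "v \<in> pts (E k)" for z v
      unfolding p_def using that bdd by (intro cSup_upper) auto
    have p_le: "p v \<le> c" if "\<And>z. z \<in> Z \<Longrightarrow> vnorm F (A (z(k := v))) \<le> c" for v c
      unfolding p_def using Z that by (intro cSup_least) auto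
    have Zt: "z \<in> tuples n E" if "z \<in> Z" for z
      using that by (simp add: Z_def)
    obtain C where C: "0 \<le> C" "\<And>v. v \<in> pts (E k) \<Longrightarrow> p v \<le> C * vnorm (E k) v"
    proof (rule Ek.zabreiko[of p])
      fix v w assume v: "v \<in> pts (E k)" and w: "w \<in> pts (E k)"
      show "p (vadd (E k) v w) \<le> p v + p w"
      proof (rule p_le)
        fix z assume z: "z \<in> Z"
        have "A (z(k := vadd (E k) v w)) = vadd F (A (z(k := v))) (A (z(k := w)))"
          by (intro add_coord k Zt z v w)
        then have "vnorm F (A (z(k := vadd (E k) v w))) \<le> vnorm F (A (z(k := v))) + vnorm F (A (z(k := w)))"
          by (simp only: F.norm_triangle Az[OF z v] Az[OF z w])
        also have "\<dots> \<le> p v + p w"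
          by (intro add_mono p_ge z v w)
        finally show "vnorm F (A (z(k := vadd (E k) v w))) \<le> p v + p w" .
      qed
    next
      fix c v assume v: "v \<in> pts (E k)"
      show "p (vscale (E k) c v) \<le> norm c * p v"
      proof (rule p_le)
        fix z assume z: "z \<in> Z"
        have "A (z(k := vscale (E k) c v)) = vscale F c (A (z(k := v)))"
          by (intro scale_coord k Zt z v)
        then show "vnorm F (A (z(k := vscale (E k) c v))) \<le> norm c * p v"
          using F.norm_scale[OF Az[OF z v]] p_ge[OF z v] by (simp add: mult_left_mono)
      qed
    next
      fix y M assume y: "\<And>s. y s \<in> pts (E k)" and lim: "(\<lambda>s. vnorm (E k) (y s)) \<longlonglongrightarrow> 0"
        and py: "\<And>s. p (vsub (E k) (y s) (y (Suc s))) \<le> M / 2 ^ s"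
      show "p (y 0) \<le> 2 * M"
      proof (rule p_le)
        fix z assume z: "z \<in> Z"
        \<comment> \<open>The differences of successive terms are values of \<open>A\<close> at
          differences of successive remainders, so \<open>T\<close> is Cauchy at a geometric
          rate.\<close>
        define T where "T s = A (z(k := y s))" for s
        have T: "T s \<in> pts F" for s
          unfolding T_def by (intro Az z y)
        have "vnorm F (vsub F (T s) (T (Suc s))) \<le> M / 2 ^ s" for s
        proof -
          have "vsub F (T s) (T (Suc s)) = A (z(k := vsub (E k) (y s) (y (Suc s))))"
            unfolding T_def by (intro vsub_coord[symmetric] k Zt z y)
          then show ?thesis
            using p_ge[OF z Ek.vsub_closed[OF y y], of s "Suc s"] py[of s] by simp
        qed
        note geo = F.norm_vsub_geometric[OF T this]
        have "0 \<le> M"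
          using geo[of 0 0] by (simp add: F.vsub_self T F.norm_zero)
        obtain w where w: "w \<in> pts F" "vlim F T w"
        proof (rule FB.Cauchy_vlim[of T])
          fix e :: real assume e: "0 < e"
          have "(\<lambda>s. 4 * M * (1 / 2) ^ s) \<longlonglongrightarrow> 0"
            by (intro tendsto_mult_right_zero LIMSEQ_power_zero) auto
          then have "\<exists>N. \<forall>s\<ge>N. norm (4 * M * (1 / 2) ^ s - 0) < e"
            using e by (rule LIMSEQ_D)
          then obtain N where "norm (4 * M * (1 / 2) ^ N - 0) < e"
            by blast
          then have N: "4 * M * (1 / 2) ^ N < e"
            using \<open>0 \<le> M\<close> by simp
          have "vnorm F (vsub F (T a) (T b)) < e" if "a \<ge> N" "b \<ge> N" for a b
          proof -
            have "vnorm F (vsub F (T N) (T a)) \<le> 2 * M / 2 ^ N" "vnorm F (vsub F (T N) (T b)) \<le> 2 * M / 2 ^ N"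
              using geo[of N "a - N"] geo[of N "b - N"] that by simp_all
            then have "vnorm F (vsub F (T a) (T b)) \<le> 2 * M / 2 ^ N + 2 * M / 2 ^ N"
              using F.norm_vsub_triangle[OF T T T, of a b N] F.norm_vsub_commute[OF T T, of a N] by linarith
            also have "\<dots> = 4 * M * (1 / 2) ^ N"
              by (simp add: power_one_over)
            finally show ?thesis using N by simp
          qed
          then show "\<exists>N. \<forall>a\<ge>N. \<forall>b\<ge>N. vnorm F (vsub F (T a) (T b)) < e"
            by blast
        qed (rule T)
        \<comment> \<open>The remainders tend to zero, so the closed graph hypothesis in coordinate
          \<open>k\<close> identifies the limit. The geometric estimate starting at
          \<open>T 0\<close> then gives the bound \<open>2 * M\<close>.\<close>
        have "w = vzero F"
          using w(2) unfolding T_def by (intro closed_graph[OF k Zt[OF z] y lim w(1)])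
        then have "(\<lambda>s. 2 * M + vnorm F (T s)) \<longlonglongrightarrow> 2 * M + 0"
          using F.norm_vlim[OF w(2) T w(1)] by (intro tendsto_add) (simp_all add: F.norm_zero)
        moreover have "vnorm F (T 0) \<le> 2 * M + vnorm F (T s)" for s
          using geo[of 0 s] F.norm_le_vsub[OF T T, of 0 s] by simp
        ultimately have "vnorm F (T 0) \<le> 2 * M"
          using LIMSEQ_le_const[of "\<lambda>s. 2 * M + vnorm F (T s)" "2 * M + 0" "vnorm F (T 0)"] by simp
        then show "vnorm F (A (z(k := y 0))) \<le> 2 * M"
          by (simp add: T_def)
      qed
    qed (rule that)
    show ?case
    proof (intro exI ballI impI)
      fix z assume z: "z \<in> tuples n E" "\<forall>i<n. Suc k \<le> i \<longrightarrow> z i = x i" "\<forall>i<Suc k. vnorm (E i) (z i) \<le> 1"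
      have zk: "z k \<in> pts (E k)"
        by (rule tuple_mem[OF z(1) k])
      have "z \<in> Z"
        using z by (auto simp: Z_def)
      then have "vnorm F (A z) \<le> p (z k)"
        using p_ge[of z "z k"] zk by simp
      also have "\<dots> \<le> C * vnorm (E k) (z k)"
        by (rule C(2)[OF zk])
      also have "\<dots> \<le> C"
        using C(1) z(3) by (intro mult_left_le) auto
      finally show "vnorm F (A z) \<le> C" .
    qed
  qed
  from this[of n "\<lambda>i\<in>{..<n}. vzero (E i)"] that show ?thesis
    using normed_E by (force simp: normed_nspace.zero_closed)
qed

section \<open>Spaces of sequences\<close>

text \<open>The embedding into \<open>linf E\<close> does two things: it makes the operations of
  \<open>V\<close> coordinatewise, and it makes every coordinate a contraction from \<open>V\<close>
  to \<open>E\<close>. The values of both sequence classes are instances.\<close>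

locale seq_space =
  fixes E :: "('k::real_normed_field, 'a) nspace" and V :: "('k, nat \<Rightarrow> 'a) nspace"
  assumes banach_base: "banach_nspace E"
    and banach_seq: "banach_nspace V"
    and embeds_linf: "embeds V (linf E)"
begin

sublocale E: banach_nspace E by (rule banach_base)
sublocale V: banach_nspace V by (rule banach_seq)

lemma coord: "x \<in> pts V \<Longrightarrow> x j \<in> pts E"
  using embeds_linf by (auto simp: embeds_def linf_def)

lemma vzero_eq: "vzero V = (\<lambda>j. vzero E)"
  using embeds_linf by (auto simp: embeds_def linf_def)

lemma vadd_eq: "\<lbrakk>x \<in> pts V; y \<in> pts V\<rbrakk> \<Longrightarrow> vadd V x y = (\<lambda>j. vadd E (x j) (y j))"
  using embeds_linf by (auto simp: embeds_def linf_def)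

lemma vscale_eq: "x \<in> pts V \<Longrightarrow> vscale V c x = (\<lambda>j. vscale E c (x j))"
  using embeds_linf by (auto simp: embeds_def linf_def)

lemma norm_coord_le:
  assumes "x \<in> pts V"
  shows "vnorm E (x j) \<le> vnorm V x"
proof -
  have "bdd_above (range (\<lambda>j. vnorm E (x j)))" "(SUP j. vnorm E (x j)) \<le> vnorm V x"
    using embeds_linf assms by (auto simp: embeds_def linf_def)
  then show ?thesis
    using cSUP_upper[of j UNIV "\<lambda>j. vnorm E (x j)"] by simp
qed

lemma vsub_eq: "\<lbrakk>x \<in> pts V; y \<in> pts V\<rbrakk> \<Longrightarrow> vsub V x y = (\<lambda>j. vsub E (x j) (y j))"
  by (simp add: vsub_def vadd_eq V.scale_closed, simp add: vscale_eq)

lemma vsum_eq: "\<lbrakk>finite A; f ` A \<subseteq> pts V\<rbrakk> \<Longrightarrow> vsum V f A = (\<lambda>j. vsum E (\<lambda>a. f a j) A)"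
proof (induction A rule: finite_induct)
  case empty
  then show ?case
    by (simp add: V.vsum_empty E.vsum_empty vzero_eq)
next
  case (insert a A)
  have "(\<lambda>a. f a j) ` insert a A \<subseteq> pts E" for j
    using insert.prems coord by (auto simp: image_subset_iff)
  then show ?case
    using insert V.vsum_closed[of f A] by (simp add: V.vsum_insert E.vsum_insert vadd_eq)
qed

text \<open>Coordinates are contractions. Together with uniqueness of limits in \<open>E\<close>,
  this determines a limit in \<open>V\<close> coordinate by coordinate, which serves to close graphs
  and to identify limits.\<close>

lemma vlim_coord:
  assumes "vlim V s l" "\<And>k. s k \<in> pts V" "l \<in> pts V"
  shows "vlim E (\<lambda>k. s k j) (l j)"
  unfolding vlim_def
proof (rule null_seq_le)
  show "(\<lambda>k. vnorm V (vsub V (s k) l)) \<longlonglongrightarrow> 0"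
    using assms(1) by (simp add: vlim_def)
  show "\<bar>vnorm E (vsub E (s k j) (l j))\<bar> \<le> vnorm V (vsub V (s k) l)" for k
    using norm_coord_le[OF V.vsub_closed[OF assms(2,3)], of k j]
    by (simp add: vsub_eq assms E.norm_nonneg E.vsub_closed coord)
qed

end

lemma induced_upd:
  "i < n \<Longrightarrow> induced n A (x(i := y)) j = A ((\<lambda>m\<in>{..<n}. x m j)(i := y j))"
  by (simp add: induced_def) (rule arg_cong[where f = A], auto)

lemma induced_eq: "induced n A x j = A (\<lambda>m\<in>{..<n}. x m j)"
  by (simp add: induced_def)

text \<open>Only membership of the induced sequences in \<open>W\<close> is assumed; their
  boundedness is derived in \<open>induced_bound\<close>.\<close>

locale induced_map = multilinear_map n E F A
  for n and E :: "nat \<Rightarrow> ('k::real_normed_field, 'a) nspace" and F :: "('k, 'b) nspace" and A +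
  fixes V :: "nat \<Rightarrow> ('k, nat \<Rightarrow> 'a) nspace" and W :: "('k, nat \<Rightarrow> 'b) nspace"
  assumes seq_dom: "i < n \<Longrightarrow> seq_space (E i) (V i)"
    and seq_cod: "seq_space F W"
    and induced_into: "x \<in> tuples n V \<Longrightarrow> induced n A x \<in> pts W"
begin

sublocale W: seq_space F W by (rule seq_cod)

lemma slice: "x \<in> tuples n V \<Longrightarrow> (\<lambda>m\<in>{..<n}. x m j) \<in> tuples n E"
  by (auto intro: seq_space.coord[OF seq_dom])

lemma homog_induced: "homog_map n V W (induced n A)"
proof (rule homog_map.intro)
  show "normed_nspace W" ..
  fix i assume i: "i < n"
  interpret Vi: seq_space "E i" "V i" by (rule seq_dom[OF i])
  show "normed_nspace (V i)" ..
  fix x y c assume x: "x \<in> tuples n V" and y: "y \<in> pts (V i)"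
  have "induced n A (x(i := y)) \<in> pts W"
    by (intro induced_into upd_tuple x y i)
  moreover have "induced n A (x(i := vscale (V i) c y)) j = vscale F c (induced n A (x(i := y)) j)" for j
    unfolding induced_upd[OF i] Vi.vscale_eq[OF y] by (intro scale_coord i slice x Vi.coord y)
  ultimately show "induced n A (x(i := vscale (V i) c y)) = vscale W c (induced n A (x(i := y)))"
    by (auto simp: W.vscale_eq)
qed (rule induced_into)

text \<open>\<open>induced n A\<close> is not \<open>undefined\<close> off the tuples, whereas
  \<open>multilinear\<close> demands extensionality, hence the restriction.\<close>

lemma multilinear_induced: "multilinear_map n V W (restrict (induced n A) (tuples n V))"
proof (rule multilinear_map.intro)
  interpret H: homog_map n V W "induced n A" by (rule homog_induced)
  show "normed_nspace W" ..
  show "normed_nspace (V i)" if "i < n" for i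
    by (rule H.normed_E[OF that])
  have "induced n A (x(i := vadd (V i) y z)) = vadd W (induced n A (x(i := y))) (induced n A (x(i := z)))"
    if i: "i < n" and x: "x \<in> tuples n V" and y: "y \<in> pts (V i)" and z: "z \<in> pts (V i)" for i x y z
  proof -
    interpret Vi: seq_space "E i" "V i" by (rule seq_dom[OF i])
    have "induced n A (x(i := y)) \<in> pts W" "induced n A (x(i := z)) \<in> pts W"
      by (intro induced_into upd_tuple x y z i)+
    moreover have "induced n A (x(i := vadd (V i) y z)) j
        = vadd F (induced n A (x(i := y)) j) (induced n A (x(i := z)) j)" for j
      unfolding induced_upd[OF i] Vi.vadd_eq[OF y z] by (intro add_coord i slice x Vi.coord y z)
    ultimately show ?thesis
      by (auto simp: W.vadd_eq)
  qed
  moreover have "vadd (V i) y z \<in> pts (V i)" "vscale (V i) c y \<in> pts (V i)"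
    if "i < n" "y \<in> pts (V i)" "z \<in> pts (V i)" for i c y z
    using H.normed_E[OF that(1)] that by (simp_all add: normed_nspace.add_closed normed_nspace.scale_closed)
  ultimately show "multilinear n V W (restrict (induced n A) (tuples n V))"
    unfolding multilinear_def using H.into
    by (simp add: upd_tuple H.scale_coord del: fun_upd_apply)
qed

text \<open>Let one sequence argument tend to zero and the induced values tend to \<open>w\<close>.
  In each coordinate the boundedness of \<open>A\<close> forces the limit zero, so \<open>w\<close>
  is zero and the closed graph theorem applies.\<close>

lemma induced_bound:
  assumes bound: "\<And>x. \<lbrakk>x \<in> tuples n E; \<And>i. i < n \<Longrightarrow> vnorm (E i) (x i) \<le> 1\<rbrakk> \<Longrightarrow> vnorm F (A x) \<le> C"
  obtains K where
    "\<And>x. \<lbrakk>x \<in> tuples n V; \<And>i. i < n \<Longrightarrow> vnorm (V i) (x i) \<le> 1\<rbrakk> \<Longrightarrow> vnorm W (induced n A x) \<le> K"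
proof -
  interpret M: multilinear_map n V W "restrict (induced n A) (tuples n V)"
    by (rule multilinear_induced)
  obtain K where K: "\<And>x. \<lbrakk>x \<in> tuples n V; \<And>i. i < n \<Longrightarrow> vnorm (V i) (x i) \<le> 1\<rbrakk>
      \<Longrightarrow> vnorm W (restrict (induced n A) (tuples n V) x) \<le> K"
  proof (rule M.closed_graph)
    show "banach_nspace W" ..
    show "banach_nspace (V i)" if "i < n" for i
      using seq_dom[OF that] by (simp add: seq_space.banach_seq)
    fix i x y w
    assume i: "i < n" and x: "x \<in> tuples n V" and y: "\<And>s. y s \<in> pts (V i)"
      and lim: "(\<lambda>s. vnorm (V i) (y s)) \<longlonglongrightarrow> 0" and w: "w \<in> pts W"
      and "vlim W (\<lambda>s. restrict (induced n A) (tuples n V) (x(i := y s))) w"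
    moreover have xy: "x(i := y s) \<in> tuples n V" for s
      by (intro upd_tuple x y i)
    ultimately have lim_w: "vlim W (\<lambda>s. induced n A (x(i := y s))) w"
      by simp
    interpret Vi: seq_space "E i" "V i" by (rule seq_dom[OF i])
    have "w j = vzero F" for j
    proof (rule F.vlim_unique)
      show "vlim F (\<lambda>s. induced n A (x(i := y s)) j) (w j)"
        by (intro W.vlim_coord lim_w induced_into xy w)
      define a where "a = (\<lambda>m\<in>{..<n}. x m j)"
      have a: "a \<in> tuples n E"
        unfolding a_def by (rule slice[OF x])
      define c where "c = C * (\<Prod>m\<in>{..<n} - {i}. vnorm (E m) (a m))"
      have bd: "vnorm F (A (a(i := y s j))) \<le> \<bar>c\<bar> * vnorm (V i) (y s)" for s
      proof -
        have "vnorm F (A (a(i := y s j))) \<le> C * (\<Prod>m<n. vnorm (E m) ((a(i := y s j)) m))"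
          by (rule unit_ball_bound[OF bound]) (simp_all only: upd_tuple[of a n E] a Vi.coord y i)
        also have "(\<Prod>m<n. vnorm (E m) ((a(i := y s j)) m))
            = vnorm (E i) (y s j) * (\<Prod>m\<in>{..<n} - {i}. vnorm (E m) (a m))"
          using i by (subst prod.remove[of _ i]) auto
        also have "C * \<dots> = c * vnorm (E i) (y s j)"
          by (simp add: c_def)
        also have "\<dots> \<le> \<bar>c\<bar> * vnorm (V i) (y s)"
          by (intro mult_mono Vi.norm_coord_le y) (auto intro: Vi.E.norm_nonneg Vi.coord y)
        finally show ?thesis .
      qed
      have A_into: "A (a(i := y s j)) \<in> pts F" for s
        by (intro into upd_tuple a Vi.coord y i)
      show "vlim F (\<lambda>s. induced n A (x(i := y s)) j) (vzero F)"
        unfolding vlim_def induced_upd[OF i] a_def[symmetric]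
      proof (rule null_seq_le)
        show "(\<lambda>s. \<bar>c\<bar> * vnorm (V i) (y s)) \<longlonglongrightarrow> 0"
          using lim by (rule tendsto_mult_right_zero)
        show "\<bar>vnorm F (vsub F (A (a(i := y s j))) (vzero F))\<bar> \<le> \<bar>c\<bar> * vnorm (V i) (y s)" for s
          using bd[of s] by (simp add: F.vsub_zero[OF A_into] F.norm_nonneg[OF A_into] del: fun_upd_apply)
      qed
    qed (auto intro!: W.coord induced_into xy w F.zero_closed)
    then show "w = vzero W"
      by (auto simp: W.vzero_eq)
  next
    fix K
    assume "\<And>x. \<lbrakk>x \<in> tuples n V; \<And>i. i < n \<Longrightarrow> vnorm (V i) (x i) \<le> 1\<rbrakk>
      \<Longrightarrow> vnorm W (restrict (induced n A) (tuples n V) x) \<le> K"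
    then show thesis
      by (rule that)
  qed
  show ?thesis
    using K by (intro that[of K]) simp
qed

end

section \<open>Sequence classes\<close>

lemma banach_scalars: "banach_nspace (scalars :: ('k::{real_normed_field, banach}, 'k + 'u) nspace)"
proof -
  let ?K = "scalars :: ('k, 'k + 'u) nspace"
  interpret K: normed_nspace ?K
  proof
    show "\<exists>y\<in>pts ?K. vadd ?K x y = vzero ?K" if "x \<in> pts ?K" for x
      using that by (intro bexI[of _ "Inl (- projl x)"]) (auto simp: scalars_def)
  qed (auto simp: scalars_def algebra_simps norm_mult norm_triangle_ineq)
  have diff: "vnorm ?K (vsub ?K x y) = norm (projl x - projl y)" for x y
    by (simp add: vsub_def scalars_def)
  show ?thesis
  proof (rule K.banach_nspaceI)
    fix s :: "nat \<Rightarrow> 'k + 'u"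
    assume s: "\<And>k. s k \<in> pts ?K"
      and cauchy: "\<And>e. 0 < e \<Longrightarrow> \<exists>N. \<forall>k\<ge>N. \<forall>l\<ge>N. vnorm ?K (vsub ?K (s k) (s l)) < e"
    have "Cauchy (\<lambda>k. projl (s k))"
      unfolding Cauchy_def dist_norm using cauchy by (simp add: diff)
    then obtain l where "(\<lambda>k. projl (s k)) \<longlonglongrightarrow> l"
      using Cauchy_convergent convergent_def by blast
    then have "(\<lambda>k. norm (projl (s k) - l)) \<longlonglongrightarrow> 0"
      using LIM_zero tendsto_norm_zero by blast
    then show "\<exists>l\<in>pts ?K. vlim ?K s l"
      by (intro bexI[of _ "Inl l"]) (simp_all add: vlim_def diff, simp add: scalars_def)
  qed
qed

text \<open>With one-element tuples as arguments, the results on multilinear maps and polynomials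
  cover linear operators.\<close>

lemma linear_multilinear_power:
  assumes E: "normed_nspace E" and F: "normed_nspace F"
    and u: "\<And>x. x \<in> pts E \<Longrightarrow> u x \<in> pts F"
      "\<And>x y. \<lbrakk>x \<in> pts E; y \<in> pts E\<rbrakk> \<Longrightarrow> u (vadd E x y) = vadd F (u x) (u y)"
      "\<And>c x. x \<in> pts E \<Longrightarrow> u (vscale E c x) = vscale F c (u x)"
  shows "multilinear_power 1 E F (\<lambda>z\<in>tuples_in 1 E. u (z 0))"
proof -
  interpret E: normed_nspace E by (rule E)
  have "z(0 := y) \<in> tuples_in 1 E" if "z \<in> tuples_in 1 E" "y \<in> pts E" for z y
    using that by (intro upd_tuple) auto
  moreover have "z 0 \<in> pts E" if "z \<in> tuples_in 1 E" for z
    using that by auto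
  ultimately show ?thesis
    using assms unfolding multilinear_power_def multilinear_def by (auto simp: E.closed)
qed

text \<open>Continuity is the case of degree one of \<open>diagonal_in_polys\<close>.\<close>

lemma linopsI:
  assumes E: "normed_nspace E" and F: "normed_nspace F"
    and u: "\<And>x. x \<in> pts E \<Longrightarrow> u x \<in> pts F"
      "\<And>x y. \<lbrakk>x \<in> pts E; y \<in> pts E\<rbrakk> \<Longrightarrow> u (vadd E x y) = vadd F (u x) (u y)"
      "\<And>c x. x \<in> pts E \<Longrightarrow> u (vscale E c x) = vscale F c (u x)"
    and ext: "u \<in> extensional (pts E)"
    and bound: "\<And>x. \<lbrakk>x \<in> pts E; vnorm E x \<le> 1\<rbrakk> \<Longrightarrow> vnorm F (u x) \<le> C"
  shows "u \<in> linops E F"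
proof -
  interpret M: multilinear_power 1 E F "\<lambda>z\<in>tuples_in 1 E. u (z 0)"
    by (rule linear_multilinear_power[OF E F u])
  have "u \<in> polys 1 E F"
    by (rule M.diagonal_in_polys[OF _ _ ext bound]) auto
  then show ?thesis
    using u by (simp add: linops_def polys_def)
qed

locale linop =
  fixes E :: "('k::real_normed_field, 'a) nspace" and F :: "('k, 'b) nspace" and u
  assumes normed_E: "normed_nspace E" and normed_F: "normed_nspace F" and linop: "u \<in> linops E F"
begin

lemma into: "x \<in> pts E \<Longrightarrow> u x \<in> pts F"
  and add: "\<lbrakk>x \<in> pts E; y \<in> pts E\<rbrakk> \<Longrightarrow> u (vadd E x y) = vadd F (u x) (u y)"
  and scale: "x \<in> pts E \<Longrightarrow> u (vscale E c x) = vscale F c (u x)"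
  and ext: "u \<in> extensional (pts E)"
  and cont: "continuous_map (vtop E) (vtop F) u"
  using linop by (auto simp: linops_def PiE_iff)

sublocale homogeneous_map 1 E F u
  using normed_E normed_F by (intro homogeneous_map.intro) (auto simp: into scale)

lemma unit_bound: "\<lbrakk>x \<in> pts E; vnorm E x \<le> 1\<rbrakk> \<Longrightarrow> vnorm F (u x) \<le> ball_norm E F u"
  using continuous_bound[OF cont] ball_norm_ball by metis

lemma norm_le: "x \<in> pts E \<Longrightarrow> vnorm F (u x) \<le> ball_norm E F u * vnorm E x"
  using unit_ball_bound[OF unit_bound] by simp

lemma norm_nonneg: "0 \<le> ball_norm E F u"
  by (rule ball_norm_nonneg[OF unit_bound])

end

locale polynomial =
  fixes n :: nat and E :: "('k::real_normed_field, 'a) nspace" and F :: "('k, 'b) nspace" and P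
  assumes normed_E: "normed_nspace E" and normed_F: "normed_nspace F"
    and degree: "1 \<le> n" and poly: "P \<in> polys n E F"
begin

sublocale P: homogeneous_map n E F P
  by (rule polysE[OF poly normed_E normed_F degree])

abbreviation "A \<equiv> polar n E F P"

text \<open>Symmetrizing any multilinear map with diagonal \<open>P\<close> produces the polar, so
  the properties hidden behind \<open>THE\<close> become available at once.\<close>

lemma polar_facts: "multilinear_power n E F A \<and> symmetric_map n E A \<and> A = polarize n E F P \<and>
    (\<forall>v\<in>pts E. P v = A (\<lambda>i\<in>{..<n}. v))"
proof -
  obtain B where B: "multilinear_power n E F B" "\<And>v. v \<in> pts E \<Longrightarrow> P v = B (\<lambda>i\<in>{..<n}. v)"
    by (rule polysE[OF poly normed_E normed_F degree]) blast
  interpret B: multilinear_power n E F B by (rule B)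
  have "A = symmetrize n E F B"
    by (rule B.polar_eq_symmetrize[OF B(2)])
  then show ?thesis
    using B.multilinear_symmetrize B.symmetric_symmetrize B.polarization[OF B(2)] B.symmetrize_diagonal
    by (auto simp: multilinear_power_def normed_E normed_F B(2))
qed

sublocale A: multilinear_power n E F A
  using polar_facts by blast

lemma symmetric_A: "symmetric_map n E A"
  and A_polarize: "A = polarize n E F P"
  and diagonal: "v \<in> pts E \<Longrightarrow> P v = A (\<lambda>i\<in>{..<n}. v)"
  using polar_facts by blast+

lemma P_bound: "\<lbrakk>v \<in> pts E; vnorm E v \<le> 1\<rbrakk> \<Longrightarrow> vnorm F (P v) \<le> ball_norm E F P"
  by (rule polysE[OF poly normed_E normed_F degree]) (rule P.ball_norm_ball)

lemma P_norm: "v \<in> pts E \<Longrightarrow> vnorm F (P v) \<le> ball_norm E F P * vnorm E v ^ n"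
  by (rule P.unit_ball_bound[OF P_bound])

lemma P_norm_nonneg: "0 \<le> ball_norm E F P"
  by (rule P.ball_norm_nonneg[OF P_bound])

lemma A_bound:
  "\<lbrakk>x \<in> tuples_in n E; \<And>i. i < n \<Longrightarrow> vnorm E (x i) \<le> 1\<rbrakk>
    \<Longrightarrow> vnorm F (A x) \<le> real n ^ n / fact n * ball_norm E F P"
  using A.norm_symmetrize_le[OF diagonal degree P_bound P_norm_nonneg]
  by (simp add: A.symmetrize_id[OF symmetric_A])

end

section \<open>Estimates from stability, and the embedding of a space into its sequence
  space\<close>

locale summing_setup =
  fixes X Y :: "('k::{real_normed_field,banach}, 'u) seq_rule"
  assumes class_X: "sequence_class X" and stable_X: "multilinearly_stable X"
    and class_Y: "sequence_class Y" and stable_Y: "linearly_stable Y"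
    and compatible: "1 \<le> n \<Longrightarrow> power_embeds n X Y"
begin

lemma seq_X: "banach_nspace E \<Longrightarrow> seq_space E (X E)"
  and seq_Y: "banach_nspace E \<Longrightarrow> seq_space E (Y E)"
  using class_X class_Y by (auto simp: sequence_class_def seq_space_def)

lemma c00_X: "banach_nspace E \<Longrightarrow> c00 E \<subseteq> pts (X E)"
  using class_X by (auto simp: sequence_class_def)

lemma norm_unit_seq: "vnorm (X scalars) (unit_seq j) = 1" "vnorm (Y scalars) (unit_seq j) = 1"
  using class_X class_Y by (auto simp: sequence_class_def)

text \<open>Stability equates two suprema and asserts that the induced map is continuous. Continuity
  makes the supremum over sequences finite, and only then does the equality become an inequality for
  every tuple.\<close>

lemma multilinear_stability:
  fixes E :: "nat \<Rightarrow> ('k, 'k + 'u) nspace" and F :: "('k, 'k + 'u) nspace"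
  assumes n: "1 \<le> n" and E: "\<And>m. m < n \<Longrightarrow> banach_nspace (E m)" and F: "banach_nspace F"
    and A: "multilinear n E F A"
    and bound: "\<And>x. \<lbrakk>x \<in> tuples n E; \<And>i. i < n \<Longrightarrow> vnorm (E i) (x i) \<le> 1\<rbrakk> \<Longrightarrow> vnorm F (A x) \<le> C"
    and x: "x \<in> tuples n (\<lambda>m. X (E m))"
  shows "induced n A x \<in> pts (X F)"
    and "vnorm (X F) (induced n A x) \<le> C * (\<Prod>m<n. vnorm (X (E m)) (x m))"
proof -
  interpret A: multilinear_map n E F A
    using E F A by (intro multilinear_map.intro) (auto simp: banach_nspace_def)
  have "multicontinuous n E F A"
    by (rule A.bounded_multicontinuous, rule A.unit_ball_bound, rule bound)
  then have "A \<in> multiops n E F"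
    using A by (simp add: multiops_def)
  then have st: "\<forall>x\<in>tuples n (\<lambda>m. X (E m)). induced n A x \<in> pts (X F)"
      "multicontinuous n (\<lambda>m. X (E m)) (X F) (induced n A)"
      "multinorm n (\<lambda>m. X (E m)) (X F) (induced n A) = multinorm n E F A"
    using stable_X n E F unfolding multilinearly_stable_def by blast+
  interpret I: induced_map n E F A "\<lambda>m. X (E m)" "X F"
    by (intro induced_map.intro induced_map_axioms.intro A.multilinear_map_axioms seq_X E F)
      (use st(1) in auto)
  interpret H: homog_map n "\<lambda>m. X (E m)" "X F" "induced n A"
    by (rule I.homog_induced)
  obtain K where K: "\<And>x. \<lbrakk>x \<in> tuples n (\<lambda>m. X (E m)); \<And>i. i < n \<Longrightarrow> vnorm (X (E i)) (x i) \<le> 1\<rbrakk>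
      \<Longrightarrow> vnorm (X F) (induced n A x) \<le> K"
    using H.multicontinuous_bound[OF st(2) n] by blast
  show "induced n A x \<in> pts (X F)"
    using st(1) x by blast
  have "vnorm (X F) (induced n A x) \<le> multinorm n E F A * (\<Prod>m<n. vnorm (X (E m)) (x m))"
    unfolding st(3)[symmetric] by (rule H.norm_le_multinorm[OF K x])
  also have "\<dots> \<le> C * (\<Prod>m<n. vnorm (X (E m)) (x m))"
    by (intro mult_right_mono A.multinorm_le bound H.prod_norm_nonneg x)
  finally show "vnorm (X F) (induced n A x) \<le> C * (\<Prod>m<n. vnorm (X (E m)) (x m))" .
qed

text \<open>\<open>X\<close> is stable under multilinear operators, and a linear operator is the
  case \<open>n = 1\<close>.\<close>

lemma linear_stability_X:
  assumes E: "banach_nspace E" and F: "banach_nspace F" and u: "u \<in> linops E F" and x: "x \<in> pts (X E)"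
  shows "(\<lambda>j. u (x j)) \<in> pts (X F)"
    and "vnorm (X F) (\<lambda>j. u (x j)) \<le> ball_norm E F u * vnorm (X E) x"
proof -
  interpret E: banach_nspace E by (rule E)
  interpret F: banach_nspace F by (rule F)
  interpret XE: seq_space E "X E" by (rule seq_X[OF E])
  interpret u: linop E F u
    using u by unfold_locales
  define A where "A = (\<lambda>z\<in>tuples_in 1 E. u (z 0))"
  interpret A: multilinear_power 1 E F A
    unfolding A_def by (intro linear_multilinear_power) (auto simp: u.into u.add u.scale E.normed_nspace_axioms F.normed_nspace_axioms)
  have x1: "(\<lambda>m\<in>{..<1}. x) \<in> tuples_in 1 (X E)"
    using x by auto
  have eq: "induced 1 A (\<lambda>m\<in>{..<1}. x) = (\<lambda>j. u (x j))"
    using XE.coord[OF x] by (auto simp: induced_def A_def fun_eq_iff)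
  have bound: "vnorm F (A z) \<le> ball_norm E F u"
    if "z \<in> tuples_in 1 E" "\<And>i. i < 1 \<Longrightarrow> vnorm E (z i) \<le> 1" for z
    using that u.unit_bound[of "z 0"] by (auto simp: A_def)
  note st = multilinear_stability[of 1 "\<lambda>_. E" F A, OF _ E F A.multilinear_B bound x1, unfolded eq]
  show "(\<lambda>j. u (x j)) \<in> pts (X F)"
    by (rule st(1)) auto
  have "vnorm (X F) (\<lambda>j. u (x j)) \<le> ball_norm E F u * (\<Prod>m<1. vnorm (X E) ((\<lambda>m\<in>{..<1::nat}. x) m))"
    by (rule st(2)) auto
  then show "vnorm (X F) (\<lambda>j. u (x j)) \<le> ball_norm E F u * vnorm (X E) x"
    by simp
qed

text \<open>As for \<open>X\<close>, the continuity of the induced operator turns the equality of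
  suprema into an estimate.\<close>

lemma linear_stability_Y:
  assumes E: "banach_nspace E" and F: "banach_nspace F" and u: "u \<in> linops E F" and x: "x \<in> pts (Y E)"
  shows "(\<lambda>j. u (x j)) \<in> pts (Y F)"
    and "vnorm (Y F) (\<lambda>j. u (x j)) \<le> ball_norm E F u * vnorm (Y E) x"
proof -
  interpret E: banach_nspace E by (rule E)
  interpret F: banach_nspace F by (rule F)
  interpret YE: seq_space E "Y E" by (rule seq_Y[OF E])
  interpret YF: seq_space F "Y F" by (rule seq_Y[OF F])
  interpret u: linop E F u
    using u by unfold_locales
  have st: "\<forall>x\<in>pts (Y E). (\<lambda>j. u (x j)) \<in> pts (Y F)"
      "continuous_map (vtop (Y E)) (vtop (Y F)) (\<lambda>x j. u (x j))"
      "ball_norm (Y E) (Y F) (\<lambda>x j. u (x j)) = ball_norm E F u"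
    using stable_Y E F u unfolding linearly_stable_def by blast+
  interpret H: homogeneous_map 1 "Y E" "Y F" "\<lambda>x j. u (x j)"
  proof
    show "(\<lambda>j. u (vscale (Y E) c x j)) = vscale (Y F) (c ^ 1) (\<lambda>j. u (x j))" if "x \<in> pts (Y E)" for c x
      using that st(1) by (simp add: YE.vscale_eq YF.vscale_eq u.scale YE.coord)
  qed (use st(1) in auto)
  show "(\<lambda>j. u (x j)) \<in> pts (Y F)"
    using st(1) x by blast
  obtain C where "\<And>x. \<lbrakk>x \<in> pts (Y E); vnorm (Y E) x \<le> 1\<rbrakk> \<Longrightarrow> vnorm (Y F) (\<lambda>j. u (x j)) \<le> C"
    using H.continuous_bound[OF st(2)] by blast
  from H.norm_le_ball_norm[OF this x] show "vnorm (Y F) (\<lambda>j. u (x j)) \<le> ball_norm E F u * vnorm (Y E) x"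
    by (simp add: st(3))
qed

definition at0 :: "('k, 'k + 'u) nspace \<Rightarrow> 'k + 'u \<Rightarrow> nat \<Rightarrow> 'k + 'u" where
  "at0 E x = (\<lambda>j. if j = 0 then x else vzero E)"

text \<open>Multiplication of scalars by a fixed vector carries scalar sequences to vector
  sequences. It is used for \<open>at0\<close> and for polynomials of finite type.\<close>

lemma multiples_linop:
  assumes E: "banach_nspace E" and b: "b \<in> pts E"
  shows "(\<lambda>z\<in>pts scalars. vscale E (projl z) b) \<in> linops (scalars :: ('k, 'k + 'u) nspace) E"
    and "ball_norm (scalars :: ('k, 'k + 'u) nspace) E (\<lambda>z\<in>pts scalars. vscale E (projl z) b) \<le> vnorm E b"
proof -
  let ?K = "scalars :: ('k, 'k + 'u) nspace"
  let ?u = "\<lambda>z\<in>pts ?K. vscale E (projl z) b"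
  interpret E: banach_nspace E by (rule E)
  interpret K: banach_nspace ?K by (rule banach_scalars)
  have bound: "vnorm E (?u z) \<le> vnorm E b" if "z \<in> pts ?K" "vnorm ?K z \<le> 1" for z
    using that b by (auto simp: E.norm_scale scalars_def intro: mult_left_le_one_le E.norm_nonneg)
  show lin: "?u \<in> linops ?K E"
  proof (rule linopsI[OF K.normed_nspace_axioms E.normed_nspace_axioms _ _ _ _ bound])
  qed (auto simp: scalars_def b E.scale_closed E.scale_add_left E.scale_scale extensional_def)
  interpret u: linop ?K E ?u
    using lin by unfold_locales
  show "ball_norm ?K E ?u \<le> vnorm E b"
    by (rule u.ball_norm_le[OF bound])
qed

text \<open>Multiplication by \<open>x\<close> sends the scalar sequence \<open>unit_seq 0\<close>,
  which has norm \<open>1\<close>, to \<open>at0 E x\<close>; linear stability transfers the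
  norm.\<close>

lemma at0_X:
  assumes E: "banach_nspace E" and x: "x \<in> pts E"
  shows "at0 E x \<in> pts (X E)" and "vnorm (X E) (at0 E x) \<le> vnorm E x"
proof -
  let ?K = "scalars :: ('k, 'k + 'u) nspace"
  let ?u = "\<lambda>z\<in>pts ?K. vscale E (projl z) x"
  interpret E: banach_nspace E by (rule E)
  have "unit_seq 0 \<in> c00 ?K"
    by (auto simp: c00_def scalars_def unit_seq_def)
  then have mem: "unit_seq 0 \<in> pts (X ?K)"
    using c00_X[OF banach_scalars] by blast
  have eq: "(\<lambda>j. ?u (unit_seq 0 j)) = at0 E x"
    using x by (auto simp: at0_def unit_seq_def scalars_def E.scale_one E.scale_zero_left)
  note st = linear_stability_X[OF banach_scalars E multiples_linop(1)[OF E x] mem, unfolded eq]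
  show "at0 E x \<in> pts (X E)"
    by (rule st(1))
  show "vnorm (X E) (at0 E x) \<le> vnorm E x"
    using st(2) multiples_linop(2)[OF E x] unfolding norm_unit_seq by linarith
qed

end

section \<open>The two norms of a single summing polynomial\<close>

locale summing_poly = summing_setup X Y
  for X Y :: "('k::{real_normed_field,banach}, 'u) seq_rule" +
  fixes n :: nat and E F :: "('k, 'k + 'u) nspace" and P :: "'k + 'u \<Rightarrow> 'k + 'u"
  assumes banach_E: "banach_nspace E" and banach_F: "banach_nspace F" and degree: "1 \<le> n"
    and P: "P \<in> summing_polys X Y n E F"
begin

sublocale E: banach_nspace E by (rule banach_E)
sublocale F: banach_nspace F by (rule banach_F)
sublocale XE: seq_space E "X E" by (rule seq_X[OF banach_E])
sublocale YF: seq_space F "Y F" by (rule seq_Y[OF banach_F])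

lemma P_poly: "P \<in> polys n E F"
  and seq_into: "x \<in> pts (X E) \<Longrightarrow> (\<lambda>j. P (x j)) \<in> pts (Y F)"
  using P by (auto simp: summing_polys_def)

sublocale polynomial n E F P
  using P_poly degree by unfold_locales

text \<open>The polarization formula is carried out in the sequence spaces: signed sums are formed
  in \<open>X(E)\<close>, their images under \<open>P\<close> lie in \<open>Y(F)\<close>, and
  \<open>Y(F)\<close> is closed under linear combinations. In each coordinate this is
  \<open>polarize\<close> for \<open>P\<close>.\<close>

lemma induced_into:
  assumes x: "x \<in> tuples_in n (X E)"
  shows "induced n A x \<in> pts (Y F)"
proof -
  let ?v = "\<lambda>e. vsum (X E) (\<lambda>i. vscale (X E) (e i) (x i)) {..<n}"
  let ?t = "\<lambda>e. vscale (Y F) (\<Prod>i<n. e i) (\<lambda>j. P (?v e j))"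
  have ex: "(\<lambda>i. vscale (X E) (e i) (x i)) ` {..<n} \<subseteq> pts (X E)" for e
    using x by (auto intro: XE.V.scale_closed)
  have v: "?v e \<in> pts (X E)" for e
    by (intro XE.V.vsum_closed ex)
  have v_eq: "?v e j = vsum E (\<lambda>i. vscale E (e i) (x i j)) {..<n}" for e j
  proof -
    have "?v e j = vsum E (\<lambda>i. vscale (X E) (e i) (x i) j) {..<n}"
      by (simp add: XE.vsum_eq ex)
    also have "\<dots> = vsum E (\<lambda>i. vscale E (e i) (x i j)) {..<n}"
      using tuple_mem[OF x]
      by (intro E.vsum_cong) (simp_all add: XE.vscale_eq E.scale_closed XE.coord image_subset_iff)
    finally show ?thesis .
  qed
  have t: "?t ` signs n \<subseteq> pts (Y F)"
    using v by (auto intro!: YF.V.scale_closed seq_into)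
  have "induced n A x = vscale (Y F) (1 / (2 ^ n * fact n)) (vsum (Y F) ?t (signs n))"
  proof
    fix j
    have xj: "(\<lambda>m\<in>{..<n}. x m j) \<in> tuples_in n E"
      using x by (auto intro: XE.coord)
    have xv: "vsum E (\<lambda>i. vscale E (e i) ((\<lambda>m\<in>{..<n}. x m j) i)) {..<n} = ?v e j" for e
      unfolding v_eq using tuple_mem[OF x]
      by (intro E.vsum_cong) (simp_all add: E.scale_closed XE.coord image_subset_iff)
    have "induced n A x j = vscale F (1 / (2 ^ n * fact n)) (vsum F (\<lambda>e. vscale F (\<Prod>i<n. e i) (P (?v e j))) (signs n))"
      unfolding induced_eq A_polarize polarize_def restrict_apply'[OF xj] xv ..
    also have "vsum F (\<lambda>e. vscale F (\<Prod>i<n. e i) (P (?v e j))) (signs n) = vsum (Y F) ?t (signs n) j"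
      unfolding YF.vsum_eq[OF finite_signs t] by (simp only: YF.vscale_eq[OF seq_into[OF v]])
    finally show "induced n A x j = vscale (Y F) (1 / (2 ^ n * fact n)) (vsum (Y F) ?t (signs n)) j"
      by (simp add: YF.vscale_eq YF.V.vsum_closed t)
  qed
  then show ?thesis
    by (simp add: YF.V.scale_closed YF.V.vsum_closed t)
qed

sublocale I: induced_map n "\<lambda>_. E" F A "\<lambda>_. X E" "Y F"
  using induced_into XE.seq_space_axioms YF.seq_space_axioms by unfold_locales

sublocale IH: homog_map n "\<lambda>_. X E" "Y F" "induced n A"
  by (rule I.homog_induced)

lemma diagonal_induced: "x \<in> pts (X E) \<Longrightarrow> induced n A (\<lambda>i\<in>{..<n}. x) = (\<lambda>j. P (x j))"
proof
  fix j assume x: "x \<in> pts (X E)"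
  have "(\<lambda>m\<in>{..<n}. (\<lambda>i\<in>{..<n}. x) m j) = (\<lambda>m\<in>{..<n}. x j)"
    by auto
  then show "induced n A (\<lambda>i\<in>{..<n}. x) j = P (x j)"
    by (simp only: induced_eq diagonal XE.coord[OF x])
qed

text \<open>One level up, the induced map is multilinear on \<open>X(E)\<close> and its diagonal is
  the polynomial induced by \<open>P\<close>. Homogeneity and the polarization inequality therefore
  apply to sequences as they do to vectors.\<close>

sublocale IP: multilinear_power n "X E" "Y F" "restrict (induced n A) (tuples_in n (X E))"
  using I.multilinear_induced by (simp add: multilinear_power_def multilinear_map_def IH.normed_F XE.V.normed_nspace_axioms)

lemma diagonal_IP:
  "x \<in> pts (X E) \<Longrightarrow> (\<lambda>j. P (x j)) = restrict (induced n A) (tuples_in n (X E)) (\<lambda>i\<in>{..<n}. x)"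
  using diagonal_induced[of x] const_tuple[of x "X E" n] by simp

sublocale HP: homogeneous_map n "X E" "Y F" "\<lambda>x j. P (x j)"
  by (rule IP.homogeneous_diagonal[OF diagonal_IP degree])

abbreviation "N1 \<equiv> summing_norm1 X Y n E F"
abbreviation "N2 \<equiv> summing_norm2 X Y n E F"

lemma N2_bound:
  assumes x: "x \<in> tuples_in n (X E)" "\<And>i. i < n \<Longrightarrow> vnorm (X E) (x i) \<le> 1"
  shows "vnorm (Y F) (induced n A x) \<le> N2 P"
proof (rule I.induced_bound[OF A_bound])
  fix K
  assume K: "\<And>x. \<lbrakk>x \<in> tuples_in n (X E); \<And>i. i < n \<Longrightarrow> vnorm (X E) (x i) \<le> 1\<rbrakk>
      \<Longrightarrow> vnorm (Y F) (induced n A x) \<le> K"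
  show ?thesis
    unfolding summing_norm2_def summing_multinorm_def by (rule IH.multinorm_ball[OF K x])
qed

lemma N2_le:
  assumes "\<And>x. \<lbrakk>x \<in> tuples_in n (X E); \<And>i. i < n \<Longrightarrow> vnorm (X E) (x i) \<le> 1\<rbrakk>
    \<Longrightarrow> vnorm (Y F) (induced n A x) \<le> C"
  shows "N2 P \<le> C"
  unfolding summing_norm2_def summing_multinorm_def by (rule IH.multinorm_le[OF assms])

lemma N2_norm:
  "x \<in> tuples_in n (X E) \<Longrightarrow> vnorm (Y F) (induced n A x) \<le> N2 P * (\<Prod>i<n. vnorm (X E) (x i))"
  by (rule IH.unit_ball_bound[OF N2_bound])

text \<open>Diagonal tuples transfer the finite bound from the multilinear supremum to the one that
  defines \<open>N1\<close>.\<close>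

lemma seq_bound_N2: "\<lbrakk>x \<in> pts (X E); vnorm (X E) x \<le> 1\<rbrakk> \<Longrightarrow> vnorm (Y F) (\<lambda>j. P (x j)) \<le> N2 P"
  using N2_bound[OF const_tuple[of x "X E" n]] by (simp add: diagonal_induced)

lemma N1_bound: "\<lbrakk>x \<in> pts (X E); vnorm (X E) x \<le> 1\<rbrakk> \<Longrightarrow> vnorm (Y F) (\<lambda>j. P (x j)) \<le> N1 P"
  unfolding summing_norm1_def by (rule HP.ball_norm_ball[OF seq_bound_N2])

lemma N1_le:
  assumes "\<And>x. \<lbrakk>x \<in> pts (X E); vnorm (X E) x \<le> 1\<rbrakk> \<Longrightarrow> vnorm (Y F) (\<lambda>j. P (x j)) \<le> C"
  shows "N1 P \<le> C"
  unfolding summing_norm1_def by (rule HP.ball_norm_le[OF assms])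

lemma N1_norm: "x \<in> pts (X E) \<Longrightarrow> vnorm (Y F) (\<lambda>j. P (x j)) \<le> N1 P * vnorm (X E) x ^ n"
  by (rule HP.unit_ball_bound[OF N1_bound])

lemma N1_nonneg: "0 \<le> N1 P"
  unfolding summing_norm1_def by (rule HP.ball_norm_nonneg[OF seq_bound_N2])

lemma N1_le_N2: "N1 P \<le> N2 P"
  by (rule N1_le[OF seq_bound_N2])

lemma N2_nonneg: "0 \<le> N2 P"
  using N1_nonneg N1_le_N2 by simp

text \<open>This is \<open>norm_symmetrize_le\<close> for the sequence spaces. It estimates the
  symmetrization of the induced map, which is that map itself because the polar of \<open>P\<close>
  is symmetric.\<close>

lemma N2_le_N1: "N2 P \<le> real n ^ n / fact n * N1 P"
proof (rule N2_le)
  fix x assume x: "x \<in> tuples_in n (X E)" "\<And>i. i < n \<Longrightarrow> vnorm (X E) (x i) \<le> 1"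
  let ?B = "restrict (induced n A) (tuples_in n (X E))"
  have "symmetric_map n (X E) ?B"
    unfolding symmetric_map_def
  proof (intro allI impI ballI)
    fix \<sigma> x assume s: "\<sigma> permutes {..<n}" and x: "x \<in> tuples_in n (X E)"
    have "induced n A (x \<circ> \<sigma>) j = induced n A x j" for j
    proof -
      have xj: "(\<lambda>m\<in>{..<n}. x m j) \<in> tuples_in n E"
        by (rule I.slice[OF x])
      have "(\<lambda>m\<in>{..<n}. (x \<circ> \<sigma>) m j) = (\<lambda>m\<in>{..<n}. x m j) \<circ> \<sigma>"
        using permutes_in_image[OF s] by (auto simp: fun_eq_iff)
      then show ?thesis
        using symmetric_A s xj by (simp only: induced_eq symmetric_map_def)
    qed
    then show "?B (x \<circ> \<sigma>) = ?B x"
      using perm_tuple[OF s x] x by (auto simp: fun_eq_iff)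
  qed
  then have sym: "symmetrize n (X E) (Y F) ?B = ?B"
    by (rule IP.symmetrize_id)
  have "vnorm (Y F) (symmetrize n (X E) (Y F) ?B x) \<le> real n ^ n / fact n * N1 P"
    by (rule IP.norm_symmetrize_le[OF diagonal_IP degree N1_bound N1_nonneg x])
  then show "vnorm (Y F) (induced n A x) \<le> real n ^ n / fact n * N1 P"
    by (simp only: sym restrict_apply'[OF x(1)])
qed

text \<open>The sequence \<open>at0 E x\<close> has norm at most that of \<open>x\<close>, and
  coordinate \<open>0\<close> of its image is \<open>P x\<close>.\<close>

lemma norm_le_N1:
  assumes x: "x \<in> pts E"
  shows "vnorm F (P x) \<le> N1 P * vnorm E x ^ n"
proof -
  have "vnorm F (P x) \<le> vnorm (Y F) (\<lambda>j. P (at0 E x j))"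
    using YF.norm_coord_le[OF seq_into[OF at0_X(1)[OF banach_E x]], of 0] by (simp add: at0_def)
  also have "\<dots> \<le> N1 P * vnorm (X E) (at0 E x) ^ n"
    by (rule N1_norm[OF at0_X(1)[OF banach_E x]])
  also have "\<dots> \<le> N1 P * vnorm E x ^ n"
    by (intro mult_left_mono power_mono at0_X banach_E x N1_nonneg XE.V.norm_nonneg)
  finally show ?thesis .
qed

end

section \<open>The Banach spaces of summing polynomials\<close>

text \<open>An inequality under scaling suffices, since applying it to \<open>inverse c\<close>
  gives the reverse one. By \<open>N_eval\<close>, a map with \<open>N f = 0\<close> vanishes at
  every point, so \<open>N\<close> is definite.\<close>

lemma normed_map_space:
  assumes F: "normed_nspace F" and S: "S \<subseteq> pts E \<rightarrow>\<^sub>E pts F"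
    and zero: "(\<lambda>x\<in>pts E. vzero F) \<in> S"
    and add: "\<And>f g. \<lbrakk>f \<in> S; g \<in> S\<rbrakk> \<Longrightarrow> (\<lambda>x\<in>pts E. vadd F (f x) (g x)) \<in> S"
    and scale: "\<And>c f. f \<in> S \<Longrightarrow> (\<lambda>x\<in>pts E. vscale F c (f x)) \<in> S"
    and N_nonneg: "\<And>f. f \<in> S \<Longrightarrow> 0 \<le> N f"
    and N_add: "\<And>f g. \<lbrakk>f \<in> S; g \<in> S\<rbrakk> \<Longrightarrow> N (\<lambda>x\<in>pts E. vadd F (f x) (g x)) \<le> N f + N g"
    and N_scale: "\<And>c f. f \<in> S \<Longrightarrow> N (\<lambda>x\<in>pts E. vscale F c (f x)) \<le> norm c * N f"
    and N_eval: "\<And>f x. \<lbrakk>f \<in> S; x \<in> pts E\<rbrakk> \<Longrightarrow> \<exists>c. vnorm F (f x) \<le> N f * c"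
  shows "normed_nspace (map_space E F S N)"
proof -
  interpret F: normed_nspace F by (rule F)
  have val: "f x \<in> pts F" if "f \<in> S" "x \<in> pts E" for f x
    using S that by auto
  have res: "(\<lambda>x\<in>pts E. f x) = f" if "f \<in> S" for f
    using S that by (auto simp: PiE_iff extensional_restrict)
  let ?V = "map_space E F S N"
  note defs = map_space_def
  have eqI: "(\<lambda>x\<in>pts E. u x) = (\<lambda>x\<in>pts E. v x)" if "\<And>x. x \<in> pts E \<Longrightarrow> u x = v x" for u v
    using that by auto
  have scale_one: "vscale ?V 1 f = f" if "f \<in> S" for f
    using that by (simp add: defs F.scale_one val res cong: restrict_cong)
  have scale_scale: "vscale ?V c (vscale ?V d f) = vscale ?V (c * d) f" if "f \<in> S" for c d f
    using that by (simp add: defs F.scale_scale val cong: restrict_cong)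
  have N_zero: "N (\<lambda>x\<in>pts E. vzero F) = 0"
    using N_scale[OF zero, of 0] N_nonneg[OF zero]
    by (simp add: F.scale_zero_right F.zero_closed cong: restrict_cong)
  show ?thesis
  proof
    show "vzero ?V \<in> pts ?V"
      using zero by (simp add: defs)
    fix f g h c d
    show "vadd ?V f g \<in> pts ?V" if "f \<in> pts ?V" "g \<in> pts ?V"
      using add that by (simp add: defs)
    show sc: "vscale ?V c f \<in> pts ?V" if "f \<in> pts ?V" for c f
      using scale that by (simp add: defs)
    show "vadd ?V (vadd ?V f g) h = vadd ?V f (vadd ?V g h)"
      if "f \<in> pts ?V" "g \<in> pts ?V" "h \<in> pts ?V"
      using that by (simp add: defs F.add_assoc val cong: restrict_cong)
    show "vadd ?V f g = vadd ?V g f" if "f \<in> pts ?V" "g \<in> pts ?V"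
      using that by (simp add: defs) (intro eqI F.add_commute val)
    show "vadd ?V f (vzero ?V) = f" if "f \<in> pts ?V"
      using that by (simp add: defs F.add_zero val res cong: restrict_cong)
    show "\<exists>g\<in>pts ?V. vadd ?V f g = vzero ?V" if "f \<in> pts ?V"
    proof
      show "vscale ?V (- 1) f \<in> pts ?V"
        by (rule sc[OF that])
      show "vadd ?V f (vscale ?V (- 1) f) = vzero ?V"
        using that by (simp add: defs F.add_minus val cong: restrict_cong)
    qed
    show "vscale ?V c (vadd ?V f g) = vadd ?V (vscale ?V c f) (vscale ?V c g)"
      if "f \<in> pts ?V" "g \<in> pts ?V"
      using that by (simp add: defs F.scale_add_right val cong: restrict_cong)
    show "vscale ?V (c + d) f = vadd ?V (vscale ?V c f) (vscale ?V d f)" if "f \<in> pts ?V"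
      using that by (simp add: defs F.scale_add_left val cong: restrict_cong)
    show "vscale ?V c (vscale ?V d f) = vscale ?V (c * d) f" "vscale ?V 1 f = f" if "f \<in> pts ?V"
      using that scale_one scale_scale by (simp_all add: defs)
    show "0 \<le> vnorm ?V f" if "f \<in> pts ?V"
      using that N_nonneg by (simp add: defs)
    show "vnorm ?V f = 0 \<longleftrightarrow> f = vzero ?V" if f: "f \<in> pts ?V"
    proof
      assume "vnorm ?V f = 0"
      then have "f x = vzero F" if "x \<in> pts E" for x
        using N_eval[of f x] f that val[of f x] F.norm_nonneg[of "f x"] F.norm_eq_0_iff[of "f x"]
        by (auto simp: defs)
      then have "(\<lambda>x\<in>pts E. f x) = vzero ?V"
        by (auto simp: defs)
      then show "f = vzero ?V"
        using res[of f] f by (simp add: defs)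
    qed (simp add: defs N_zero)
    show "vnorm ?V (vscale ?V c f) = norm c * vnorm ?V f" if f: "f \<in> pts ?V"
    proof (cases "c = 0")
      case True
      then show ?thesis
        using f by (simp add: defs F.scale_zero_left val N_zero cong: restrict_cong)
    next
      case False
      have "vnorm ?V f = vnorm ?V (vscale ?V (inverse c) (vscale ?V c f))"
        using f False scale_scale[of f "inverse c" c] scale_one[of f] by (simp add: defs)
      also have "\<dots> \<le> norm (inverse c) * vnorm ?V (vscale ?V c f)"
        using N_scale[OF scale, of f "inverse c" c] f by (simp add: defs)
      finally have "norm c * vnorm ?V f \<le> vnorm ?V (vscale ?V c f)"
        using False by (simp add: norm_divide field_simps)
      then show ?thesis
        using N_scale[of f c] f by (simp add: defs)
    qed
    show "vnorm ?V (vadd ?V f g) \<le> vnorm ?V f + vnorm ?V g" if "f \<in> pts ?V" "g \<in> pts ?V"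
      using that N_add by (simp add: defs)
  qed
qed

section \<open>Polars of sums and scalar multiples\<close>

lemma multilinear_power_add:
  assumes A: "multilinear_power n E F A" and B: "multilinear_power n E F B"
  shows "multilinear_power n E F (\<lambda>x\<in>tuples_in n E. vadd F (A x) (B x))"
proof -
  interpret A: multilinear_power n E F A by (rule A)
  interpret B: multilinear_power n E F B by (rule B)
  have "multilinear n (\<lambda>_. E) F (\<lambda>x\<in>tuples_in n E. vadd F (A x) (B x))"
    unfolding multilinear_def
  proof (intro conjI allI impI ballI)
    fix i x y z assume *: "i < n" "x \<in> tuples_in n E" "y \<in> pts E" "z \<in> pts E"
    then have u: "x(i := v) \<in> tuples_in n E" if "v \<in> pts E" for v
      using that by (intro upd_tuple)
    show "(\<lambda>x\<in>tuples_in n E. vadd F (A x) (B x)) (x(i := vadd E y z))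
      = vadd F ((\<lambda>x\<in>tuples_in n E. vadd F (A x) (B x)) (x(i := y)))
          ((\<lambda>x\<in>tuples_in n E. vadd F (A x) (B x)) (x(i := z)))"
      by (simp only: restrict_apply' u A.E.add_closed * A.add_coord[OF *] B.add_coord[OF *]
          A.F.add_ac A.F.add_closed A.into B.into)
  next
    fix i x c y assume *: "i < n" "x \<in> tuples_in n E" "y \<in> pts E"
    then have u: "x(i := v) \<in> tuples_in n E" if "v \<in> pts E" for v
      using that by (intro upd_tuple)
    show "(\<lambda>x\<in>tuples_in n E. vadd F (A x) (B x)) (x(i := vscale E c y))
      = vscale F c ((\<lambda>x\<in>tuples_in n E. vadd F (A x) (B x)) (x(i := y)))"
      by (simp only: restrict_apply' u A.E.scale_closed * A.scale_coord[OF *] B.scale_coord[OF *]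
          A.F.scale_add_right A.into B.into)
  qed (auto intro!: A.F.add_closed A.into B.into)
  then show ?thesis
    by (intro multilinear_power.intro A.normed_base A.normed_target)
qed

lemma multilinear_power_scale:
  assumes A: "multilinear_power n E F A"
  shows "multilinear_power n E F (\<lambda>x\<in>tuples_in n E. vscale F d (A x))"
proof -
  interpret A: multilinear_power n E F A by (rule A)
  have "multilinear n (\<lambda>_. E) F (\<lambda>x\<in>tuples_in n E. vscale F d (A x))"
    unfolding multilinear_def
  proof (intro conjI allI impI ballI)
    fix i x y z assume *: "i < n" "x \<in> tuples_in n E" "y \<in> pts E" "z \<in> pts E"
    then have u: "x(i := v) \<in> tuples_in n E" if "v \<in> pts E" for v
      using that by (intro upd_tuple)
    show "(\<lambda>x\<in>tuples_in n E. vscale F d (A x)) (x(i := vadd E y z))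
      = vadd F ((\<lambda>x\<in>tuples_in n E. vscale F d (A x)) (x(i := y)))
          ((\<lambda>x\<in>tuples_in n E. vscale F d (A x)) (x(i := z)))"
      by (simp only: restrict_apply' u A.E.add_closed * A.add_coord[OF *] A.F.scale_add_right A.into)
  next
    fix i x c y assume *: "i < n" "x \<in> tuples_in n E" "y \<in> pts E"
    then have u: "x(i := v) \<in> tuples_in n E" if "v \<in> pts E" for v
      using that by (intro upd_tuple)
    show "(\<lambda>x\<in>tuples_in n E. vscale F d (A x)) (x(i := vscale E c y))
      = vscale F c ((\<lambda>x\<in>tuples_in n E. vscale F d (A x)) (x(i := y)))"
      by (simp only: restrict_apply' u A.E.scale_closed * A.scale_coord[OF *] A.F.scale_scale
          mult.commute A.into)
  qed (auto intro!: A.F.scale_closed A.into)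
  then show ?thesis
    by (intro multilinear_power.intro A.normed_base A.normed_target)
qed

lemma (in polynomial) polar_unique:
  assumes B: "multilinear_power n E F B" and sym: "symmetric_map n E B"
    and diag: "\<And>v. v \<in> pts E \<Longrightarrow> P v = B (\<lambda>i\<in>{..<n}. v)"
  shows "polar n E F P = B"
proof -
  interpret B: multilinear_power n E F B by (rule B)
  show ?thesis
    using B.polar_eq_symmetrize[OF diag] B.symmetrize_id[OF sym] by simp
qed

text \<open>The pointwise sum of the polars is symmetric and has the right diagonal, so it is the
  polar. The formula serves the second norm, which is defined through the polar.\<close>

lemma polys_add:
  assumes P: "polynomial n E F P" and Q: "polynomial n E F Q"
  shows "polynomial n E F (\<lambda>x\<in>pts E. vadd F (P x) (Q x))"
    and "polar n E F (\<lambda>x\<in>pts E. vadd F (P x) (Q x))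
      = (\<lambda>x\<in>tuples_in n E. vadd F (polar n E F P x) (polar n E F Q x))"
proof -
  interpret P: polynomial n E F P by (rule P)
  interpret Q: polynomial n E F Q by (rule Q)
  let ?R = "\<lambda>x\<in>pts E. vadd F (P x) (Q x)"
  let ?C = "\<lambda>x\<in>tuples_in n E. vadd F (P.A x) (Q.A x)"
  have C: "multilinear_power n E F ?C"
    by (intro multilinear_power_add P.A.multilinear_power_axioms Q.A.multilinear_power_axioms)
  interpret C: multilinear_power n E F ?C by (rule C)
  have diag: "?R v = ?C (\<lambda>i\<in>{..<n}. v)" if "v \<in> pts E" for v
    using that by (simp only: restrict_apply' const_tuple P.diagonal Q.diagonal)
  have "?R \<in> polys n E F"
  proof (rule C.diagonal_in_polys[OF diag P.degree])
    fix v assume "v \<in> pts E" "vnorm E v \<le> 1"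
    then show "vnorm F (?R v) \<le> ball_norm E F P + ball_norm E F Q"
      using P.P.F.norm_triangle[of "P v" "Q v"] P.P_bound[of v] Q.P_bound[of v]
      by (simp add: P.P.into Q.P.into)
  qed (simp_all only: restrict_extensional)
  then show R: "polynomial n E F ?R"
    by (intro polynomial.intro P.normed_E P.normed_F P.degree)
  interpret R: polynomial n E F ?R by (rule R)
  show "R.A = ?C"
  proof (rule R.polar_unique[OF C _ diag])
    show "symmetric_map n E ?C"
      using P.symmetric_A Q.symmetric_A by (simp add: symmetric_map_def perm_tuple)
  qed
qed

lemma polys_scale:
  assumes P: "polynomial n E F P"
  shows "polynomial n E F (\<lambda>x\<in>pts E. vscale F c (P x))"
    and "polar n E F (\<lambda>x\<in>pts E. vscale F c (P x)) = (\<lambda>x\<in>tuples_in n E. vscale F c (polar n E F P x))"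
proof -
  interpret P: polynomial n E F P by (rule P)
  let ?R = "\<lambda>x\<in>pts E. vscale F c (P x)"
  let ?C = "\<lambda>x\<in>tuples_in n E. vscale F c (P.A x)"
  have C: "multilinear_power n E F ?C"
    by (intro multilinear_power_scale P.A.multilinear_power_axioms)
  interpret C: multilinear_power n E F ?C by (rule C)
  have diag: "?R v = ?C (\<lambda>i\<in>{..<n}. v)" if "v \<in> pts E" for v
    using that by (simp only: restrict_apply' const_tuple P.diagonal)
  have "?R \<in> polys n E F"
  proof (rule C.diagonal_in_polys[OF diag P.degree])
    fix v assume "v \<in> pts E" "vnorm E v \<le> 1"
    then show "vnorm F (?R v) \<le> norm c * ball_norm E F P"
      using P.P_bound[of v] by (simp add: P.P.into P.P.F.norm_scale mult_left_mono)
  qed (simp_all only: restrict_extensional)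
  then show R: "polynomial n E F ?R"
    by (intro polynomial.intro P.normed_E P.normed_F P.degree)
  interpret R: polynomial n E F ?R by (rule R)
  show "R.A = ?C"
  proof (rule R.polar_unique[OF C _ diag])
    show "symmetric_map n E ?C"
      using P.symmetric_A by (simp add: symmetric_map_def perm_tuple)
  qed
qed

locale summing_component = summing_setup X Y
  for X Y :: "('k::{real_normed_field,banach}, 'u) seq_rule" +
  fixes n :: nat and E F :: "('k, 'k + 'u) nspace"
  assumes banach_E: "banach_nspace E" and banach_F: "banach_nspace F" and degree: "1 \<le> n"
begin

sublocale E: banach_nspace E by (rule banach_E)
sublocale F: banach_nspace F by (rule banach_F)
sublocale XE: seq_space E "X E" by (rule seq_X[OF banach_E])
sublocale YF: seq_space F "Y F" by (rule seq_Y[OF banach_F])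

abbreviation "S \<equiv> summing_polys X Y n E F"
abbreviation "N1 \<equiv> summing_norm1 X Y n E F"
abbreviation "N2 \<equiv> summing_norm2 X Y n E F"
abbreviation add (infixl "\<boxplus>" 65) where "P \<boxplus> Q \<equiv> (\<lambda>x\<in>pts E. vadd F (P x) (Q x))"
abbreviation scale (infixr "\<star>" 70) where "c \<star> P \<equiv> (\<lambda>x\<in>pts E. vscale F c (P x))"

lemma member: "P \<in> S \<Longrightarrow> summing_poly X Y n E F P"
  using banach_E banach_F degree
  by (intro summing_poly.intro summing_poly_axioms.intro summing_setup_axioms)

lemma member_poly: "P \<in> S \<Longrightarrow> polynomial n E F P"
  by (intro polynomial.intro E.normed_nspace_axioms F.normed_nspace_axioms degree)
    (simp add: summing_polys_def)

lemma point: "\<lbrakk>P \<in> S; x \<in> pts E\<rbrakk> \<Longrightarrow> P x \<in> pts F"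
  by (auto simp: summing_polys_def polys_def)

lemma seq_value: "\<lbrakk>P \<in> S; x \<in> pts (X E)\<rbrakk> \<Longrightarrow> (\<lambda>j. P (x j)) \<in> pts (Y F)"
  by (simp add: summing_polys_def)

lemma seq_add: "\<lbrakk>P \<in> S; Q \<in> S; x \<in> pts (X E)\<rbrakk> \<Longrightarrow>
    (\<lambda>j. (P \<boxplus> Q) (x j)) = vadd (Y F) (\<lambda>j. P (x j)) (\<lambda>j. Q (x j))"
  by (simp add: YF.vadd_eq seq_value XE.coord)

lemma seq_scale: "\<lbrakk>P \<in> S; x \<in> pts (X E)\<rbrakk> \<Longrightarrow>
    (\<lambda>j. (c \<star> P) (x j)) = vscale (Y F) c (\<lambda>j. P (x j))"
  by (simp add: YF.vscale_eq seq_value XE.coord)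

lemma S_I: "\<lbrakk>polynomial n E F P; \<And>x. x \<in> pts (X E) \<Longrightarrow> (\<lambda>j. P (x j)) \<in> pts (Y F)\<rbrakk> \<Longrightarrow> P \<in> S"
  by (simp add: summing_polys_def polynomial.poly)

lemma S_add: "\<lbrakk>P \<in> S; Q \<in> S\<rbrakk> \<Longrightarrow> P \<boxplus> Q \<in> S"
  by (rule S_I) (simp_all only: polys_add(1) member_poly seq_add YF.V.add_closed seq_value)

lemma S_scale: "P \<in> S \<Longrightarrow> c \<star> P \<in> S"
  by (rule S_I) (simp_all only: polys_scale(1) member_poly seq_scale YF.V.scale_closed seq_value)

lemma S_zero: "(\<lambda>x\<in>pts E. vzero F) \<in> S"
proof -
  let ?Z = "\<lambda>x\<in>tuples_in n E. vzero F"
  have "multilinear_power n E F ?Z"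
    by (intro multilinear_power.intro E.normed_nspace_axioms F.normed_nspace_axioms)
      (auto simp: multilinear_def upd_tuple E.closed F.closed F.add_zero F.scale_zero_right simp del: fun_upd_apply)
  then interpret Z: multilinear_power n E F ?Z .
  have "(\<lambda>x\<in>pts E. vzero F) \<in> polys n E F"
  proof (rule Z.diagonal_in_polys[OF _ degree])
    show "vnorm F ((\<lambda>x\<in>pts E. vzero F) v) \<le> 0" if "v \<in> pts E" for v
      using that by (simp add: F.norm_zero)
  qed auto
  then have "polynomial n E F (\<lambda>x\<in>pts E. vzero F)"
    by (intro polynomial.intro E.normed_nspace_axioms F.normed_nspace_axioms degree)
  then show ?thesis
    using YF.V.zero_closed by (intro S_I) (simp_all add: XE.coord YF.vzero_eq)
qed

lemma N1_add:
  assumes P: "P \<in> S" and Q: "Q \<in> S"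
  shows "N1 (P \<boxplus> Q) \<le> N1 P + N1 Q"
proof (rule summing_poly.N1_le[OF member[OF S_add[OF P Q]]])
  fix x assume x: "x \<in> pts (X E)" "vnorm (X E) x \<le> 1"
  show "vnorm (Y F) (\<lambda>j. (P \<boxplus> Q) (x j)) \<le> N1 P + N1 Q"
    unfolding seq_add[OF P Q x(1)]
    using YF.V.norm_triangle[OF seq_value[OF P x(1)] seq_value[OF Q x(1)]]
      summing_poly.N1_bound[OF member[OF P] x] summing_poly.N1_bound[OF member[OF Q] x] by linarith
qed

lemma N1_scale:
  assumes P: "P \<in> S"
  shows "N1 (c \<star> P) \<le> norm c * N1 P"
proof (rule summing_poly.N1_le[OF member[OF S_scale[OF P]]])
  fix x assume x: "x \<in> pts (X E)" "vnorm (X E) x \<le> 1"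
  show "vnorm (Y F) (\<lambda>j. (c \<star> P) (x j)) \<le> norm c * N1 P"
    unfolding seq_scale[OF P x(1)] YF.V.norm_scale[OF seq_value[OF P x(1)]]
    by (intro mult_left_mono summing_poly.N1_bound[OF member[OF P] x]) simp
qed

lemma N2_add:
  assumes P: "P \<in> S" and Q: "Q \<in> S"
  shows "N2 (P \<boxplus> Q) \<le> N2 P + N2 Q"
proof (rule summing_poly.N2_le[OF member[OF S_add[OF P Q]]])
  interpret P: summing_poly X Y n E F P by (rule member[OF P])
  interpret Q: summing_poly X Y n E F Q by (rule member[OF Q])
  fix x assume x: "x \<in> tuples_in n (X E)" "\<And>i. i < n \<Longrightarrow> vnorm (X E) (x i) \<le> 1"
  have "induced n (polar n E F (P \<boxplus> Q)) x = vadd (Y F) (induced n P.A x) (induced n Q.A x)"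
    unfolding YF.vadd_eq[OF P.induced_into[OF x(1)] Q.induced_into[OF x(1)]]
      polys_add(2)[OF member_poly[OF P] member_poly[OF Q]]
    by (intro ext) (simp only: induced_eq restrict_apply' P.I.slice[OF x(1)])
  then show "vnorm (Y F) (induced n (polar n E F (P \<boxplus> Q)) x) \<le> N2 P + N2 Q"
    using YF.V.norm_triangle[OF P.induced_into[OF x(1)] Q.induced_into[OF x(1)]]
      P.N2_bound[OF x] Q.N2_bound[OF x] by simp
qed

lemma N2_scale:
  assumes P: "P \<in> S"
  shows "N2 (c \<star> P) \<le> norm c * N2 P"
proof (rule summing_poly.N2_le[OF member[OF S_scale[OF P]]])
  interpret P: summing_poly X Y n E F P by (rule member[OF P])
  fix x assume x: "x \<in> tuples_in n (X E)" "\<And>i. i < n \<Longrightarrow> vnorm (X E) (x i) \<le> 1"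
  have "induced n (polar n E F (c \<star> P)) x = vscale (Y F) c (induced n P.A x)"
    unfolding YF.vscale_eq[OF P.induced_into[OF x(1)]]
      polys_scale(2)[OF member_poly[OF P]]
    by (intro ext) (simp only: induced_eq restrict_apply' P.I.slice[OF x(1)])
  then show "vnorm (Y F) (induced n (polar n E F (c \<star> P)) x) \<le> norm c * N2 P"
    using P.N2_bound[OF x] by (simp add: YF.V.norm_scale P.induced_into[OF x(1)] mult_left_mono)
qed

lemma S_maps: "S \<subseteq> pts E \<rightarrow>\<^sub>E pts F"
  by (auto simp: summing_polys_def polys_def)

lemma normed_N1: "normed_nspace (map_space E F S N1)"
  using summing_poly.N1_nonneg[OF member] summing_poly.norm_le_N1[OF member]
  by (intro normed_map_space F.normed_nspace_axioms S_maps S_zero S_add S_scale N1_add N1_scale) auto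

lemma norm_le_N2: "\<lbrakk>P \<in> S; x \<in> pts E\<rbrakk> \<Longrightarrow> vnorm F (P x) \<le> N2 P * vnorm E x ^ n"
  using summing_poly.norm_le_N1[OF member, of P x] summing_poly.N1_le_N2[OF member, of P]
  by (meson E.norm_nonneg mult_right_mono order_trans zero_le_power)

lemma normed_N2: "normed_nspace (map_space E F S N2)"
  using summing_poly.N2_nonneg[OF member] norm_le_N2
  by (intro normed_map_space F.normed_nspace_axioms S_maps S_zero S_add S_scale N2_add N2_scale) auto

section \<open>Completeness of both norms\<close>

abbreviation diff (infixl "\<boxminus>" 65) where "P \<boxminus> Q \<equiv> P \<boxplus> (- 1) \<star> Q"

lemma S_diff: "\<lbrakk>P \<in> S; Q \<in> S\<rbrakk> \<Longrightarrow> P \<boxminus> Q \<in> S"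
  by (intro S_add S_scale)

lemma diff_apply: "x \<in> pts E \<Longrightarrow> (P \<boxminus> Q) x = vsub F (P x) (Q x)"
  by (simp add: vsub_def)

lemma seq_diff: "\<lbrakk>P \<in> S; Q \<in> S; x \<in> pts (X E)\<rbrakk> \<Longrightarrow>
    (\<lambda>j. (P \<boxminus> Q) (x j)) = vsub (Y F) (\<lambda>j. P (x j)) (\<lambda>j. Q (x j))"
  by (simp only: YF.vsub_eq seq_value XE.coord diff_apply)

lemma vsub_map_space: "vsub (map_space E F S N) P Q = P \<boxminus> Q"
  by (simp add: vsub_def map_space_def)

text \<open>\<open>polarize\<close> forms a finite linear combination of values, so it respects
  pointwise limits.\<close>

lemma vlim_polarize:
  assumes lim: "\<And>v. v \<in> pts E \<Longrightarrow> vlim F (\<lambda>k. s k v) (P v)"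
    and s: "\<And>k v. v \<in> pts E \<Longrightarrow> s k v \<in> pts F" and P: "\<And>v. v \<in> pts E \<Longrightarrow> P v \<in> pts F"
    and x: "x \<in> tuples_in n E"
  shows "vlim F (\<lambda>k. polarize n E F (s k) x) (polarize n E F P x)" and "polarize n E F P x \<in> pts F"
proof -
  have v: "vsum E (\<lambda>i. vscale E (e i) (x i)) {..<n} \<in> pts E" for e
    using tuple_mem[OF x] by (intro E.vsum_closed) (auto simp: E.scale_closed)
  show "vlim F (\<lambda>k. polarize n E F (s k) x) (polarize n E F P x)"
    unfolding polarize_def restrict_apply'[OF x]
    by (intro F.vlim_scale F.vsum_vlim finite_signs lim F.scale_closed F.vsum_closed image_subsetI s P v)
  show "polarize n E F P x \<in> pts F"
    unfolding polarize_def restrict_apply'[OF x]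
    by (intro F.scale_closed F.vsum_closed image_subsetI P v)
qed

text \<open>All estimates are made for \<open>N1\<close>. The lower comparison turns a Cauchy
  sequence for \<open>N\<close> into one for \<open>N1\<close>, the upper one brings convergence
  back. It is used with \<open>K = 1\<close> and with the polarization constant.\<close>

lemma complete_equivalent:
  assumes normed: "normed_nspace (map_space E F S N)"
    and lower: "\<And>P. P \<in> S \<Longrightarrow> N1 P \<le> N P" and upper: "\<And>P. P \<in> S \<Longrightarrow> N P \<le> K * N1 P"
  shows "banach_nspace (map_space E F S N)"
proof (rule normed_nspace.banach_nspaceI[OF normed])
  fix s :: "nat \<Rightarrow> 'k + 'u \<Rightarrow> 'k + 'u"
  assume "\<And>k. s k \<in> pts (map_space E F S N)"
    and cauchy_N: "\<And>e. 0 < e \<Longrightarrow> \<exists>M. \<forall>k\<ge>M. \<forall>l\<ge>M.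
        vnorm (map_space E F S N) (vsub (map_space E F S N) (s k) (s l)) < e"
  then have s: "s k \<in> S" for k
    by (simp add: map_space_def)
  have sd: "s k \<boxminus> s l \<in> S" for k l
    by (intro S_diff s)
  have cauchy: "\<exists>M. \<forall>k\<ge>M. \<forall>l\<ge>M. N1 (s k \<boxminus> s l) < e" if "0 < e" for e
    using cauchy_N[OF that] lower[OF sd] unfolding vsub_map_space
    by (simp add: map_space_def) (meson le_less_trans)
  have scaled: "\<exists>M. \<forall>k\<ge>M. \<forall>l\<ge>M. N1 (s k \<boxminus> s l) * c < e" if "0 < e" "0 \<le> c" for e c :: real
  proof -
    \<comment> \<open>The summand \<open>1\<close> avoids a division by zero when
      \<open>c = 0\<close>.\<close>
    obtain M where M: "\<forall>k\<ge>M. \<forall>l\<ge>M. N1 (s k \<boxminus> s l) < e / (c + 1)"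
      using cauchy[of "e / (c + 1)"] \<open>0 < e\<close> \<open>0 \<le> c\<close> by auto
    have "N1 (s k \<boxminus> s l) * c < e" if "k \<ge> M" "l \<ge> M" for k l
    proof -
      have "N1 (s k \<boxminus> s l) * c \<le> e / (c + 1) * c"
        using M that \<open>0 \<le> c\<close> by (intro mult_right_mono) (auto intro: less_imp_le)
      also have "\<dots> < e"
        using \<open>0 < e\<close> \<open>0 \<le> c\<close> by (simp add: field_simps)
      finally show ?thesis .
    qed
    then show ?thesis by blast
  qed
  have "\<exists>l\<in>pts F. vlim F (\<lambda>k. s k x) l" if x: "x \<in> pts E" for x
  proof (rule F.Cauchy_vlim[of "\<lambda>k. s k x"])
    show "s k x \<in> pts F" for k
      by (rule point[OF s x])
    fix e :: real assume "0 < e"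
    then obtain M where M: "\<forall>k\<ge>M. \<forall>l\<ge>M. N1 (s k \<boxminus> s l) * vnorm E x ^ n < e"
      using scaled E.norm_nonneg[OF x] by (meson zero_le_power)
    have "vnorm F (vsub F (s k x) (s l x)) \<le> N1 (s k \<boxminus> s l) * vnorm E x ^ n" for k l
      using summing_poly.norm_le_N1[OF member[OF sd] x, of k l] by (simp only: diff_apply[OF x])
    then show "\<exists>M. \<forall>k\<ge>M. \<forall>l\<ge>M. vnorm F (vsub F (s k x) (s l x)) < e"
      using M by (meson le_less_trans)
  qed blast
  then obtain p where p: "\<And>x. x \<in> pts E \<Longrightarrow> p x \<in> pts F" "\<And>x. x \<in> pts E \<Longrightarrow> vlim F (\<lambda>k. s k x) (p x)"
    by metis
  define P where "P = restrict p (pts E)"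
  have P: "P x \<in> pts F" "vlim F (\<lambda>k. s k x) (P x)" if "x \<in> pts E" for x
    using p that by (simp_all add: P_def)
  have pol: "vlim F (\<lambda>k. polarize n E F (s k) x) (polarize n E F P x)" "polarize n E F P x \<in> pts F"
    if "x \<in> tuples_in n E" for x
    using vlim_polarize[of s P x] P point[OF s] that by blast+
  let ?B = "polarize n E F P"
  have A: "multilinear_power n E F (polarize n E F (s k))" for k
    using polynomial.polar_facts[OF member_poly[OF s]] by metis
  have A_into: "polarize n E F (s k) x \<in> pts F" if "x \<in> tuples_in n E" for k x
  proof -
    interpret A: multilinear_power n E F "polarize n E F (s k)" by (rule A)
    show ?thesis by (rule A.into[OF that])
  qed
  \<comment> \<open>To be a polynomial, the limit needs a multilinear map behind it. Its
    polarization is one: it is the pointwise limit of the polars of the \<open>s k\<close>, and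
    their linearity passes to the limit.\<close>
  have B: "multilinear_power n E F ?B"
  proof (intro multilinear_power.intro E.normed_nspace_axioms F.normed_nspace_axioms)
    show "multilinear n (\<lambda>_. E) F ?B"
      unfolding multilinear_def
    proof (intro conjI allI impI ballI)
      show "?B \<in> tuples_in n E \<rightarrow>\<^sub>E pts F"
        using pol(2) by (intro PiE_I) (auto simp: polarize_def)
      fix i x y assume i: "i < n" and x: "x \<in> tuples_in n E" and y: "y \<in> pts E"
      have u: "x(i := v) \<in> tuples_in n E" if "v \<in> pts E" for v
        using x i that by (intro upd_tuple)
      show "?B (x(i := vadd E y z)) = vadd F (?B (x(i := y))) (?B (x(i := z)))" if z: "z \<in> pts E" for z
      proof (rule F.vlim_unique)
        show "vlim F (\<lambda>k. polarize n E F (s k) (x(i := vadd E y z))) (?B (x(i := vadd E y z)))"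
          by (intro pol u E.add_closed y z)
        have "polarize n E F (s k) (x(i := vadd E y z))
            = vadd F (polarize n E F (s k) (x(i := y))) (polarize n E F (s k) (x(i := z)))" for k
        proof -
          interpret A: multilinear_power n E F "polarize n E F (s k)" by (rule A)
          show ?thesis by (intro A.add_coord i x y z)
        qed
        then show "vlim F (\<lambda>k. polarize n E F (s k) (x(i := vadd E y z)))
            (vadd F (?B (x(i := y))) (?B (x(i := z))))"
          by (simp only:) (intro F.vlim_add pol u y z A_into)
      qed (simp_all only: A_into pol u y z E.add_closed F.add_closed)
      show "?B (x(i := vscale E c y)) = vscale F c (?B (x(i := y)))" for c
      proof (rule F.vlim_unique)
        show "vlim F (\<lambda>k. polarize n E F (s k) (x(i := vscale E c y))) (?B (x(i := vscale E c y)))"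
          by (intro pol u E.scale_closed y)
        have "polarize n E F (s k) (x(i := vscale E c y)) = vscale F c (polarize n E F (s k) (x(i := y)))" for k
        proof -
          interpret A: multilinear_power n E F "polarize n E F (s k)" by (rule A)
          show ?thesis by (intro A.scale_coord i x y)
        qed
        then show "vlim F (\<lambda>k. polarize n E F (s k) (x(i := vscale E c y))) (vscale F c (?B (x(i := y))))"
          by (simp only:) (intro F.vlim_scale pol u y A_into)
      qed (simp_all only: A_into pol u y E.scale_closed F.scale_closed)
    qed
  qed
  interpret B: multilinear_power n E F ?B by (rule B)
  have diag: "P v = ?B (\<lambda>i\<in>{..<n}. v)" if v: "v \<in> pts E" for v
  proof (rule F.vlim_unique)
    show "vlim F (\<lambda>k. s k v) (P v)"
      by (rule P(2)[OF v])
    have "s k v = polarize n E F (s k) (\<lambda>i\<in>{..<n}. v)" for k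
      using polynomial.diagonal[OF member_poly[OF s] v] polynomial.A_polarize[OF member_poly[OF s]] by metis
    then show "vlim F (\<lambda>k. s k v) (?B (\<lambda>i\<in>{..<n}. v))"
      using pol(1)[OF const_tuple[OF v]] by simp
  qed (simp_all only: point[OF s v] P v B.into const_tuple)
  \<comment> \<open>From index \<open>M\<close> on, \<open>s k\<close> differs from
    \<open>s M\<close> by less than \<open>1\<close> in \<open>N1\<close>. This bounds the limit on
    the unit ball and so makes it continuous.\<close>
  obtain M where M: "\<And>k l. \<lbrakk>k \<ge> M; l \<ge> M\<rbrakk> \<Longrightarrow> N1 (s k \<boxminus> s l) < 1"
    using cauchy[of 1] by auto
  have "P \<in> polys n E F"
  proof (rule B.diagonal_in_polys[OF diag degree])
    fix v assume v: "v \<in> pts E" "vnorm E v \<le> 1"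
    have "vnorm F (s k v) \<le> 1 + N1 (s M)" if "k \<ge> M" for k
    proof -
      have bnd: "vnorm F (Q v) \<le> N1 Q" if "Q \<in> S" for Q
      proof -
        have "N1 Q * vnorm E v ^ n \<le> N1 Q"
          using v E.norm_nonneg by (intro mult_left_le power_le_one summing_poly.N1_nonneg[OF member[OF that]])
        then show ?thesis
          using summing_poly.norm_le_N1[OF member[OF that] v(1)] by simp
      qed
      have "vnorm F (s k v) \<le> vnorm F (vsub F (s k v) (s M v)) + vnorm F (s M v)"
        by (intro F.norm_le_vsub point s v)
      also have "vsub F (s k v) (s M v) = (s k \<boxminus> s M) v"
        by (simp only: diff_apply v)
      also have "vnorm F ((s k \<boxminus> s M) v) + vnorm F (s M v) \<le> 1 + N1 (s M)"
        using bnd[OF sd, of k M] bnd[OF s, of M] M[OF that order_refl] by linarith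
      finally show ?thesis .
    qed
    then show "vnorm F (P v) \<le> 1 + N1 (s M)"
      by (intro LIMSEQ_le_const2[OF F.norm_vlim[OF P(2)[OF v(1)] point[OF s v(1)] P(1)[OF v(1)]]] exI[of _ M]) simp
  qed (simp_all only: P_def restrict_extensional)
  then have P_poly: "polynomial n E F P"
    by (intro polynomial.intro E.normed_nspace_axioms F.normed_nspace_axioms degree)
  have seq_lim: "(\<lambda>j. P (x j)) \<in> pts (Y F) \<and> vlim (Y F) (\<lambda>k j. s k (x j)) (\<lambda>j. P (x j))"
    if x: "x \<in> pts (X E)" for x
  proof -
    obtain y where y: "y \<in> pts (Y F)" "vlim (Y F) (\<lambda>k j. s k (x j)) y"
    proof (rule YF.V.Cauchy_vlim[of "\<lambda>k j. s k (x j)"])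
      show "(\<lambda>j. s k (x j)) \<in> pts (Y F)" for k
        by (rule seq_value[OF s x])
      fix e :: real assume "0 < e"
      then obtain M where M: "\<forall>k\<ge>M. \<forall>l\<ge>M. N1 (s k \<boxminus> s l) * vnorm (X E) x ^ n < e"
        using scaled XE.V.norm_nonneg[OF x] by (meson zero_le_power)
      have "vnorm (Y F) (vsub (Y F) (\<lambda>j. s k (x j)) (\<lambda>j. s l (x j))) \<le> N1 (s k \<boxminus> s l) * vnorm (X E) x ^ n" for k l
        using summing_poly.N1_norm[OF member[OF sd] x, of k l] by (simp only: seq_diff[OF s s x])
      then show "\<exists>M. \<forall>k\<ge>M. \<forall>l\<ge>M. vnorm (Y F) (vsub (Y F) (\<lambda>j. s k (x j)) (\<lambda>j. s l (x j))) < e"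
        using M by (meson le_less_trans)
    qed
    \<comment> \<open>Completeness of \<open>Y(F)\<close> only provides some limit \<open>y\<close>;
      its coordinates are pointwise limits, and these are known to be the values of
      \<open>P\<close>.\<close>
    have "y j = P (x j)" for j
      by (rule F.vlim_unique[OF YF.vlim_coord[OF y(2) seq_value[OF s x] y(1)] P(2)])
        (auto intro!: YF.coord y XE.coord x point[OF s] P)
    then have "y = (\<lambda>j. P (x j))" by auto
    then show ?thesis using y by simp
  qed
  have PS: "P \<in> S"
    using P_poly seq_lim by (intro S_I) auto
  \<comment> \<open>The Cauchy estimate is kept for one sequence \<open>x\<close> while
    \<open>l\<close> tends to infinity; the supremum over \<open>x\<close> is taken
    afterwards.\<close>
  have close: "N1 (s k \<boxminus> P) \<le> e" if "\<forall>l\<ge>M. N1 (s k \<boxminus> s l) < e" for k M e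
  proof (rule summing_poly.N1_le[OF member[OF S_diff[OF s PS]]])
    fix x assume x: "x \<in> pts (X E)" "vnorm (X E) x \<le> 1"
    let ?s = "\<lambda>l j. s l (x j)" and ?P = "\<lambda>j. P (x j)"
    have mem: "?s l \<in> pts (Y F)" "?P \<in> pts (Y F)" for l
      using seq_value[OF s x(1)] seq_value[OF PS x(1)] .
    have "vnorm (Y F) (vsub (Y F) (?s k) ?P) \<le> e + vnorm (Y F) (vsub (Y F) (?s l) ?P)" if "l \<ge> M" for l
    proof -
      have "vnorm (Y F) (vsub (Y F) (?s k) (?s l)) \<le> N1 (s k \<boxminus> s l)"
        using summing_poly.N1_bound[OF member[OF sd] x, of k l] by (simp only: seq_diff[OF s s x(1)])
      also have "\<dots> < e"
        using \<open>\<forall>l\<ge>M. N1 (s k \<boxminus> s l) < e\<close> that by blast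
      finally show ?thesis
        using YF.V.norm_vsub_triangle[OF mem(1)[of k] mem(1)[of l] mem(2)] by linarith
    qed
    moreover have "(\<lambda>l. e + vnorm (Y F) (vsub (Y F) (?s l) ?P)) \<longlonglongrightarrow> e + 0"
      using seq_lim[OF x(1)] by (intro tendsto_add tendsto_const) (simp add: vlim_def)
    ultimately have "vnorm (Y F) (vsub (Y F) (?s k) ?P) \<le> e + 0"
      by (intro LIMSEQ_le_const[of "\<lambda>l. e + vnorm (Y F) (vsub (Y F) (?s l) ?P)"]) auto
    then show "vnorm (Y F) (\<lambda>j. (s k \<boxminus> P) (x j)) \<le> e"
      by (simp only: seq_diff[OF s PS x(1)])
  qed
  have "(\<lambda>k. N (s k \<boxminus> P)) \<longlonglongrightarrow> 0"
  proof (rule null_seq_le)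
    show "(\<lambda>k. K * N1 (s k \<boxminus> P)) \<longlonglongrightarrow> 0"
    proof (intro tendsto_mult_right_zero LIMSEQ_I)
      fix e :: real assume e: "0 < e"
      then obtain M where M: "\<forall>k\<ge>M. \<forall>l\<ge>M. N1 (s k \<boxminus> s l) < e / 2"
        using cauchy[of "e / 2"] by auto
      have "norm (N1 (s k \<boxminus> P) - 0) < e" if "k \<ge> M" for k
        using close[of M k "e / 2"] M that e summing_poly.N1_nonneg[OF member[OF S_diff[OF s PS]], of k] by auto
      then show "\<exists>M. \<forall>k\<ge>M. norm (N1 (s k \<boxminus> P) - 0) < e" by blast
    qed
    show "\<bar>N (s k \<boxminus> P)\<bar> \<le> K * N1 (s k \<boxminus> P)" for k
      using upper[OF S_diff[OF s PS], of k] lower[OF S_diff[OF s PS], of k]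
        summing_poly.N1_nonneg[OF member[OF S_diff[OF s PS]], of k] by simp
  qed
  then have "vlim (map_space E F S N) s P"
    unfolding vlim_def vsub_map_space by (simp add: map_space_def)
  then show "\<exists>P\<in>pts (map_space E F S N). vlim (map_space E F S N) s P"
    using PS by (auto simp: map_space_def)
qed

lemma banach_N1: "banach_nspace (map_space E F S N1)"
  by (rule complete_equivalent[OF normed_N1, of 1]) auto

lemma banach_N2: "banach_nspace (map_space E F S N2)"
  by (rule complete_equivalent[OF normed_N2 summing_poly.N1_le_N2[OF member] summing_poly.N2_le_N1[OF member]])

end

section \<open>The hyper-ideal property\<close>

text \<open>An \<open>m * n\<close>-tuple is read as \<open>n\<close> consecutive tuples of length
  \<open>m\<close>; index \<open>q\<close> sits in block \<open>q div m\<close> at place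
  \<open>q mod m\<close>.\<close>

abbreviation block :: "nat \<Rightarrow> (nat \<Rightarrow> 'a) \<Rightarrow> nat \<Rightarrow> nat \<Rightarrow> 'a" where
  "block m x i \<equiv> \<lambda>k\<in>{..<m}. x (i * m + k)"

lemma block_index: "\<lbrakk>i < n; k < m\<rbrakk> \<Longrightarrow> i * m + k < m * (n :: nat)"
proof -
  assume "i < n" "k < m"
  then have "i * m + k < Suc i * m" "Suc i * m \<le> n * m"
    by (simp, intro mult_right_mono) auto
  then show ?thesis
    by (simp add: mult.commute)
qed

lemma block_tuple: "\<lbrakk>x \<in> tuples_in (m * n) E; i < n\<rbrakk> \<Longrightarrow> block m x i \<in> tuples_in m E"
  by (auto simp: PiE_iff block_index)

lemma block_upd:
  assumes "1 \<le> m" "i < n"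
  shows "block m (x(q := y)) i = (if i = q div m then (block m x i)(q mod m := y) else block m x i)"
proof
  fix k
  have "k < m \<Longrightarrow> i * m + k = q \<longleftrightarrow> i = q div m \<and> k = q mod m"
    by auto
  then show "block m (x(q := y)) i k
      = (if i = q div m then (block m x i)(q mod m := y) else block m x i) k"
    using assms by (auto simp: Suc_le_eq)
qed

locale composition = summing_poly X Y n E F P
  for X Y :: "('k::{real_normed_field,banach}, 'u) seq_rule" and n E F P +
  fixes m :: nat and G H :: "('k, 'k + 'u) nspace" and R t :: "'k + 'u \<Rightarrow> 'k + 'u"
  assumes banach_G: "banach_nspace G" and banach_H: "banach_nspace H" and degree_R: "1 \<le> m"
    and R_poly: "R \<in> polys m G E" and t_linop: "t \<in> linops F H"
begin

sublocale G: banach_nspace G by (rule banach_G)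
sublocale H: banach_nspace H by (rule banach_H)
sublocale XG: seq_space G "X G" by (rule seq_X[OF banach_G])
sublocale YH: seq_space H "Y H" by (rule seq_Y[OF banach_H])
sublocale R: polynomial m G E R
  using R_poly degree_R by unfold_locales
sublocale t: linop F H t
  using t_linop by unfold_locales

abbreviation "T \<equiv> restrict (t \<circ> P \<circ> R) (pts G)"

text \<open>Its diagonal is \<open>t \<circ> P \<circ> R\<close>, but \<open>D\<close> need not be
  invariant under permutations that mix the blocks, so it is not yet the polar.\<close>

definition "D = (\<lambda>x\<in>tuples_in (m * n) G. t (A (\<lambda>i\<in>{..<n}. R.A (block m x i))))"

lemma blocks_tuple: "x \<in> tuples_in (m * n) G \<Longrightarrow> (\<lambda>i\<in>{..<n}. R.A (block m x i)) \<in> tuples_in n E"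
  by (auto intro!: R.A.into block_tuple)

text \<open>Exactly one block contains the index \<open>q\<close>. Linearity of \<open>D\<close> in
  coordinate \<open>q\<close> thereby follows from that of \<open>R.A\<close> in place
  \<open>q mod m\<close> and that of \<open>A\<close> in place \<open>q div m\<close>.\<close>

lemma blocks_upd:
  assumes "q < m * n"
  shows "(\<lambda>i\<in>{..<n}. R.A (block m (x(q := y)) i))
    = (\<lambda>i\<in>{..<n}. R.A (block m x i))(q div m := R.A ((block m x (q div m))(q mod m := y)))"
proof
  fix i
  have "q div m < n"
    using assms by (simp add: less_mult_imp_div_less mult.commute)
  show "(\<lambda>i\<in>{..<n}. R.A (block m (x(q := y)) i)) i
      = ((\<lambda>i\<in>{..<n}. R.A (block m x i))(q div m := R.A ((block m x (q div m))(q mod m := y)))) i"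
  proof (cases "i < n")
    case True
    then have "(\<lambda>i\<in>{..<n}. R.A (block m (x(q := y)) i)) i
        = R.A (if i = q div m then (block m x i)(q mod m := y) else block m x i)"
      by (simp only: restrict_apply lessThan_iff if_True block_upd[OF degree_R])
    then show ?thesis
      using True by (cases "i = q div m") (simp_all only: fun_upd_same fun_upd_other restrict_apply
        lessThan_iff if_True if_False refl not_False_eq_True)
  next
    case False
    then show ?thesis
      using \<open>q div m < n\<close> by auto
  qed
qed

lemma multilinear_D: "multilinear_power (m * n) G H D"
proof (intro multilinear_power.intro G.normed_nspace_axioms H.normed_nspace_axioms)
  show "multilinear (m * n) (\<lambda>_. G) H D"
    unfolding multilinear_def
  proof (intro conjI allI impI ballI)
    show "D \<in> tuples_in (m * n) G \<rightarrow>\<^sub>E pts H"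
    proof (rule PiE_I)
      show "D x \<in> pts H" if "x \<in> tuples_in (m * n) G" for x
        unfolding D_def restrict_apply'[OF that] by (intro t.into A.into blocks_tuple that)
    qed (simp add: D_def)
    fix q x y assume q: "q < m * n" and x: "x \<in> tuples_in (m * n) G" and y: "y \<in> pts G"
    have dm: "q div m < n" "q mod m < m"
      using q degree_R by (simp_all add: less_mult_imp_div_less mult.commute Suc_le_eq)
    let ?c = "block m x (q div m)" and ?b = "\<lambda>i\<in>{..<n}. R.A (block m x i)"
    have c: "?c \<in> tuples_in m G"
      by (rule block_tuple[OF x dm(1)])
    have b: "?b \<in> tuples_in n E"
      by (rule blocks_tuple[OF x])
    have R_into: "R.A (?c(q mod m := v)) \<in> pts E" if "v \<in> pts G" for v
      by (intro R.A.into upd_tuple c that dm)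
    have A_into: "A (?b(q div m := v)) \<in> pts F" if "v \<in> pts E" for v
      by (intro A.into upd_tuple b that dm)
    have D_upd: "D (x(q := v)) = t (A (?b(q div m := R.A (?c(q mod m := v)))))" if "v \<in> pts G" for v
      unfolding D_def restrict_apply'[OF upd_tuple[OF x that q]] blocks_upd[OF q] ..
    show "D (x(q := vadd G y z)) = vadd H (D (x(q := y))) (D (x(q := z)))" if z: "z \<in> pts G" for z
      unfolding D_upd[OF y] D_upd[OF z] D_upd[OF G.add_closed[OF y z]] R.A.add_coord[OF dm(2) c y z]
        A.add_coord[OF dm(1) b R_into[OF y] R_into[OF z]]
      by (intro t.add A_into R_into y z)
    show "D (x(q := vscale G c y)) = vscale H c (D (x(q := y)))" for c
      unfolding D_upd[OF y] D_upd[OF G.scale_closed[OF y]] R.A.scale_coord[OF dm(2) c y]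
        A.scale_coord[OF dm(1) b R_into[OF y]]
      by (intro t.scale A_into R_into y)
  qed
qed

sublocale D: multilinear_power "m * n" G H D by (rule multilinear_D)

lemma degree_T: "1 \<le> m * n"
  using degree degree_R by simp

lemma diagonal_D:
  assumes v: "v \<in> pts G"
  shows "T v = D (\<lambda>i\<in>{..<m * n}. v)"
proof -
  have "block m (\<lambda>i\<in>{..<m * n}. v) i = (\<lambda>k\<in>{..<m}. v)" if "i < n" for i
    using that by (auto simp: block_index)
  then have "(\<lambda>i\<in>{..<n}. R.A (block m (\<lambda>i\<in>{..<m * n}. v) i)) = (\<lambda>i\<in>{..<n}. R v)"
    by (intro restrict_ext) (simp only: R.diagonal[OF v] lessThan_iff)
  then show ?thesis
    using v by (simp only: D_def restrict_apply'[OF const_tuple[OF v]] restrict_apply'[OF v] o_apply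
        diagonal[OF R.P.into[OF v]])
qed

lemma T_poly: "T \<in> polys (m * n) G H"
proof (rule D.diagonal_in_polys[OF diagonal_D degree_T])
  fix v assume v: "v \<in> pts G" "vnorm G v \<le> 1"
  have "vnorm H (T v) \<le> ball_norm F H t * vnorm F (P (R v))"
    using t.norm_le[OF P.into[OF R.P.into[OF v(1)]]] v by simp
  also have "\<dots> \<le> ball_norm F H t * (ball_norm E F P * ball_norm G E R ^ n)"
  proof (rule mult_left_mono[OF _ t.norm_nonneg])
    have "vnorm F (P (R v)) \<le> ball_norm E F P * vnorm E (R v) ^ n"
      by (rule P_norm[OF R.P.into[OF v(1)]])
    also have "\<dots> \<le> ball_norm E F P * ball_norm G E R ^ n"
      by (intro mult_left_mono power_mono R.P_bound v P_norm_nonneg E.norm_nonneg R.P.into)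
    finally show "vnorm F (P (R v)) \<le> ball_norm E F P * ball_norm G E R ^ n" .
  qed
  finally show "vnorm H (T v) \<le> ball_norm F H t * (ball_norm E F P * ball_norm G E R ^ n)" .
qed (simp_all only: restrict_extensional)

text \<open>The bound on unit vectors that polarization gives for the polar of
  \<open>R\<close>.\<close>

definition "C = real m ^ m / fact m * ball_norm G E R"

lemma C_nonneg: "0 \<le> C"
  by (simp add: C_def R.P_norm_nonneg)

text \<open>Multilinear stability of \<open>X\<close> is applied to the polar of \<open>R\<close>
  with its bound \<open>C\<close>; here the polarization constant of degree \<open>m\<close> enters
  the hyper-ideal inequality.\<close>

lemma R_induced:
  assumes x: "x \<in> tuples_in m (X G)"
  shows "induced m R.A x \<in> pts (X E)"
    and "vnorm (X E) (induced m R.A x) \<le> C * (\<Prod>i<m. vnorm (X G) (x i))"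
proof -
  note st = multilinear_stability[of m "\<lambda>_. G" E R.A, OF degree_R banach_G banach_E R.A.multilinear_B
      R.A_bound, of x, folded C_def]
  show "induced m R.A x \<in> pts (X E)"
    by (rule st(1)) (simp_all only: x)
  show "vnorm (X E) (induced m R.A x) \<le> C * (\<Prod>i<m. vnorm (X G) (x i))"
    by (rule st(2)) (simp_all only: x)
qed

lemma R_seq:
  assumes x: "x \<in> pts (X G)"
  shows "(\<lambda>j. R (x j)) \<in> pts (X E)" and "vnorm (X E) (\<lambda>j. R (x j)) \<le> C * vnorm (X G) x ^ m"
proof -
  have "(\<lambda>k\<in>{..<m}. (\<lambda>k\<in>{..<m}. x) k j) = (\<lambda>k\<in>{..<m}. x j)" for j
    by auto
  then have eq: "induced m R.A (\<lambda>k\<in>{..<m}. x) = (\<lambda>j. R (x j))"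
    by (intro ext) (simp only: induced_eq R.diagonal[OF XG.coord[OF x]])
  show "(\<lambda>j. R (x j)) \<in> pts (X E)"
    using R_induced(1)[OF const_tuple[OF x]] by (simp only: eq)
  show "vnorm (X E) (\<lambda>j. R (x j)) \<le> C * vnorm (X G) x ^ m"
    using R_induced(2)[OF const_tuple[OF x]] unfolding eq by simp
qed

lemma T_seq:
  assumes x: "x \<in> pts (X G)"
  shows "(\<lambda>j. T (x j)) = (\<lambda>j. t (P (R (x j))))"
  using XG.coord[OF x] by simp

lemma T_summing: "T \<in> summing_polys X Y (m * n) G H"
  unfolding summing_polys_def
  using T_poly linear_stability_Y(1)[OF banach_F banach_H t_linop seq_into[OF R_seq(1)]]
  by (simp add: T_seq del: restrict_apply)

sublocale T: summing_poly X Y "m * n" G H T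
  using banach_G banach_H degree_T T_summing
  by (intro summing_poly.intro summing_poly_axioms.intro summing_setup_axioms)

text \<open>For \<open>x\<close> in the unit ball, the sequence of the \<open>R (x j)\<close> has
  norm at most \<open>C\<close> in \<open>X(E)\<close>. The polynomial induced by \<open>P\<close>
  is homogeneous of degree \<open>n\<close>, so \<open>C\<close> appears with exponent
  \<open>n\<close>.\<close>

lemma N1_T: "summing_norm1 X Y (m * n) G H T
    \<le> (real m ^ m / fact m) ^ n * ball_norm F H t * summing_norm1 X Y n E F P * ball_norm G E R ^ n"
proof (rule T.N1_le)
  fix x assume x: "x \<in> pts (X G)" "vnorm (X G) x \<le> 1"
  have "vnorm (Y H) (\<lambda>j. T (x j)) \<le> ball_norm F H t * vnorm (Y F) (\<lambda>j. P (R (x j)))"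
    unfolding T_seq[OF x(1)]
    by (rule linear_stability_Y(2)[OF banach_F banach_H t_linop seq_into[OF R_seq(1)[OF x(1)]]])
  also have "\<dots> \<le> ball_norm F H t * (N1 P * C ^ n)"
  proof (rule mult_left_mono[OF _ t.norm_nonneg])
    have "C * vnorm (X G) x ^ m \<le> C"
      using x C_nonneg XG.V.norm_nonneg by (intro mult_left_le power_le_one) auto
    then have "vnorm (X E) (\<lambda>j. R (x j)) \<le> C"
      using R_seq(2)[OF x(1)] by linarith
    then have "N1 P * vnorm (X E) (\<lambda>j. R (x j)) ^ n \<le> N1 P * C ^ n"
      by (intro mult_left_mono power_mono N1_nonneg XE.V.norm_nonneg R_seq x)
    then show "vnorm (Y F) (\<lambda>j. P (R (x j))) \<le> N1 P * C ^ n"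
      using N1_norm[OF R_seq(1)[OF x(1)]] by linarith
  qed
  finally show "vnorm (Y H) (\<lambda>j. T (x j))
      \<le> (real m ^ m / fact m) ^ n * ball_norm F H t * N1 P * ball_norm G E R ^ n"
    by (simp only: C_def power_mult_distrib mult_ac)
qed

text \<open>On sequences \<open>D\<close> is again nested: the polar of \<open>R\<close> acts on
  each of the \<open>n\<close> blocks, then the polar of \<open>P\<close>, then \<open>t\<close>.
  Each block contributes one factor \<open>C\<close>.\<close>

lemma induced_D:
  assumes x: "x \<in> tuples_in (m * n) (X G)" "\<And>i. i < m * n \<Longrightarrow> vnorm (X G) (x i) \<le> 1"
  shows "induced (m * n) D x \<in> pts (Y H)"
    and "vnorm (Y H) (induced (m * n) D x) \<le> ball_norm F H t * (N2 P * C ^ n)"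
proof -
  let ?y = "\<lambda>i\<in>{..<n}. induced m R.A (block m x i)"
  have bx: "block m x i \<in> tuples_in m (X G)" if "i < n" for i
    using x(1) that by (rule block_tuple)
  have y: "?y \<in> tuples_in n (X E)"
    by (auto intro!: R_induced bx)
  have "induced (m * n) D x j = t (induced n A ?y j)" for j
  proof -
    have xj: "(\<lambda>q\<in>{..<m * n}. x q j) \<in> tuples_in (m * n) G"
      using x(1) by (auto intro: XG.coord)
    have "block m (\<lambda>q\<in>{..<m * n}. x q j) i = (\<lambda>k\<in>{..<m}. block m x i k j)" if "i < n" for i
      using that by (auto simp: block_index)
    then have "(\<lambda>i\<in>{..<n}. R.A (block m (\<lambda>q\<in>{..<m * n}. x q j) i)) = (\<lambda>i\<in>{..<n}. ?y i j)"
      by (intro restrict_ext) (simp only: lessThan_iff restrict_apply if_True induced_eq)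
    then show ?thesis
      by (simp only: induced_eq D_def restrict_apply'[OF xj])
  qed
  then have eq: "induced (m * n) D x = (\<lambda>j. t (induced n A ?y j))"
    by (intro ext)
  note st = linear_stability_Y[OF banach_F banach_H t_linop induced_into[OF y]]
  show "induced (m * n) D x \<in> pts (Y H)"
    unfolding eq by (rule st(1))
  have "vnorm (Y H) (induced (m * n) D x) \<le> ball_norm F H t * vnorm (Y F) (induced n A ?y)"
    unfolding eq by (rule st(2))
  also have "\<dots> \<le> ball_norm F H t * (N2 P * C ^ n)"
  proof (rule mult_left_mono[OF _ t.norm_nonneg])
    have "vnorm (X E) (?y i) \<le> C" if i: "i < n" for i
    proof -
      have "(\<Prod>k<m. vnorm (X G) (block m x i k)) \<le> 1"
        using i x(2) bx[OF i] XG.V.norm_nonneg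
        by (intro prod_le_1) (auto simp: block_index PiE_iff)
      then have "C * (\<Prod>k<m. vnorm (X G) (block m x i k)) \<le> C"
        using C_nonneg by (intro mult_left_le)
      then show ?thesis
        using R_induced(2)[OF bx[OF i]] i by simp
    qed
    then have "(\<Prod>i<n. vnorm (X E) (?y i)) \<le> (\<Prod>i<n. C)"
      using y XE.V.norm_nonneg by (intro prod_mono) (auto simp: PiE_iff)
    then have "N2 P * (\<Prod>i<n. vnorm (X E) (?y i)) \<le> N2 P * C ^ n"
      by (intro mult_left_mono N2_nonneg) simp
    then show "vnorm (Y F) (induced n A ?y) \<le> N2 P * C ^ n"
      using N2_norm[OF y] by linarith
  qed
  finally show "vnorm (Y H) (induced (m * n) D x) \<le> ball_norm F H t * (N2 P * C ^ n)" .
qed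

lemma polar_T: "T.A = symmetrize (m * n) G H D"
  by (rule D.polar_eq_symmetrize) (rule diagonal_D)

text \<open>The polar of \<open>t \<circ> P \<circ> R\<close> is the symmetrization of \<open>D\<close>, and symmetrizing does not
  increase the norm; estimating it through the polarization inequality instead would lose a factor.\<close>

lemma N2_T: "summing_norm2 X Y (m * n) G H T
    \<le> (real m ^ m / fact m) ^ n * ball_norm F H t * summing_norm2 X Y n E F P * ball_norm G E R ^ n"
proof (rule T.N2_le)
  fix x assume x: "x \<in> tuples_in (m * n) (X G)" "\<And>i. i < m * n \<Longrightarrow> vnorm (X G) (x i) \<le> 1"
  let ?M = "ball_norm F H t * (N2 P * C ^ n)"
  let ?d = "\<lambda>\<sigma>. induced (m * n) D (x \<circ> \<sigma>)"
  \<comment> \<open>Permuting the arguments keeps them in the unit ball, so every summand of the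
    symmetrization satisfies the same bound.\<close>
  have d: "?d \<sigma> \<in> pts (Y H)" "vnorm (Y H) (?d \<sigma>) \<le> ?M" if "\<sigma> \<in> perms (m * n)" for \<sigma>
  proof -
    have s: "\<sigma> permutes {..<m * n}" using that by simp
    have "vnorm (X G) ((x \<circ> \<sigma>) i) \<le> 1" if "i < m * n" for i
      using x(2) permutes_in_image[OF s, of i] that by simp
    then show "?d \<sigma> \<in> pts (Y H)" "vnorm (Y H) (?d \<sigma>) \<le> ?M"
      by (intro induced_D perm_tuple s x; assumption)+
  qed
  then have d': "?d ` perms (m * n) \<subseteq> pts (Y H)"
    by blast
  \<comment> \<open>The average over permutations is formed in \<open>Y(H)\<close>, where the
    triangle inequality is available; the identity is checked in each coordinate.\<close>
  have "induced (m * n) T.A x = vscale (Y H) (1 / fact (m * n)) (vsum (Y H) ?d (perms (m * n)))"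
  proof
    fix j
    have xj: "(\<lambda>q\<in>{..<m * n}. x q j) \<in> tuples_in (m * n) G"
      using x(1) by (auto intro: XG.coord)
    have xs: "(\<lambda>q\<in>{..<m * n}. x q j) \<circ> \<sigma> = (\<lambda>q\<in>{..<m * n}. (x \<circ> \<sigma>) q j)" if "\<sigma> \<in> perms (m * n)" for \<sigma>
      using that permutes_in_image[of \<sigma> "{..<m * n}"] by (auto simp: fun_eq_iff)
    have "induced (m * n) T.A x j = vscale H (1 / fact (m * n))
        (vsum H (\<lambda>\<sigma>. D ((\<lambda>q\<in>{..<m * n}. x q j) \<circ> \<sigma>)) (perms (m * n)))"
      unfolding induced_eq polar_T D.symmetrize_eq[OF xj] ..
    also have "vsum H (\<lambda>\<sigma>. D ((\<lambda>q\<in>{..<m * n}. x q j) \<circ> \<sigma>)) (perms (m * n))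
        = vsum H (\<lambda>\<sigma>. ?d \<sigma> j) (perms (m * n))"
    proof (rule H.vsum_cong[OF refl])
      show "D ((\<lambda>q\<in>{..<m * n}. x q j) \<circ> \<sigma>) = ?d \<sigma> j" if "\<sigma> \<in> perms (m * n)" for \<sigma>
        unfolding induced_eq xs[OF that] ..
      show "(\<lambda>\<sigma>. ?d \<sigma> j) ` perms (m * n) \<subseteq> pts H"
        by (rule image_subsetI) (rule YH.coord[OF d(1)])
    qed
    finally show "induced (m * n) T.A x j
        = vscale (Y H) (1 / fact (m * n)) (vsum (Y H) ?d (perms (m * n))) j"
      unfolding YH.vscale_eq[OF YH.V.vsum_closed[OF d']] unfolding YH.vsum_eq[OF finite_perms d'] .
  qed
  then have "vnorm (Y H) (induced (m * n) T.A x) = 1 / fact (m * n) * vnorm (Y H) (vsum (Y H) ?d (perms (m * n)))"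
    by (simp only: YH.V.norm_scale YH.V.vsum_closed d') (simp add: norm_divide)
  also have "\<dots> \<le> 1 / fact (m * n) * (\<Sum>\<sigma>\<in>perms (m * n). ?M)"
    by (intro mult_left_mono order_trans[OF YH.V.norm_vsum[OF d']] sum_mono d) auto
  also have "\<dots> = ?M"
    by (simp add: card_perms)
  finally show "vnorm (Y H) (induced (m * n) T.A x)
      \<le> (real m ^ m / fact m) ^ n * ball_norm F H t * N2 P * ball_norm G E R ^ n"
    by (simp only: C_def power_mult_distrib mult_ac)
qed

end

section \<open>Polynomials of finite type\<close>

context summing_component
begin

context
  fixes \<phi> :: "'k + 'u \<Rightarrow> 'k + 'u" and b :: "'k + 'u"
  assumes \<phi>: "\<phi> \<in> linops E (scalars :: ('k, 'k + 'u) nspace)" and b: "b \<in> pts F"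
begin

definition rank_one :: "'k + 'u \<Rightarrow> 'k + 'u" where
  "rank_one = (\<lambda>x\<in>pts E. vscale F (projl (\<phi> x) ^ n) b)"

definition rank_one_polar :: "(nat \<Rightarrow> 'k + 'u) \<Rightarrow> 'k + 'u" where
  "rank_one_polar = (\<lambda>x\<in>tuples_in n E. vscale F (\<Prod>i<n. projl (\<phi> (x i))) b)"

interpretation \<phi>: linop E "scalars :: ('k, 'k + 'u) nspace" \<phi>
  using \<phi> banach_scalars by (auto intro!: linop.intro E.normed_nspace_axioms simp: banach_nspace_def)

lemma rank_one_multilinear: "multilinear_power n E F rank_one_polar"
proof (intro multilinear_power.intro E.normed_nspace_axioms F.normed_nspace_axioms)
  show "multilinear n (\<lambda>_. E) F rank_one_polar"
    unfolding multilinear_def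
  proof (intro conjI allI impI ballI)
    show "rank_one_polar \<in> tuples_in n E \<rightarrow>\<^sub>E pts F"
      by (auto simp: rank_one_polar_def F.scale_closed b)
    fix i x y assume i: "i < n" and x: "x \<in> tuples_in n E" and y: "y \<in> pts E"
    define c where "c = (\<Prod>j\<in>{..<n} - {i}. projl (\<phi> (x j)))"
    have upd: "rank_one_polar (x(i := v)) = vscale F (projl (\<phi> v) * c) b" if "v \<in> pts E" for v
    proof -
      have "(\<Prod>j<n. projl (\<phi> ((x(i := v)) j))) = projl (\<phi> v) * c"
        unfolding c_def using i by (subst prod.remove[of _ i]) (auto intro!: prod.cong)
      then show ?thesis
        unfolding rank_one_polar_def restrict_apply'[OF upd_tuple[OF x that i]] by simp
    qed
    show "rank_one_polar (x(i := vadd E y z)) = vadd F (rank_one_polar (x(i := y))) (rank_one_polar (x(i := z)))"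
      if z: "z \<in> pts E" for z
    proof -
      have "projl (\<phi> (vadd E y z)) = projl (\<phi> y) + projl (\<phi> z)"
        by (simp add: \<phi>.add y z) (simp add: scalars_def)
      then show ?thesis
        by (simp only: upd y z E.add_closed distrib_right F.scale_add_left b)
    qed
    show "rank_one_polar (x(i := vscale E d y)) = vscale F d (rank_one_polar (x(i := y)))" for d
    proof -
      have "projl (\<phi> (vscale E d y)) = d * projl (\<phi> y)"
        by (simp add: \<phi>.scale[unfolded power_one_right] y) (simp add: scalars_def)
      then show ?thesis
        by (simp only: upd y E.scale_closed F.scale_scale b mult.assoc)
    qed
  qed
qed

lemma rank_one_diagonal:
  assumes "v \<in> pts E"
  shows "rank_one v = rank_one_polar (\<lambda>i\<in>{..<n}. v)"
proof -
  have "(\<Prod>i<n. projl (\<phi> ((\<lambda>i\<in>{..<n}. v) i))) = (\<Prod>i<n. projl (\<phi> v))"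
    by (intro prod.cong) auto
  then show ?thesis
    by (simp only: rank_one_polar_def rank_one_def restrict_apply' const_tuple assms
        prod_constant card_lessThan)
qed

lemma rank_one_polynomial: "polynomial n E F rank_one"
proof (intro polynomial.intro E.normed_nspace_axioms F.normed_nspace_axioms degree)
  interpret B: multilinear_power n E F rank_one_polar by (rule rank_one_multilinear)
  show "rank_one \<in> polys n E F"
  proof (rule B.diagonal_in_polys[OF rank_one_diagonal degree])
    show "rank_one \<in> extensional (pts E)"
      unfolding rank_one_def by (rule restrict_extensional)
    fix v assume v: "v \<in> pts E" "vnorm E v \<le> 1"
    have "norm (projl (\<phi> v)) \<le> ball_norm E (scalars :: ('k, 'k + 'u) nspace) \<phi>"
      using \<phi>.unit_bound[OF v] by (simp add: scalars_def)
    then show "vnorm F (rank_one v) \<le> ball_norm E (scalars :: ('k, 'k + 'u) nspace) \<phi> ^ n * vnorm F b"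
      using v by (simp add: rank_one_def F.norm_scale b norm_power mult_right_mono power_mono F.norm_nonneg)
  qed
qed

lemma polar_rank_one: "polar n E F rank_one = rank_one_polar"
proof -
  interpret polynomial n E F rank_one by (rule rank_one_polynomial)
  show ?thesis
  proof (rule polar_unique[OF rank_one_multilinear _ rank_one_diagonal])
    show "symmetric_map n E rank_one_polar"
      unfolding symmetric_map_def
    proof (intro allI impI ballI)
      fix \<sigma> x assume s: "\<sigma> permutes {..<n}" and x: "x \<in> tuples_in n E"
      show "rank_one_polar (x \<circ> \<sigma>) = rank_one_polar x"
        unfolding rank_one_polar_def restrict_apply'[OF x] restrict_apply'[OF perm_tuple[OF s x]]
        using prod.permute[OF s, of "\<lambda>i. projl (\<phi> (x i))"] by (simp add: o_def)
    qed
  qed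
qed

text \<open>\<open>\<phi>\<close> sends sequences of \<open>X(E)\<close> to scalar sequences of the
  class \<open>X\<close>, compatibility puts their \<open>n\<close>-th powers into the scalar
  sequences of \<open>Y\<close>, and multiplication by \<open>b\<close> leads to
  \<open>Y(F)\<close>.\<close>

lemma rank_one_summing: "rank_one \<in> S"
proof (rule S_I[OF rank_one_polynomial])
  fix x assume x: "x \<in> pts (X E)"
  let ?K = "scalars :: ('k, 'k + 'u) nspace"
  let ?u = "\<lambda>z\<in>pts ?K. vscale F (projl z) b"
  have Inl: "\<phi> (x j) = Inl (projl (\<phi> (x j)))" for j
    using \<phi>.into[OF XE.coord[OF x], of j] by (auto simp: scalars_def)
  have "(\<lambda>j. Inl (projl (\<phi> (x j)))) \<in> pts (X ?K)"
    using linear_stability_X(1)[OF banach_E banach_scalars \<phi> x] by (simp flip: Inl)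
  \<comment> \<open>The power is written as a product of \<open>n\<close> equal factors, the form in
    which \<open>power_embeds\<close> applies.\<close>
  then have "(\<lambda>j. Inl (\<Prod>m<n. projl (\<phi> (x j)))) \<in> pts (Y ?K)"
    using compatible[OF degree] unfolding power_embeds_def
    by (elim allE[of _ "\<lambda>_ j. projl (\<phi> (x j))"]) simp
  from linear_stability_Y(1)[OF banach_scalars banach_F multiples_linop(1)[OF banach_F b] this]
  show "(\<lambda>j. rank_one (x j)) \<in> pts (Y F)"
    using XE.coord[OF x] by (simp add: rank_one_def scalars_def)
qed

end

lemma finite_type_subset: "finite_type_polys n E F \<subseteq> S"
proof
  fix P assume "P \<in> finite_type_polys n E F"
  then show "P \<in> S"
    unfolding finite_type_polys_def
  proof induction
    case zero
    show ?case
      unfolding map_space_def nspace.simps by (rule S_zero)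
  next
    case (step P g c)
    then obtain \<phi> b where "\<phi> \<in> linops E (scalars :: ('k, 'k + 'u) nspace)" "b \<in> pts F"
        "g = (\<lambda>x\<in>pts E. vscale F (projl (\<phi> x) ^ n) b)"
      by blast
    then have "g \<in> S"
      using rank_one_summing rank_one_def by metis
    then show ?case
      unfolding map_space_def nspace.simps by (intro S_add step.IH S_scale)
  qed
qed

end

text \<open>Both norms are squeezed in \<open>1 \<le> N1 \<le> N2 \<le> 1\<close>. The first
  inequality evaluates at \<open>unit_seq 0\<close>, which the power map fixes and which has norm
  \<open>1\<close> in both classes. The last is compatibility, since the polar multiplies its
  arguments.\<close>

lemma (in summing_setup) norm_power_map:
  fixes K :: "('k, 'k + 'u) nspace"
  defines "K \<equiv> scalars"
  assumes n: "1 \<le> n"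
  shows "summing_norm1 X Y n K K (\<lambda>x\<in>pts K. Inl (projl x ^ n)) = 1"
    and "summing_norm2 X Y n K K (\<lambda>x\<in>pts K. Inl (projl x ^ n)) = 1"
proof -
  have K: "banach_nspace K"
    unfolding K_def by (rule banach_scalars)
  interpret summing_component X Y n K K
    by (intro summing_component.intro summing_component_axioms.intro summing_setup_axioms K n)
  \<comment> \<open>The power map is the rank-one polynomial of the identity functional and the
    vector \<open>1\<close>, which makes its polar explicit.\<close>
  define \<phi> where "\<phi> = (\<lambda>x\<in>pts K. x)"
  have \<phi>: "\<phi> \<in> linops K scalars"
    unfolding K_def[symmetric]
    by (rule linopsI[OF E.normed_nspace_axioms E.normed_nspace_axioms, where C = 1])
      (simp_all add: \<phi>_def E.closed)
  have one: "Inl 1 \<in> pts K"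
    by (simp add: K_def scalars_def)
  let ?I = "\<lambda>x\<in>pts K. Inl (projl x ^ n)"
  have I: "?I = rank_one \<phi> (Inl 1)"
    unfolding rank_one_def[OF \<phi> one] by (intro restrict_ext) (simp add: \<phi>_def, simp add: K_def scalars_def)
  then have mem: "?I \<in> S"
    using rank_one_summing[OF \<phi> one] by simp
  interpret I: summing_poly X Y n K K ?I
    by (rule member[OF mem])
  have "N2 ?I \<le> 1"
  proof (rule I.N2_le)
    fix x assume x: "x \<in> tuples_in n (X K)" "\<And>i. i < n \<Longrightarrow> vnorm (X K) (x i) \<le> 1"
    define l where "l m j = projl (x m j)" for m j
    have xK: "x m j \<in> pts K" if "m < n" for m j
      by (rule XE.coord[OF tuple_mem[OF x(1) that]])
    have xl: "x m = (\<lambda>j. Inl (l m j))" if "m < n" for m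
    proof
      fix j show "x m j = Inl (l m j)"
        using xK[OF that, of j] by (auto simp: l_def K_def scalars_def)
    qed
    have "induced n (polar n K K ?I) x = (\<lambda>j. Inl (\<Prod>m<n. l m j))"
      unfolding I polar_rank_one[OF \<phi> one]
    proof
      fix j
      have "(\<lambda>m\<in>{..<n}. x m j) \<in> tuples_in n K"
        using xK by auto
      then have "induced n (rank_one_polar \<phi> (Inl 1)) x j
          = vscale K (\<Prod>i<n. projl (\<phi> ((\<lambda>m\<in>{..<n}. x m j) i))) (Inl 1)"
        by (simp only: induced_eq rank_one_polar_def[OF \<phi> one] restrict_apply')
      also have "(\<Prod>i<n. projl (\<phi> ((\<lambda>m\<in>{..<n}. x m j) i))) = (\<Prod>m<n. l m j)"
        using xK by (intro prod.cong) (simp_all add: \<phi>_def l_def)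
      finally show "induced n (rank_one_polar \<phi> (Inl 1)) x j = Inl (\<Prod>m<n. l m j)"
        by (simp add: K_def scalars_def)
    qed
    moreover have "(\<lambda>j. Inl (l m j)) \<in> pts (X K)" if "m < n" for m
      using tuple_mem[OF x(1) that] by (simp add: xl[OF that])
    then have "vnorm (Y K) (\<lambda>j. Inl (\<Prod>m<n. l m j)) \<le> (\<Prod>m<n. vnorm (X K) (\<lambda>j. Inl (l m j)))"
      using compatible[OF n] unfolding power_embeds_def K_def by blast
    moreover have "(\<Prod>m<n. vnorm (X K) (\<lambda>j. Inl (l m j))) = (\<Prod>m<n. vnorm (X K) (x m))"
      by (intro prod.cong) (simp_all add: xl)
    moreover have "(\<Prod>m<n. vnorm (X K) (x m)) \<le> 1"
      using x tuple_mem[OF x(1)] XE.V.norm_nonneg by (intro prod_le_1) auto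
    ultimately show "vnorm (Y K) (induced n (polar n K K ?I) x) \<le> 1"
      by simp
  qed
  moreover have "1 \<le> N1 ?I"
  proof -
    have "unit_seq 0 \<in> c00 K"
      by (auto simp: c00_def K_def scalars_def unit_seq_def)
    then have "unit_seq 0 \<in> pts (X K)"
      using c00_X[OF K] by blast
    then have "vnorm (Y K) (\<lambda>j. ?I (unit_seq 0 j)) \<le> N1 ?I"
      by (rule I.N1_bound) (simp add: K_def norm_unit_seq)
    moreover have eq: "(\<lambda>j. ?I (unit_seq 0 j)) = unit_seq 0"
      using n by (auto simp: unit_seq_def K_def scalars_def)
    ultimately have "vnorm (Y K) (unit_seq 0) \<le> N1 ?I"
      by (simp only: eq)
    then show ?thesis
      by (simp only: K_def norm_unit_seq)
  qed
  ultimately show "N1 ?I = 1" "N2 ?I = 1"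
    using I.N1_le_N2 by linarith+
qed

theorem theorem3p3:
  fixes X Y :: "('k::{real_normed_field,banach}, 'u) seq_rule"
  assumes "sequence_class X" and "multilinearly_stable X"
    and "sequence_class Y" and "linearly_stable Y"
    and "\<And>n. 1 \<le> n \<Longrightarrow> power_embeds n X Y"
  shows "polynomial_banach_hyper_ideal (\<lambda>n. real n ^ n / fact n)
           (summing_polys X Y) (summing_norm1 X Y)
       \<and> polynomial_banach_hyper_ideal (\<lambda>n. real n ^ n / fact n)
           (summing_polys X Y) (summing_norm2 X Y)"
proof -
  interpret summing_setup X Y
    using assms by unfold_locales
  have const: "1 \<le> real n ^ n / fact n" for n
    using fact_le_power[of n, where 'a = real] by simp
  have component: "summing_polys X Y n E F \<subseteq> polys n E F" "finite_type_polys n E F \<subseteq> summing_polys X Y n E F"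
      "banach_nspace (map_space E F (summing_polys X Y n E F) (summing_norm1 X Y n E F))"
      "banach_nspace (map_space E F (summing_polys X Y n E F) (summing_norm2 X Y n E F))"
    if "1 \<le> n" "banach_nspace E" "banach_nspace F" for n and E F :: "('k, 'k + 'u) nspace"
  proof -
    interpret summing_component X Y n E F
      using that by (intro summing_component.intro summing_component_axioms.intro summing_setup_axioms)
    show "S \<subseteq> polys n E F"
      by (auto simp: summing_polys_def)
    show "finite_type_polys n E F \<subseteq> S"
      by (rule finite_type_subset)
    show "banach_nspace (map_space E F S N1)" "banach_nspace (map_space E F S N2)"
      by (rule banach_N1 banach_N2)+
  qed
  have comp: "composition X Y n E F P m G H R t"
    if "1 \<le> n" "1 \<le> m" "banach_nspace E" "banach_nspace F" "banach_nspace G" "banach_nspace H"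
      "P \<in> summing_polys X Y n E F" "R \<in> polys m G E" "t \<in> linops F H"
    for n m P R t and E F G H :: "('k, 'k + 'u) nspace"
    using that by (intro composition.intro composition_axioms.intro summing_poly.intro
        summing_poly_axioms.intro summing_setup_axioms)
  \<comment> \<open>The two ideals share their components; the three conditions that involve the
    norm become premises, to be discharged for each norm separately.\<close>
  have ideal: "polynomial_banach_hyper_ideal (\<lambda>n. real n ^ n / fact n) (summing_polys X Y) N"
    if banach: "\<And>n E F. \<lbrakk>1 \<le> n; banach_nspace E; banach_nspace F\<rbrakk>
        \<Longrightarrow> banach_nspace (map_space E F (summing_polys X Y n E F) (N n E F))"
      and one: "\<And>n. 1 \<le> n \<Longrightarrow> N n scalars scalars (\<lambda>x\<in>pts scalars. Inl (projl x ^ n)) = 1"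
      and bound: "\<And>n m E F G H P R t. composition X Y n E F P m G H R t \<Longrightarrow>
        N (m * n) G H (restrict (t \<circ> P \<circ> R) (pts G))
          \<le> (real m ^ m / fact m) ^ n * ball_norm F H t * N n E F P * ball_norm G E R ^ n"
    for N :: "nat \<Rightarrow> ('k, 'k + 'u) nspace \<Rightarrow> ('k, 'k + 'u) nspace \<Rightarrow> ('k + 'u \<Rightarrow> 'k + 'u) \<Rightarrow> real"
    unfolding polynomial_banach_hyper_ideal_def
    by (intro conjI allI impI; (elim conjE)?)
      ((rule const component banach one composition.T_summing[OF comp] bound[OF comp]; assumption) | simp)+
  show ?thesis
    by (intro conjI ideal component norm_power_map composition.N1_T composition.N2_T)
qed

end
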